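(* Use the notation of the context: $M$ is a compact symplectic manifold with $H^{\rm odd}(M;\mathbb{C})=0$, $P$ is its big phase space, and the tensors $\rho_0,C_0,\rho_1,G,A_1,A_2,B$, the quantum product $\bullet$ and the operator $T$ are built from the genus-0 and genus-1 generating functions $F_0,F_1$ of the descendant Gromov-Witten invariants of $M$. Then the two equations (I) $\displaystyle A_{2}(\mathcal{W}_{1}, T(\mathcal{W}_{2})) - (\nabla_{T(\mathcal{W}_{1})} A_{1})(\mathcal{W}_{2}) = 0$ for any vector fields $\mathcal{W}_1,\mathcal{W}_2$ on $P$, and (II) $\displaystyle B(\mathcal{W}_{1}, \mathcal{W}_{2}, T(\mathcal{W}_{3})) - A_{2}(\mathcal{W}_{1}\bullet\mathcal{W}_{2}, \mathcal{W}_{3}) + (\nabla_{\mathcal{W}_{1}\bullet\mathcal{W}_{2}} A_{1})(\mathcal{W}_{3}) = 0$ for all vector fields $\mathcal{W}_1,\mathcal{W}_2,\mathcal{W}_3$ on $P$, can be derived from the known genus-0 and genus-1 relations, namely: the genus-0 topological recursion relation $\rho_0=0$ (and the relation $C_0=0$ obtained from its covariant derivative), the genus-1 topological recursion relation $\rho_1=0$, and Getzler's genus-1 equation $G=0$.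
   Context: **Big phase space.** Let $M$ be a compact symplectic manifold with $H^{\rm odd}(M;\mathbb{C})=0$. Fix a basis $\gamma_1=1,\gamma_2,\ldots,\gamma_N$ of $H^*(M;\mathbb{C})$, where $\gamma_1$ is the identity of the ordinary cohomology ring. Let $\eta_{\alpha\beta}=\int_M\gamma_\alpha\cup\gamma_\beta$, with inverse matrix $(\eta^{\alpha\beta})$, and put $\gamma^\alpha=\eta^{\alpha\beta}\gamma_\beta$. Repeated Greek indices are summed from $1$ to $N$. The big phase space is $P=\prod_{n\ge 0}H^*(M;\mathbb{C})$, with basis $\tau_n(\gamma_\alpha)$ ($n\ge 0$, $1\le\alpha\le N$) and corresponding coordinates $t^\alpha_n$. Identify $\tau_n(\gamma_\alpha)$ with the coordinate vector field $\partial/\partial t^\alpha_n$, and write $\gamma_\alpha=\tau_0(\gamma_\alpha)$. Functions on $P$ are understood as formal power series in the $t^\alpha_n$. Vector fields are (formal) combinations $\sum_{n,\alpha} f_{n,\alpha}\tau_n(\gamma_\alpha)$ with $f_{n,\alpha}$ functions on $P$. Let $\tau_+\big(\sum f_{n,\alpha}\tau_n(\gamma_\alpha)\big)=\sum f_{n,\alpha}\tau_{n+1}(\gamma_\alpha)$. **Correlation functions.** Let $\langle\tau_{n_1}(\gamma_{\alpha_1})\cdots\tau_{n_k}(\gamma_{\alpha_k})\rangle_g$ be the genus-$g$ descendant Gromov-Witten invariant of $M$ associated to the classes $\gamma_{\alpha_i}$ and the integers $n_i\ge 0$. Here $n_i$ is the power of the first Chern class of the tautological line bundle, on the moduli space of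 stable maps from genus-$g$ $k$-pointed curves to $M$, whose fiber is the cotangent space of the domain curve at the $i$-th marked point. The genus-$g$ generating function is $$F_g=\sum_{k\ge0}\frac1{k!}\sum_{\alpha_1,\ldots,\alpha_k,\,n_1,\ldots,n_k}t^{\alpha_1}_{n_1}\cdots t^{\alpha_k}_{n_k}\langle\tau_{n_1}(\gamma_{\alpha_1})\cdots\tau_{n_k}(\gamma_{\alpha_k})\rangle_g .$$ For vector fields $\mathcal{W}_i=\sum f^i_{m,\alpha}\,\partial/\partial t^\alpha_m$, $$\langle\langle\mathcal{W}_1\cdots\mathcal{W}_k\rangle\rangle_g=\sum f^1_{m_1,\alpha_1}\cdots f^k_{m_k,\alpha_k}\frac{\partial^kF_g}{\partial t^{\alpha_1}_{m_1}\cdots\partial t^{\alpha_k}_{m_k}} .$$ **Product, operator $T$, connection.** The quantum product is $\mathcal{W}_1\bullet\mathcal{W}_2=\langle\langle\mathcal{W}_1\,\mathcal{W}_2\,\gamma^\alpha\rangle\rangle_0\,\gamma_\alpha$, and $T(\mathcal{W})=\tau_+(\mathcal{W})-\langle\langle\mathcal{W}\,\gamma^\alpha\rangle\rangle_0\,\gamma_\alpha$. $\nabla$ is the trivial flat connection on $P$ for which all $\tau_n(\gamma_\alpha)$ are parallel; it acts on tensors by $(\nabla_{\mathcal{V}}S)(\mathcal{W}_1,\ldots,\mathcal{W}_k)=\mathcal{V}\big(S(\mathcal{W}_1,\ldots,\mathcal{W}_k)\big)-\sum_iS(\ldots,\nabla_{\mathcal{V}}\mathcal{W}_i,\ldots)$.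 **Derivation.** Deriving an equation from given relations means obtaining it by using those relations, where the covariant derivatives (with respect to $\nabla$) of the relations may also be used. **Genus-0 and genus-1 relations.** $$\rho_0(\mathcal{W}_1,\mathcal{W}_2,\mathcal{W}_3)=\langle\langle T(\mathcal{W}_1)\,\mathcal{W}_2\,\mathcal{W}_3\rangle\rangle_0,$$ $$C_0(\mathcal{W}_1,\mathcal{W}_2,\mathcal{W}_3,\mathcal{W}_4)=(\nabla_{\mathcal{W}_3}\rho_0)(\mathcal{W}_1,\mathcal{W}_2,\mathcal{W}_4)-(\nabla_{\mathcal{W}_2}\rho_0)(\mathcal{W}_1,\mathcal{W}_3,\mathcal{W}_4)=\langle\langle(\mathcal{W}_1\bullet\mathcal{W}_2)\,\mathcal{W}_3\,\mathcal{W}_4\rangle\rangle_0-\langle\langle\mathcal{W}_1\,(\mathcal{W}_2\bullet\mathcal{W}_3)\,\mathcal{W}_4\rangle\rangle_0$$ (so $C_0=0$ implies that $\bullet$ is associative), $$\rho_1(\mathcal{W})=\langle\langle T(\mathcal{W})\rangle\rangle_1-\tfrac1{24}\langle\langle\mathcal{W}\,\gamma^\alpha\,\gamma_\alpha\rangle\rangle_0,$$ $$\begin{aligned} G(\mathcal{W}_1,\mathcal{W}_2,\mathcal{W}_3,\mathcal{W}_4)=\sum_{g\in S_4}\Big\{&3\langle\langle\{\mathcal{W}_{g(1)}\bullet\mathcal{W}_{g(2)}\}\{\mathcal{W}_{g(3)}\bullet\mathcal{W}_{g(4)}\}\rangle\rangle_1-4\langle\langle\{\mathcal{W}_{g(1)}\bullet\mathcal{W}_{g(2)}\bullet\mathcal{W}_{g(3)}\}\mathcal{W}_{g(4)}\rangle\rangle_1\\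 &-\langle\langle\{\mathcal{W}_{g(1)}\bullet\mathcal{W}_{g(2)}\}\mathcal{W}_{g(3)}\mathcal{W}_{g(4)}\gamma^\alpha\rangle\rangle_0\langle\langle\gamma_\alpha\rangle\rangle_1+2\langle\langle\mathcal{W}_{g(1)}\mathcal{W}_{g(2)}\mathcal{W}_{g(3)}\gamma^\alpha\rangle\rangle_0\langle\langle\{\gamma_\alpha\bullet\mathcal{W}_{g(4)}\}\rangle\rangle_1\\ &+\tfrac16\langle\langle\mathcal{W}_{g(1)}\mathcal{W}_{g(2)}\mathcal{W}_{g(3)}\gamma^\alpha\rangle\rangle_0\langle\langle\gamma_\alpha\mathcal{W}_{g(4)}\gamma_\beta\gamma^\beta\rangle\rangle_0\\ &+\tfrac1{24}\langle\langle\mathcal{W}_{g(1)}\mathcal{W}_{g(2)}\mathcal{W}_{g(3)}\mathcal{W}_{g(4)}\gamma^\alpha\rangle\rangle_0\langle\langle\gamma_\alpha\gamma_\beta\gamma^\beta\rangle\rangle_0\\ &-\tfrac14\langle\langle\mathcal{W}_{g(1)}\mathcal{W}_{g(2)}\gamma^\alpha\gamma^\beta\rangle\rangle_0\langle\langle\gamma_\alpha\gamma_\beta\mathcal{W}_{g(3)}\mathcal{W}_{g(4)}\rangle\rangle_0\Big\}. \end{aligned}$$ **The tensors $A_1,A_2,B$.** $$\begin{aligned} A_1(\mathcal{W})=&\tfrac7{10}\langle\langle\gamma_\alpha\rangle\rangle_1\langle\langle\{\gamma^\alpha\bullet\mathcal{W}\}\rangle\rangle_1+\tfrac1{10}\langle\langle\gamma_\alpha\{\gamma^\alpha\bullet\mathcal{W}\}\rangle\rangle_1-\tfrac1{240}\langle\langle\mathcal{W}\{\gamma_\alpha\bullet\gamma^\alpha\}\rangle\rangle_1\\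 &+\tfrac{13}{240}\langle\langle\mathcal{W}\gamma_\alpha\gamma^\alpha\gamma^\beta\rangle\rangle_0\langle\langle\gamma_\beta\rangle\rangle_1+\tfrac1{960}\langle\langle\mathcal{W}\gamma^\alpha\gamma_\alpha\gamma^\beta\gamma_\beta\rangle\rangle_0, \end{aligned}$$ $$\begin{aligned} A_2(\mathcal{W},\mathcal{V})=&\tfrac{13}{10}\langle\langle\mathcal{W}\mathcal{V}\gamma^\alpha\gamma^\beta\rangle\rangle_0\langle\langle\gamma_\alpha\rangle\rangle_1\langle\langle\gamma_\beta\rangle\rangle_1+\tfrac45\langle\langle\mathcal{W}\gamma^\alpha\rangle\rangle_1\langle\langle\{\gamma_\alpha\bullet\mathcal{V}\}\rangle\rangle_1+\tfrac45\langle\langle\mathcal{V}\gamma^\alpha\rangle\rangle_1\langle\langle\{\gamma_\alpha\bullet\mathcal{W}\}\rangle\rangle_1\\ &-\tfrac45\langle\langle\{\mathcal{W}\bullet\mathcal{V}\}\gamma^\alpha\rangle\rangle_1\langle\langle\gamma_\alpha\rangle\rangle_1+\tfrac{23}{240}\langle\langle\mathcal{W}\mathcal{V}\gamma^\alpha\gamma_\alpha\gamma^\beta\rangle\rangle_0\langle\langle\gamma_\beta\rangle\rangle_1\\ &+\tfrac1{48}\langle\langle\mathcal{W}\gamma^\alpha\gamma_\alpha\gamma^\beta\rangle\rangle_0\langle\langle\gamma_\beta\mathcal{V}\rangle\rangle_1+\tfrac1{48}\langle\langle\mathcal{V}\gamma^\alpha\gamma_\alpha\gamma^\beta\rangle\rangle_0\langle\langle\gamma_\beta\mathcal{W}\rangle\rangle_1-\tfrac1{80}\langle\langle\mathcal{W}\mathcal{V}\{\gamma^\alpha\bullet\gamma_\alpha\}\rangle\rangle_1\\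 &+\tfrac7{30}\langle\langle\mathcal{W}\mathcal{V}\gamma^\alpha\gamma^\beta\rangle\rangle_0\langle\langle\gamma_\alpha\gamma_\beta\rangle\rangle_1+\tfrac1{30}\langle\langle\gamma_\alpha\{\gamma^\alpha\bullet\mathcal{W}\}\mathcal{V}\rangle\rangle_1+\tfrac1{30}\langle\langle\gamma_\alpha\{\gamma^\alpha\bullet\mathcal{V}\}\mathcal{W}\rangle\rangle_1\\ &-\tfrac1{30}\langle\langle\{\mathcal{W}\bullet\mathcal{V}\}\gamma_\alpha\gamma^\alpha\rangle\rangle_1+\tfrac1{576}\langle\langle\mathcal{W}\mathcal{V}\gamma^\alpha\gamma_\alpha\gamma^\beta\gamma_\beta\rangle\rangle_0, \end{aligned}$$ $$\begin{aligned} B(\mathcal{W}_1,\mathcal{W}_2,\mathcal{W}_3)=&\tfrac15\langle\langle\mathcal{W}_1\mathcal{W}_2\mathcal{W}_3\gamma^\alpha\gamma^\beta\rangle\rangle_0\langle\langle\gamma_\alpha\rangle\rangle_1\langle\langle\gamma_\beta\rangle\rangle_1-\tfrac65\langle\langle\mathcal{W}_1\mathcal{W}_2\mathcal{W}_3\gamma^\alpha\rangle\rangle_0\langle\langle\gamma_\alpha\gamma^\beta\rangle\rangle_1\langle\langle\gamma_\beta\rangle\rangle_1\\ &+\tfrac1{120}\langle\langle\mathcal{W}_1\mathcal{W}_2\mathcal{W}_3\gamma^\alpha\gamma_\alpha\gamma^\beta\rangle\rangle_0\langle\langle\gamma_\beta\rangle\rangle_1-\tfrac1{120}\langle\langle\mathcal{W}_1\mathcal{W}_2\mathcal{W}_3\{\gamma^\alpha\bullet\gamma_\alpha\}\rangle\rangle_1\\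 &+\tfrac1{10}\langle\langle\mathcal{W}_1\mathcal{W}_2\mathcal{W}_3\gamma^\alpha\gamma^\beta\rangle\rangle_0\langle\langle\gamma_\alpha\gamma_\beta\rangle\rangle_1-\tfrac1{20}\langle\langle\mathcal{W}_1\mathcal{W}_2\mathcal{W}_3\gamma^\alpha\rangle\rangle_0\langle\langle\gamma_\alpha\gamma^\beta\gamma_\beta\rangle\rangle_1\\ &+\sum_{\sigma\in S_3}\Big\{-\tfrac15\langle\langle\mathcal{W}_{\sigma(1)}\mathcal{W}_{\sigma(2)}\gamma^\alpha\gamma^\beta\rangle\rangle_0\langle\langle\gamma_\alpha\rangle\rangle_1\langle\langle\gamma_\beta\mathcal{W}_{\sigma(3)}\rangle\rangle_1+\tfrac25\langle\langle\{\mathcal{W}_{\sigma(1)}\bullet\gamma_\alpha\}\rangle\rangle_1\langle\langle\gamma^\alpha\mathcal{W}_{\sigma(2)}\mathcal{W}_{\sigma(3)}\rangle\rangle_1\\ &\quad-\tfrac35\langle\langle\mathcal{W}_{\sigma(1)}\{\mathcal{W}_{\sigma(2)}\bullet\gamma^\alpha\}\rangle\rangle_1\langle\langle\gamma_\alpha\mathcal{W}_{\sigma(3)}\rangle\rangle_1+\tfrac3{10}\langle\langle\mathcal{W}_{\sigma(1)}\gamma_\alpha\rangle\rangle_1\langle\langle\gamma^\alpha\{\mathcal{W}_{\sigma(2)}\bullet\mathcal{W}_{\sigma(3)}\}\rangle\rangle_1\\ &\quad-\tfrac15\langle\langle\gamma_\alpha\rangle\rangle_1\langle\langle\gamma^\alpha\mathcal{W}_{\sigma(1)}\{\mathcal{W}_{\sigma(2)}\bullet\mathcal{W}_{\sigma(3)}\}\rangle\rangle_1-\tfrac1{80}\langle\langle\mathcal{W}_{\sigma(1)}\mathcal{W}_{\sigma(2)}\gamma^\alpha\gamma_\alpha\gamma^\beta\rangle\rangle_0\langle\langle\gamma_\beta\mathcal{W}_{\sigma(3)}\rangle\rangle_1\\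 &\quad+\tfrac1{80}\langle\langle\mathcal{W}_{\sigma(1)}\gamma^\alpha\gamma_\alpha\gamma^\beta\rangle\rangle_0\langle\langle\gamma_\beta\mathcal{W}_{\sigma(2)}\mathcal{W}_{\sigma(3)}\rangle\rangle_1-\tfrac1{20}\langle\langle\mathcal{W}_{\sigma(1)}\gamma_\alpha\gamma_\beta\rangle\rangle_1\langle\langle\gamma^\alpha\gamma^\beta\mathcal{W}_{\sigma(2)}\mathcal{W}_{\sigma(3)}\rangle\rangle_0\\ &\quad+\tfrac1{60}\langle\langle\mathcal{W}_{\sigma(1)}\mathcal{W}_{\sigma(2)}\gamma_\alpha\{\gamma^\alpha\bullet\mathcal{W}_{\sigma(3)}\}\rangle\rangle_1-\tfrac1{120}\langle\langle\mathcal{W}_{\sigma(1)}\gamma^\alpha\gamma_\alpha\{\mathcal{W}_{\sigma(2)}\bullet\mathcal{W}_{\sigma(3)}\}\rangle\rangle_1\Big\}. \end{aligned}$$ *)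

theory Defs
  imports "HOL-Analysis.Analysis" "HOL-Library.Multiset" "HOL-Library.Groups_Big_Fun"
    "HOL-Combinatorics.Permutations"
begin

section \<open>Formal power series in arbitrarily many variables\<close>

text \<open>
  The library has no power series in infinitely many variables.  A monomial in variables of
  type \<open>'v\<close> is a multiset over \<open>'v\<close>, and a power series is an arbitrary family of complex
  coefficients indexed by the monomials.
\<close>

typedef 'v mfps = "UNIV :: ('v multiset \<Rightarrow> complex) set"
  morphisms coeff_mfps Abs_mfps ..

setup_lifting type_definition_mfps

lemma mfps_eqI: "(\<And>m. coeff_mfps f m = coeff_mfps g m) \<Longrightarrow> f = g"
  by (simp add: coeff_mfps_inject[symmetric] ext)

lemma coeff_Abs_mfps [simp]: "coeff_mfps (Abs_mfps f) = f"
  by (simp add: Abs_mfps_inverse)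

lemma finite_submultisets: "finite {a. a \<subseteq># (m :: 'v multiset)}"
proof (induction m)
  case (add x m)
  have "{a. a \<subseteq># add_mset x m} \<subseteq> {a. a \<subseteq># m} \<union> add_mset x ` {a. a \<subseteq># m}"
  proof
    fix a assume "a \<in> {a. a \<subseteq># add_mset x m}"
    then have a: "a \<subseteq># add_mset x m" by simp
    show "a \<in> {a. a \<subseteq># m} \<union> add_mset x ` {a. a \<subseteq># m}"
    proof (cases "x \<in># a")
      case True
      then obtain b where "a = add_mset x b" by (meson multi_member_split)
      with a show ?thesis by simp
    next
      case False
      then have "a \<subseteq># m"
        using a by (metis add_mset_remove_trivial diff_single_trivial subset_eq_diff_conv
            add_mset_add_single)
      then show ?thesis by simp
    qed
  qed
  then show ?case using add by (meson finite_Un finite_imageI finite_subset)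
qed simp

instantiation mfps :: (type) comm_ring_1
begin

lift_definition zero_mfps :: "'a mfps" is "\<lambda>m. 0" .
lift_definition one_mfps :: "'a mfps" is "\<lambda>m. if m = {#} then 1 else 0" .
lift_definition plus_mfps :: "'a mfps \<Rightarrow> 'a mfps \<Rightarrow> 'a mfps" is "\<lambda>f g m. f m + g m" .
lift_definition minus_mfps :: "'a mfps \<Rightarrow> 'a mfps \<Rightarrow> 'a mfps" is "\<lambda>f g m. f m - g m" .
lift_definition uminus_mfps :: "'a mfps \<Rightarrow> 'a mfps" is "\<lambda>f m. - f m" .
lift_definition times_mfps :: "'a mfps \<Rightarrow> 'a mfps \<Rightarrow> 'a mfps"
  is "\<lambda>f g m. \<Sum>a | a \<subseteq># m. f a * g (m - a)" .

instance
proof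
  fix f g h :: "'a mfps"
  show "f * g * h = f * (g * h)"
  proof (transfer, rule ext)
    fix f g h :: "'a multiset \<Rightarrow> complex" and m :: "'a multiset"
    let ?S = "SIGMA a : {a. a \<subseteq># m}. {b. b \<subseteq># a}"
    let ?R = "SIGMA a : {a. a \<subseteq># m}. {b. b \<subseteq># m - a}"
    have fin: "finite {a. a \<subseteq># n}" for n :: "'a multiset" by (rule finite_submultisets)
    have "(\<Sum>a | a \<subseteq># m. (\<Sum>b | b \<subseteq># a. f b * g (a - b)) * h (m - a))
        = (\<Sum>(a, b) \<in> ?S. f b * g (a - b) * h (m - a))"
      by (simp add: sum_distrib_right sum.Sigma fin)
    also have "\<dots> = (\<Sum>(a, b) \<in> ?R. f a * (g b * h (m - a - b)))"
    proof (rule sum.reindex_bij_witness[where i = "\<lambda>(a, b). (a + b, a)" and j = "\<lambda>(a, b). (b, a - b)"])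
      fix p assume "p \<in> ?S"
      then obtain a b where p: "p = (a, b)" "a \<subseteq># m" "b \<subseteq># a" by auto
      then obtain c where c: "a = b + c" by (auto simp: subset_mset.le_iff_add)
      with p obtain d where d: "m = b + c + d" by (auto simp: subset_mset.le_iff_add)
      show "(case case p of (a, b) \<Rightarrow> (b, a - b) of (a, b) \<Rightarrow> (a + b, a)) = p"
        "(case p of (a, b) \<Rightarrow> (b, a - b)) \<in> ?R"
        "(case case p of (a, b) \<Rightarrow> (b, a - b) of (a, b) \<Rightarrow> f a * (g b * h (m - a - b))) =
          (case p of (a, b) \<Rightarrow> f b * g (a - b) * h (m - a))"
        by (simp_all add: p(1) c d ac_simps)
    next
      fix p assume "p \<in> ?R"
      then obtain a b where p: "p = (a, b)" "a \<subseteq># m" "b \<subseteq># m - a" by auto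
      then obtain c where c: "m = a + c" by (auto simp: subset_mset.le_iff_add)
      with p obtain d where d: "c = b + d" by (auto simp: subset_mset.le_iff_add)
      show "(case case p of (a, b) \<Rightarrow> (a + b, a) of (a, b) \<Rightarrow> (b, a - b)) = p"
        "(case p of (a, b) \<Rightarrow> (a + b, a)) \<in> ?S"
        by (simp_all add: p(1) c d ac_simps)
    qed
    also have "\<dots> = (\<Sum>a | a \<subseteq># m. f a * (\<Sum>b | b \<subseteq># m - a. g b * h (m - a - b)))"
      by (simp add: sum_distrib_left sum.Sigma fin)
    finally show "(\<Sum>a | a \<subseteq># m. (\<Sum>b | b \<subseteq># a. f b * g (a - b)) * h (m - a)) =
      (\<Sum>a | a \<subseteq># m. f a * (\<Sum>b | b \<subseteq># m - a. g b * h (m - a - b)))" .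
  qed
  show "f * g = g * f"
  proof (transfer, rule ext)
    fix f g :: "'a multiset \<Rightarrow> complex" and m :: "'a multiset"
    show "(\<Sum>a | a \<subseteq># m. f a * g (m - a)) = (\<Sum>a | a \<subseteq># m. g a * f (m - a))"
      by (rule sum.reindex_bij_witness[where i = "\<lambda>a. m - a" and j = "\<lambda>a. m - a"])
        (auto simp: subset_mset.le_iff_add)
  qed
  show "1 * f = f"
  proof (transfer, rule ext)
    fix f :: "'a multiset \<Rightarrow> complex" and m :: "'a multiset"
    have "(\<Sum>a | a \<subseteq># m. (if a = {#} then 1 else 0) * f (m - a)) =
        (\<Sum>a | a \<subseteq># m. if a = {#} then f m else 0)"
      by (rule sum.cong) auto
    also have "\<dots> = f m" by (simp add: sum.delta finite_submultisets)
    finally show "(\<Sum>a | a \<subseteq># m. (if a = {#} then 1 else 0) * f (m - a)) = f m" .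
  qed
  show "(f + g) * h = f * h + g * h"
    by transfer (simp add: distrib_right sum.distrib)
  show "(0 :: 'a mfps) \<noteq> 1"
    by transfer (metis zero_neq_one)
qed (transfer; simp add: algebra_simps)+

end

definition cscale :: "complex \<Rightarrow> 'v mfps \<Rightarrow> 'v mfps"  (infixr \<open>*\<^sub>c\<close> 75)
  where "c *\<^sub>c f = Abs_mfps (\<lambda>m. c * coeff_mfps f m)"

definition pd :: "'v \<Rightarrow> 'v mfps \<Rightarrow> 'v mfps"
  where "pd v f = Abs_mfps (\<lambda>m. of_nat (Suc (count m v)) * coeff_mfps f (add_mset v m))"

text \<open>
  Sum of a possibly infinite family of power series, taken coefficient by coefficient.  It is
  meaningful for families in which every monomial occurs only finitely often
  (\<^term>\<open>Sum_any\<close> returns \<open>0\<close> otherwise).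
\<close>

definition locally_finite :: "('i \<Rightarrow> 'v mfps) \<Rightarrow> bool"
  where "locally_finite g \<longleftrightarrow> (\<forall>m. finite {i. coeff_mfps (g i) m \<noteq> 0})"

definition msum :: "('i \<Rightarrow> 'v mfps) \<Rightarrow> 'v mfps"
  where "msum g = Abs_mfps (\<lambda>m. Sum_any (\<lambda>i. coeff_mfps (g i) m))"


section \<open>Vector fields and correlation functions on the big phase space\<close>

text \<open>
  A formal vector field is the family of its coefficients with respect to the coordinate fields
  \<open>\<partial>/\<partial>t\<^sub>v\<close>; infinitely many of them may be nonzero.  Local finiteness is what makes the contractions
  below well defined for all power series \<open>F\<close>; it holds for all finite combinations of
  coordinate fields and for fields such as \<open>\<Sum>\<^sub>v t\<^sub>v \<partial>/\<partial>t\<^sub>v\<close>.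
\<close>

type_synonym 'v vfield = "'v \<Rightarrow> 'v mfps"

definition vector_field :: "'v vfield \<Rightarrow> bool"
  where "vector_field W \<longleftrightarrow> locally_finite W"

text \<open>
  \<open>contract F [W\<^sub>1, \<dots>, W\<^sub>k]\<close> is the sum over \<open>v\<^sub>1, \<dots>, v\<^sub>k\<close> of
  \<open>W\<^sub>1 v\<^sub>1 * \<dots> * W\<^sub>k v\<^sub>k * \<partial>\<^sup>kF / \<partial>t\<^sub>v\<^sub>1 \<dots> \<partial>t\<^sub>v\<^sub>k\<close>: in the recursion only \<open>F\<close> is differentiated, never
  the coefficients of the fields.
\<close>

primrec contract :: "'v mfps \<Rightarrow> 'v vfield list \<Rightarrow> 'v mfps" where
  "contract F [] = F"
| "contract F (W # Ws) = msum (\<lambda>v. W v * contract (pd v F) Ws)"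

definition along :: "'v vfield \<Rightarrow> 'v mfps \<Rightarrow> 'v mfps"
  where "along V f = msum (\<lambda>v. V v * pd v f)"

text \<open>The trivial flat connection, on vector fields and on tensors.\<close>

definition nabla :: "'v vfield \<Rightarrow> 'v vfield \<Rightarrow> 'v vfield"
  where "nabla V W = (\<lambda>v. along V (W v))"

definition cov_deriv :: "'v vfield \<Rightarrow> ('v vfield list \<Rightarrow> 'v mfps) \<Rightarrow> 'v vfield list \<Rightarrow> 'v mfps"
  where "cov_deriv V S Ws =
    along V (S Ws) - (\<Sum>i<length Ws. S (Ws[i := nabla V (Ws ! i)]))"

text \<open>
  The data attached to the manifold: the finite type \<open>'n\<close> indexes the basis of the cohomology,
  \<open>\<eta>\<close> is the intersection matrix, and \<open>GW g [(n\<^sub>1, \<alpha>\<^sub>1), \<dots>, (n\<^sub>k, \<alpha>\<^sub>k)]\<close> stands for the descendant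
  invariant \<open>\<langle>\<tau>\<^sub>n\<^sub>1(\<gamma>\<^sub>\<alpha>\<^sub>1) \<dots> \<tau>\<^sub>n\<^sub>k(\<gamma>\<^sub>\<alpha>\<^sub>k)\<rangle>\<^sub>g\<close>.  The pair \<open>(n, \<alpha>)\<close> is the index of the coordinate
  \<open>t\<^sub>n\<^sup>\<alpha>\<close>.  All classes are even, so \<open>\<eta>\<close> and the invariants are symmetric; \<open>\<eta>\<close> is invertible by
  Poincare duality.
\<close>

locale gw_data =
  fixes \<eta> :: "complex ^ 'n::finite ^ 'n"
    and GW :: "nat \<Rightarrow> (nat \<times> 'n) list \<Rightarrow> complex"
  assumes eta_symmetric: "transpose \<eta> = \<eta>"
    and eta_invertible: "invertible \<eta>"
    and GW_symmetric: "mset xs = mset ys \<Longrightarrow> GW g xs = GW g ys"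
begin

definition potential :: "nat \<Rightarrow> (nat \<times> 'n) mfps"
  where "potential g = Abs_mfps (\<lambda>m. (\<Sum>xs | mset xs = m. GW g xs) / fact (size m))"

abbreviation correlator0 :: "(nat \<times> 'n) vfield list \<Rightarrow> (nat \<times> 'n) mfps"  (\<open>\<llangle>_\<rrangle>\<^sub>0\<close>)
  where "\<llangle>Ws\<rrangle>\<^sub>0 \<equiv> contract (potential 0) Ws"

abbreviation correlator1 :: "(nat \<times> 'n) vfield list \<Rightarrow> (nat \<times> 'n) mfps"  (\<open>\<llangle>_\<rrangle>\<^sub>1\<close>)
  where "\<llangle>Ws\<rrangle>\<^sub>1 \<equiv> contract (potential 1) Ws"

definition \<tau> :: "nat \<Rightarrow> 'n \<Rightarrow> (nat \<times> 'n) vfield"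
  where "\<tau> n \<alpha> = (\<lambda>v. if v = (n, \<alpha>) then 1 else 0)"

text \<open>\<open>\<gamma>d \<alpha>\<close> is \<open>\<gamma>\<^sub>\<alpha>\<close> and \<open>\<gamma>u \<alpha>\<close> is \<open>\<gamma>\<^sup>\<alpha>\<close>.\<close>

definition \<gamma>d :: "'n \<Rightarrow> (nat \<times> 'n) vfield"
  where "\<gamma>d \<alpha> = \<tau> 0 \<alpha>"

definition \<gamma>u :: "'n \<Rightarrow> (nat \<times> 'n) vfield"
  where "\<gamma>u \<alpha> = (\<lambda>v. \<Sum>\<beta>\<in>UNIV. (matrix_inv \<eta> $ \<alpha> $ \<beta>) *\<^sub>c \<gamma>d \<beta> v)"

definition \<tau>_plus :: "(nat \<times> 'n) vfield \<Rightarrow> (nat \<times> 'n) vfield"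
  where "\<tau>_plus W = (\<lambda>(n, \<alpha>). case n of 0 \<Rightarrow> 0 | Suc k \<Rightarrow> W (k, \<alpha>))"

definition qprod :: "(nat \<times> 'n) vfield \<Rightarrow> (nat \<times> 'n) vfield \<Rightarrow> (nat \<times> 'n) vfield"
    (infixl \<open>\<star>\<close> 72)
  where "W \<star> V = (\<lambda>v. \<Sum>\<alpha>\<in>UNIV. \<llangle>[W, V, \<gamma>u \<alpha>]\<rrangle>\<^sub>0 * \<gamma>d \<alpha> v)"

definition T :: "(nat \<times> 'n) vfield \<Rightarrow> (nat \<times> 'n) vfield"
  where "T W = (\<lambda>v. \<tau>_plus W v - (\<Sum>\<alpha>\<in>UNIV. \<llangle>[W, \<gamma>u \<alpha>]\<rrangle>\<^sub>0 * \<gamma>d \<alpha> v))"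


section \<open>The genus-0 and genus-1 relations\<close>

definition \<rho>0 where
  "\<rho>0 W1 W2 W3 = \<llangle>[T W1, W2, W3]\<rrangle>\<^sub>0"

text \<open>
  Expanded, \<open>C0 W1 W2 W3 W4\<close> is \<open>\<llangle>[W1 \<star> W2, W3, W4]\<rrangle>\<^sub>0 - \<llangle>[W1 \<star> W3, W2, W4]\<rrangle>\<^sub>0\<close>; exchanging \<open>W1\<close> and
  \<open>W2\<close> gives the usual form \<open>\<llangle>[W1 \<star> W2, W3, W4]\<rrangle>\<^sub>0 - \<llangle>[W1, W2 \<star> W3, W4]\<rrangle>\<^sub>0\<close>.
\<close>

definition C0 where
  "C0 W1 W2 W3 W4 =
     cov_deriv W3 (\<lambda>Ws. \<rho>0 (Ws ! 0) (Ws ! 1) (Ws ! 2)) [W1, W2, W4]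
   - cov_deriv W2 (\<lambda>Ws. \<rho>0 (Ws ! 0) (Ws ! 1) (Ws ! 2)) [W1, W3, W4]"

definition \<rho>1 where
  "\<rho>1 W = \<llangle>[T W]\<rrangle>\<^sub>1 - (1/24) *\<^sub>c (\<Sum>\<alpha>\<in>UNIV. \<llangle>[W, \<gamma>u \<alpha>, \<gamma>d \<alpha>]\<rrangle>\<^sub>0)"

text \<open>
  Getzler's relation.  The triple product is bracketed to the left; all bracketings agree once
  \<open>C0\<close> vanishes.
\<close>

definition G where
  "G W1 W2 W3 W4 = (let W = (\<lambda>i. [W1, W2, W3, W4] ! i) in
    \<Sum>g | g permutes {..<4}.
      3 *\<^sub>c \<llangle>[W (g 0) \<star> W (g 1), W (g 2) \<star> W (g 3)]\<rrangle>\<^sub>1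
    - 4 *\<^sub>c \<llangle>[W (g 0) \<star> W (g 1) \<star> W (g 2), W (g 3)]\<rrangle>\<^sub>1
    - (\<Sum>\<alpha>\<in>UNIV. \<llangle>[W (g 0) \<star> W (g 1), W (g 2), W (g 3), \<gamma>u \<alpha>]\<rrangle>\<^sub>0 * \<llangle>[\<gamma>d \<alpha>]\<rrangle>\<^sub>1)
    + 2 *\<^sub>c (\<Sum>\<alpha>\<in>UNIV. \<llangle>[W (g 0), W (g 1), W (g 2), \<gamma>u \<alpha>]\<rrangle>\<^sub>0 * \<llangle>[\<gamma>d \<alpha> \<star> W (g 3)]\<rrangle>\<^sub>1)
    + (1/6) *\<^sub>c (\<Sum>\<alpha>\<in>UNIV. \<Sum>\<beta>\<in>UNIV.
        \<llangle>[W (g 0), W (g 1), W (g 2), \<gamma>u \<alpha>]\<rrangle>\<^sub>0 * \<llangle>[\<gamma>d \<alpha>, W (g 3), \<gamma>d \<beta>, \<gamma>u \<beta>]\<rrangle>\<^sub>0)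
    + (1/24) *\<^sub>c (\<Sum>\<alpha>\<in>UNIV. \<Sum>\<beta>\<in>UNIV.
        \<llangle>[W (g 0), W (g 1), W (g 2), W (g 3), \<gamma>u \<alpha>]\<rrangle>\<^sub>0 * \<llangle>[\<gamma>d \<alpha>, \<gamma>d \<beta>, \<gamma>u \<beta>]\<rrangle>\<^sub>0)
    - (1/4) *\<^sub>c (\<Sum>\<alpha>\<in>UNIV. \<Sum>\<beta>\<in>UNIV.
        \<llangle>[W (g 0), W (g 1), \<gamma>u \<alpha>, \<gamma>u \<beta>]\<rrangle>\<^sub>0 * \<llangle>[\<gamma>d \<alpha>, \<gamma>d \<beta>, W (g 2), W (g 3)]\<rrangle>\<^sub>0))"


section \<open>The tensors \<open>A\<^sub>1\<close>, \<open>A\<^sub>2\<close> and \<open>B\<close>\<close>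

definition A1 where
  "A1 W =
      (7/10) *\<^sub>c (\<Sum>\<alpha>\<in>UNIV. \<llangle>[\<gamma>d \<alpha>]\<rrangle>\<^sub>1 * \<llangle>[\<gamma>u \<alpha> \<star> W]\<rrangle>\<^sub>1)
    + (1/10) *\<^sub>c (\<Sum>\<alpha>\<in>UNIV. \<llangle>[\<gamma>d \<alpha>, \<gamma>u \<alpha> \<star> W]\<rrangle>\<^sub>1)
    - (1/240) *\<^sub>c (\<Sum>\<alpha>\<in>UNIV. \<llangle>[W, \<gamma>d \<alpha> \<star> \<gamma>u \<alpha>]\<rrangle>\<^sub>1)
    + (13/240) *\<^sub>c (\<Sum>\<alpha>\<in>UNIV. \<Sum>\<beta>\<in>UNIV. \<llangle>[W, \<gamma>d \<alpha>, \<gamma>u \<alpha>, \<gamma>u \<beta>]\<rrangle>\<^sub>0 * \<llangle>[\<gamma>d \<beta>]\<rrangle>\<^sub>1)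
    + (1/960) *\<^sub>c (\<Sum>\<alpha>\<in>UNIV. \<Sum>\<beta>\<in>UNIV. \<llangle>[W, \<gamma>u \<alpha>, \<gamma>d \<alpha>, \<gamma>u \<beta>, \<gamma>d \<beta>]\<rrangle>\<^sub>0)"

definition A2 where
  "A2 W V =
      (13/10) *\<^sub>c (\<Sum>\<alpha>\<in>UNIV. \<Sum>\<beta>\<in>UNIV. \<llangle>[W, V, \<gamma>u \<alpha>, \<gamma>u \<beta>]\<rrangle>\<^sub>0 * \<llangle>[\<gamma>d \<alpha>]\<rrangle>\<^sub>1 * \<llangle>[\<gamma>d \<beta>]\<rrangle>\<^sub>1)
    + (4/5) *\<^sub>c (\<Sum>\<alpha>\<in>UNIV. \<llangle>[W, \<gamma>u \<alpha>]\<rrangle>\<^sub>1 * \<llangle>[\<gamma>d \<alpha> \<star> V]\<rrangle>\<^sub>1)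
    + (4/5) *\<^sub>c (\<Sum>\<alpha>\<in>UNIV. \<llangle>[V, \<gamma>u \<alpha>]\<rrangle>\<^sub>1 * \<llangle>[\<gamma>d \<alpha> \<star> W]\<rrangle>\<^sub>1)
    - (4/5) *\<^sub>c (\<Sum>\<alpha>\<in>UNIV. \<llangle>[W \<star> V, \<gamma>u \<alpha>]\<rrangle>\<^sub>1 * \<llangle>[\<gamma>d \<alpha>]\<rrangle>\<^sub>1)
    + (23/240) *\<^sub>c (\<Sum>\<alpha>\<in>UNIV. \<Sum>\<beta>\<in>UNIV. \<llangle>[W, V, \<gamma>u \<alpha>, \<gamma>d \<alpha>, \<gamma>u \<beta>]\<rrangle>\<^sub>0 * \<llangle>[\<gamma>d \<beta>]\<rrangle>\<^sub>1)
    + (1/48) *\<^sub>c (\<Sum>\<alpha>\<in>UNIV. \<Sum>\<beta>\<in>UNIV. \<llangle>[W, \<gamma>u \<alpha>, \<gamma>d \<alpha>, \<gamma>u \<beta>]\<rrangle>\<^sub>0 * \<llangle>[\<gamma>d \<beta>, V]\<rrangle>\<^sub>1)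
    + (1/48) *\<^sub>c (\<Sum>\<alpha>\<in>UNIV. \<Sum>\<beta>\<in>UNIV. \<llangle>[V, \<gamma>u \<alpha>, \<gamma>d \<alpha>, \<gamma>u \<beta>]\<rrangle>\<^sub>0 * \<llangle>[\<gamma>d \<beta>, W]\<rrangle>\<^sub>1)
    - (1/80) *\<^sub>c (\<Sum>\<alpha>\<in>UNIV. \<llangle>[W, V, \<gamma>u \<alpha> \<star> \<gamma>d \<alpha>]\<rrangle>\<^sub>1)
    + (7/30) *\<^sub>c (\<Sum>\<alpha>\<in>UNIV. \<Sum>\<beta>\<in>UNIV. \<llangle>[W, V, \<gamma>u \<alpha>, \<gamma>u \<beta>]\<rrangle>\<^sub>0 * \<llangle>[\<gamma>d \<alpha>, \<gamma>d \<beta>]\<rrangle>\<^sub>1)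
    + (1/30) *\<^sub>c (\<Sum>\<alpha>\<in>UNIV. \<llangle>[\<gamma>d \<alpha>, \<gamma>u \<alpha> \<star> W, V]\<rrangle>\<^sub>1)
    + (1/30) *\<^sub>c (\<Sum>\<alpha>\<in>UNIV. \<llangle>[\<gamma>d \<alpha>, \<gamma>u \<alpha> \<star> V, W]\<rrangle>\<^sub>1)
    - (1/30) *\<^sub>c (\<Sum>\<alpha>\<in>UNIV. \<llangle>[W \<star> V, \<gamma>d \<alpha>, \<gamma>u \<alpha>]\<rrangle>\<^sub>1)
    + (1/576) *\<^sub>c (\<Sum>\<alpha>\<in>UNIV. \<Sum>\<beta>\<in>UNIV. \<llangle>[W, V, \<gamma>u \<alpha>, \<gamma>d \<alpha>, \<gamma>u \<beta>, \<gamma>d \<beta>]\<rrangle>\<^sub>0)"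

definition B where
  "B W1 W2 W3 = (let W = (\<lambda>i. [W1, W2, W3] ! i) in
      (1/5) *\<^sub>c (\<Sum>\<alpha>\<in>UNIV. \<Sum>\<beta>\<in>UNIV. \<llangle>[W1, W2, W3, \<gamma>u \<alpha>, \<gamma>u \<beta>]\<rrangle>\<^sub>0 * \<llangle>[\<gamma>d \<alpha>]\<rrangle>\<^sub>1 * \<llangle>[\<gamma>d \<beta>]\<rrangle>\<^sub>1)
    - (6/5) *\<^sub>c (\<Sum>\<alpha>\<in>UNIV. \<Sum>\<beta>\<in>UNIV. \<llangle>[W1, W2, W3, \<gamma>u \<alpha>]\<rrangle>\<^sub>0 * \<llangle>[\<gamma>d \<alpha>, \<gamma>u \<beta>]\<rrangle>\<^sub>1 * \<llangle>[\<gamma>d \<beta>]\<rrangle>\<^sub>1)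
    + (1/120) *\<^sub>c (\<Sum>\<alpha>\<in>UNIV. \<Sum>\<beta>\<in>UNIV. \<llangle>[W1, W2, W3, \<gamma>u \<alpha>, \<gamma>d \<alpha>, \<gamma>u \<beta>]\<rrangle>\<^sub>0 * \<llangle>[\<gamma>d \<beta>]\<rrangle>\<^sub>1)
    - (1/120) *\<^sub>c (\<Sum>\<alpha>\<in>UNIV. \<llangle>[W1, W2, W3, \<gamma>u \<alpha> \<star> \<gamma>d \<alpha>]\<rrangle>\<^sub>1)
    + (1/10) *\<^sub>c (\<Sum>\<alpha>\<in>UNIV. \<Sum>\<beta>\<in>UNIV. \<llangle>[W1, W2, W3, \<gamma>u \<alpha>, \<gamma>u \<beta>]\<rrangle>\<^sub>0 * \<llangle>[\<gamma>d \<alpha>, \<gamma>d \<beta>]\<rrangle>\<^sub>1)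
    - (1/20) *\<^sub>c (\<Sum>\<alpha>\<in>UNIV. \<Sum>\<beta>\<in>UNIV. \<llangle>[W1, W2, W3, \<gamma>u \<alpha>]\<rrangle>\<^sub>0 * \<llangle>[\<gamma>d \<alpha>, \<gamma>u \<beta>, \<gamma>d \<beta>]\<rrangle>\<^sub>1)
    + (\<Sum>s | s permutes {..<3}.
        - ((1/5) *\<^sub>c (\<Sum>\<alpha>\<in>UNIV. \<Sum>\<beta>\<in>UNIV.
            \<llangle>[W (s 0), W (s 1), \<gamma>u \<alpha>, \<gamma>u \<beta>]\<rrangle>\<^sub>0 * \<llangle>[\<gamma>d \<alpha>]\<rrangle>\<^sub>1 * \<llangle>[\<gamma>d \<beta>, W (s 2)]\<rrangle>\<^sub>1))
        + (2/5) *\<^sub>c (\<Sum>\<alpha>\<in>UNIV. \<llangle>[W (s 0) \<star> \<gamma>d \<alpha>]\<rrangle>\<^sub>1 * \<llangle>[\<gamma>u \<alpha>, W (s 1), W (s 2)]\<rrangle>\<^sub>1)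
        - (3/5) *\<^sub>c (\<Sum>\<alpha>\<in>UNIV. \<llangle>[W (s 0), W (s 1) \<star> \<gamma>u \<alpha>]\<rrangle>\<^sub>1 * \<llangle>[\<gamma>d \<alpha>, W (s 2)]\<rrangle>\<^sub>1)
        + (3/10) *\<^sub>c (\<Sum>\<alpha>\<in>UNIV. \<llangle>[W (s 0), \<gamma>d \<alpha>]\<rrangle>\<^sub>1 * \<llangle>[\<gamma>u \<alpha>, W (s 1) \<star> W (s 2)]\<rrangle>\<^sub>1)
        - (1/5) *\<^sub>c (\<Sum>\<alpha>\<in>UNIV. \<llangle>[\<gamma>d \<alpha>]\<rrangle>\<^sub>1 * \<llangle>[\<gamma>u \<alpha>, W (s 0), W (s 1) \<star> W (s 2)]\<rrangle>\<^sub>1)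
        - (1/80) *\<^sub>c (\<Sum>\<alpha>\<in>UNIV. \<Sum>\<beta>\<in>UNIV.
            \<llangle>[W (s 0), W (s 1), \<gamma>u \<alpha>, \<gamma>d \<alpha>, \<gamma>u \<beta>]\<rrangle>\<^sub>0 * \<llangle>[\<gamma>d \<beta>, W (s 2)]\<rrangle>\<^sub>1)
        + (1/80) *\<^sub>c (\<Sum>\<alpha>\<in>UNIV. \<Sum>\<beta>\<in>UNIV.
            \<llangle>[W (s 0), \<gamma>u \<alpha>, \<gamma>d \<alpha>, \<gamma>u \<beta>]\<rrangle>\<^sub>0 * \<llangle>[\<gamma>d \<beta>, W (s 1), W (s 2)]\<rrangle>\<^sub>1)
        - (1/20) *\<^sub>c (\<Sum>\<alpha>\<in>UNIV. \<Sum>\<beta>\<in>UNIV.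
            \<llangle>[W (s 0), \<gamma>d \<alpha>, \<gamma>d \<beta>]\<rrangle>\<^sub>1 * \<llangle>[\<gamma>u \<alpha>, \<gamma>u \<beta>, W (s 1), W (s 2)]\<rrangle>\<^sub>0)
        + (1/60) *\<^sub>c (\<Sum>\<alpha>\<in>UNIV. \<llangle>[W (s 0), W (s 1), \<gamma>d \<alpha>, \<gamma>u \<alpha> \<star> W (s 2)]\<rrangle>\<^sub>1)
        - (1/120) *\<^sub>c (\<Sum>\<alpha>\<in>UNIV. \<llangle>[W (s 0), \<gamma>u \<alpha>, \<gamma>d \<alpha>, W (s 1) \<star> W (s 2)]\<rrangle>\<^sub>1)))"

end

end

theory Submission
  imports Defs
begin

text \<open>
  The two equations are linear over functions in each vector field, so it suffices to prove them for
  coordinate fields, which are parallel.  The recursion relations and their covariant derivatives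
  then remove \<open>T\<close>, and what remains is a combination of contractions of correlators in genus 0 and
  1, each described by a graph with three edges.  Two kinds of relations hold between these
  contractions: associativity of the product (with its derivatives) at a vertex of genus 0, and
  Getzler's relation with one further edge, which closes two of its legs, attaches
  \<open>\<llangle>\<gamma>\<^sub>\<alpha>\<rrangle>\<^sub>1\<close>, or connects a leg to an additional insertion created by a covariant derivative.
  Both equations are explicit rational combinations of such relations.  The combinations are checked
  by normalizing graphs inside the logic.
\<close>

section \<open>Calculus of power series\<close>

text \<open>Three obstacles shape the proof. Fields are infinite combinations, so finite additivity
  does not reduce a tensor to coordinate fields: linearity is stated for infinite sums, and sums are
  exchanged up to a fixed monomial, where finitely many summands survive. The coefficients of
  \<open>T W\<close> are correlators, so \<open>T W\<close> is in general not parallel even if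
  \<open>W\<close> is: the recursions are solved for \<open>\<tau>_plus W\<close>, which stays
  parallel, and differentiated in that form. Dual bases give an edge two different ends: a frame
  with equal ends replaces them, so that graphs can be compared up to renaming of edges. The number
  three arises because every term of A_1, A_2 and B has two edges, products included, and either the
  elimination of T or the product of the first two fields adds one. Getzler's relation also has two.
  The integers come from clearing denominators: 2880 is the least common denominator of A_1, A_2 and
  B, and 24 that of the genus-1 recursion and of Getzler's relation.\<close>

lemma coeff_mfps_simps [simp]:
  "coeff_mfps 0 m = 0"
  "coeff_mfps (f + g) m = coeff_mfps f m + coeff_mfps g m"
  "coeff_mfps (f - g) m = coeff_mfps f m - coeff_mfps g m"
  "coeff_mfps (- f) m = - coeff_mfps f m"
  "coeff_mfps (c *\<^sub>c f) m = c * coeff_mfps f m"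
  "coeff_mfps (pd v f) m = of_nat (Suc (count m v)) * coeff_mfps f (add_mset v m)"
  by (simp_all add: zero_mfps.rep_eq plus_mfps.rep_eq minus_mfps.rep_eq uminus_mfps.rep_eq
      cscale_def pd_def)

lemma coeff_mfps_one: "coeff_mfps 1 m = (if m = {#} then 1 else 0)"
  by (simp add: one_mfps.rep_eq)

lemma coeff_mfps_times: "coeff_mfps (f * g) m = (\<Sum>a | a \<subseteq># m. coeff_mfps f a * coeff_mfps g (m - a))"
  by (simp add: times_mfps.rep_eq)

lemma coeff_mfps_sum [simp]: "coeff_mfps (sum f A) m = (\<Sum>i\<in>A. coeff_mfps (f i) m)"
  by (induction A rule: infinite_finite_induct) auto

text \<open>Scalars become constant power series, so the ring laws and linearity over functions also
  take care of scalar factors.\<close>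

lemma cscale_conv_times: "c *\<^sub>c f = (c *\<^sub>c 1) * f"
proof (rule mfps_eqI)
  fix m :: "'a multiset"
  have "coeff_mfps ((c *\<^sub>c 1) * f) m = (\<Sum>a | a \<subseteq># m. if a = {#} then c * coeff_mfps f m else 0)"
    unfolding coeff_mfps_times by (rule sum.cong) (auto simp: coeff_mfps_one)
  then show "coeff_mfps (c *\<^sub>c f) m = coeff_mfps ((c *\<^sub>c 1) * f) m"
    by (simp add: sum.delta finite_submultisets)
qed

lemma cscale_cscale [simp]: "c *\<^sub>c d *\<^sub>c f = (c * d) *\<^sub>c f"
  by (rule mfps_eqI) simp

lemma cscale_0 [simp]: "0 *\<^sub>c f = 0" and cscale_1 [simp]: "1 *\<^sub>c f = f"
  and cscale_zero [simp]: "c *\<^sub>c 0 = 0"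
  by (rule mfps_eqI; simp)+

lemma cscale_times_left [simp]: "(c *\<^sub>c f) * g = c *\<^sub>c (f * g)"
  by (metis cscale_conv_times mult.assoc)

lemma cscale_times_right [simp]: "f * (c *\<^sub>c g) = c *\<^sub>c (f * g)"
  by (metis cscale_times_left mult.commute)

lemma cscale_add_left: "(c + d) *\<^sub>c f = c *\<^sub>c f + d *\<^sub>c f"
  and cscale_add_right: "c *\<^sub>c (f + g) = c *\<^sub>c f + c *\<^sub>c g"
  and cscale_diff_right: "c *\<^sub>c (f - g) = c *\<^sub>c f - c *\<^sub>c g"
  and cscale_minus_left: "(- c) *\<^sub>c f = - (c *\<^sub>c f)"
  and cscale_minus_right: "c *\<^sub>c (- f) = - (c *\<^sub>c f)"
  by (rule mfps_eqI; simp add: algebra_simps)+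

lemma cscale_sum: "c *\<^sub>c sum f A = (\<Sum>i\<in>A. c *\<^sub>c f i)"
  by (rule mfps_eqI) (simp add: sum_distrib_left)

lemma cscale_eq_0_iff: "c *\<^sub>c f = 0 \<longleftrightarrow> c = 0 \<or> f = 0"
proof
  assume "c *\<^sub>c f = 0"
  then have "c * coeff_mfps f m = 0" for m
    by (metis coeff_mfps_simps(1,5))
  then show "c = 0 \<or> f = 0"
    by (auto intro: mfps_eqI)
qed auto

lemma pd_add: "pd u (f + g) = pd u f + pd u g"
  and pd_cscale: "pd u (c *\<^sub>c f) = c *\<^sub>c pd u f"
  and pd_0 [simp]: "pd u 0 = 0"
  by (rule mfps_eqI; simp add: algebra_simps)+

lemma pd_one [simp]: "pd u 1 = 0"
  by (rule mfps_eqI) (simp add: coeff_mfps_one)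

lemma pd_sum: "pd u (sum f A) = (\<Sum>i\<in>A. pd u (f i))"
  by (rule mfps_eqI) (simp add: sum_distrib_left)

lemma pd_commute: "pd u (pd v f) = pd v (pd u f)"
  by (rule mfps_eqI) (auto simp: add_mset_commute)

text \<open>Submultisets without \<open>u\<close> have weight 0, and from the others one copy of
  \<open>u\<close> can be removed bijectively. This is the index shift contained in
  \<open>pd\<close>.\<close>

lemma sum_submultisets_count:
  fixes h :: "'v multiset \<Rightarrow> complex"
  shows "(\<Sum>a | a \<subseteq># add_mset u m. of_nat (count a u) * h a) =
    (\<Sum>a | a \<subseteq># m. of_nat (Suc (count a u)) * h (add_mset u a))"
proof -
  have "(\<Sum>a | a \<subseteq># add_mset u m. of_nat (count a u) * h a) =
      (\<Sum>a | a \<subseteq># add_mset u m \<and> u \<in># a. of_nat (count a u) * h a)"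
    by (rule sum.mono_neutral_right) (auto simp: finite_submultisets not_in_iff)
  also have "\<dots> = (\<Sum>a | a \<subseteq># m. of_nat (Suc (count a u)) * h (add_mset u a))"
    by (rule sum.reindex_bij_witness[where i = "add_mset u" and j = "\<lambda>a. a - {#u#}"])
      (auto simp: subset_eq_diff_conv)
  finally show ?thesis .
qed

text \<open>The exponent of \<open>u\<close> in a monomial is the sum of its exponents in the two
  factors; this splits the weight in \<open>pd\<close> into the two summands of the Leibniz
  rule.\<close>

lemma pd_times: "pd u (f * g) = pd u f * g + f * pd u g"
proof (rule mfps_eqI)
  fix m :: "'a multiset"
  let ?F = "coeff_mfps f" and ?G = "coeff_mfps g" and ?n = "add_mset u m"
  have swap: "(\<Sum>a | a \<subseteq># n. p a (n - a)) = (\<Sum>a | a \<subseteq># n. p (n - a) a)"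
    for n :: "'a multiset" and p :: "'a multiset \<Rightarrow> 'a multiset \<Rightarrow> complex"
    by (rule sum.reindex_bij_witness[where i = "\<lambda>a. n - a" and j = "\<lambda>a. n - a"])
      (auto simp: subset_mset.le_iff_add)
  have "coeff_mfps (pd u (f * g)) m =
      (\<Sum>a | a \<subseteq># ?n. of_nat (count a u + count (?n - a) u) * (?F a * ?G (?n - a)))"
    unfolding coeff_mfps_simps coeff_mfps_times sum_distrib_left
  proof (rule sum.cong[OF refl])
    fix a assume "a \<in> {a. a \<subseteq># ?n}"
    then have "count a u \<le> count ?n u"
      by (intro mset_subset_eq_count) simp
    then have "count a u + count (?n - a) u = Suc (count m u)"
      by simp
    then show "of_nat (Suc (count m u)) * (?F a * ?G (?n - a)) =
        of_nat (count a u + count (?n - a) u) * (?F a * ?G (?n - a))"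
      by simp
  qed
  also have "\<dots> = (\<Sum>a | a \<subseteq># ?n. of_nat (count a u) * (?F a * ?G (?n - a)))
      + (\<Sum>a | a \<subseteq># ?n. of_nat (count (?n - a) u) * (?F a * ?G (?n - a)))"
    by (simp add: sum.distrib algebra_simps)
  also have "(\<Sum>a | a \<subseteq># ?n. of_nat (count (?n - a) u) * (?F a * ?G (?n - a))) =
      (\<Sum>a | a \<subseteq># ?n. of_nat (count a u) * (?F (?n - a) * ?G a))"
    by (rule swap[where p = "\<lambda>a b. of_nat (count b u) * (?F a * ?G b)"])
  also have "\<dots> = (\<Sum>a | a \<subseteq># m. of_nat (Suc (count a u)) * (?F (m - a) * ?G (add_mset u a)))"
    by (subst sum_submultisets_count) simp
  also have "\<dots> = (\<Sum>a | a \<subseteq># m. ?F a * coeff_mfps (pd u g) (m - a))"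
    by (subst swap[where p = "\<lambda>a b. ?F a * coeff_mfps (pd u g) b"]) (simp add: algebra_simps)
  also have "(\<Sum>a | a \<subseteq># ?n. of_nat (count a u) * (?F a * ?G (?n - a))) =
      (\<Sum>a | a \<subseteq># m. coeff_mfps (pd u f) a * ?G (m - a))"
    by (subst sum_submultisets_count) (simp add: algebra_simps)
  finally show "coeff_mfps (pd u (f * g)) m = coeff_mfps (pd u f * g + f * pd u g) m"
    by (simp add: coeff_mfps_times)
qed

text \<open>
  A coefficient of an infinite sum \<open>\<Sum>\<^sub>v W v * h v\<close> only involves finitely many summands.  Agreement up
  to a monomial turns identities between such sums into identities between finite sums.
\<close>

definition agree :: "'v multiset \<Rightarrow> 'v mfps \<Rightarrow> 'v mfps \<Rightarrow> bool"
  where "agree m f g \<longleftrightarrow> (\<forall>a. a \<subseteq># m \<longrightarrow> coeff_mfps f a = coeff_mfps g a)"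

lemma agree_refl [simp]: "agree m f f"
  by (simp add: agree_def)

lemma agree_sym: "agree m f g \<Longrightarrow> agree m g f"
  by (simp add: agree_def)

lemma agree_trans [trans]: "agree m f g \<Longrightarrow> agree m g h \<Longrightarrow> agree m f h"
  by (simp add: agree_def)

lemma eq_agree_trans [trans]: "f = g \<Longrightarrow> agree m g h \<Longrightarrow> agree m f h"
  and agree_eq_trans [trans]: "agree m f g \<Longrightarrow> g = h \<Longrightarrow> agree m f h"
  by simp_all

lemma mfps_eqI_agree: "(\<And>m. agree m f g) \<Longrightarrow> f = g"
  by (rule mfps_eqI) (auto simp: agree_def)

lemma agree_times: "agree m f f' \<Longrightarrow> agree m g g' \<Longrightarrow> agree m (f * g) (f' * g')"
  unfolding agree_def coeff_mfps_times
  by (auto intro!: sum.cong) (meson diff_subset_eq_self subset_mset.order_trans)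

lemma agree_add: "agree m f f' \<Longrightarrow> agree m g g' \<Longrightarrow> agree m (f + g) (f' + g')"
  by (simp add: agree_def)

lemma agree_sum: "(\<And>i. i \<in> A \<Longrightarrow> agree m (f i) (g i)) \<Longrightarrow> agree m (sum f A) (sum g A)"
  by (simp add: agree_def)

lemma agree_pd: "agree (add_mset u m) f g \<Longrightarrow> agree m (pd u f) (pd u g)"
  by (simp add: agree_def)

text \<open>The indices visible up to the monomial \<open>m\<close>. All submultisets count, because
  a coefficient of a product at \<open>m\<close> involves coefficients of its factors at every
  divisor of \<open>m\<close>.\<close>

definition low_support :: "('v \<Rightarrow> 'w mfps) \<Rightarrow> 'w multiset \<Rightarrow> 'v set"
  where "low_support W m = (\<Union>a \<in> {a. a \<subseteq># m}. {v. coeff_mfps (W v) a \<noteq> 0})"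

lemma finite_low_support: "locally_finite W \<Longrightarrow> finite (low_support W m)"
  by (auto simp: low_support_def locally_finite_def finite_submultisets)

lemma low_support_mono: "a \<subseteq># m \<Longrightarrow> low_support W a \<subseteq> low_support W m"
  unfolding low_support_def by (auto intro: subset_mset.order_trans)

lemma agree_0_outside: "v \<notin> low_support W m \<Longrightarrow> agree m (W v) 0"
  by (auto simp: low_support_def agree_def)

lemma agree_msum:
  assumes "finite S" "low_support W m \<subseteq> S"
  shows "agree m (msum (\<lambda>v. W v * h v)) (\<Sum>v\<in>S. W v * h v)"
  unfolding agree_def
proof (intro allI impI)
  fix a assume a: "a \<subseteq># m"
  have "coeff_mfps (W v * h v) a = 0" if "v \<notin> S" for v
  proof -
    have "agree m (W v * h v) (0 * h v)"
      using that assms by (intro agree_times agree_0_outside) auto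
    then show ?thesis
      using a by (simp add: agree_def)
  qed
  then have "{v. coeff_mfps (W v * h v) a \<noteq> 0} \<subseteq> S"
    by blast
  then show "coeff_mfps (msum (\<lambda>v. W v * h v)) a = coeff_mfps (\<Sum>v\<in>S. W v * h v) a"
    using assms(1) by (simp add: msum_def Sum_any.expand_superset)
qed

lemma locally_finite_times:
  assumes "locally_finite W"
  shows "locally_finite (\<lambda>v. W v * h v)"
  unfolding locally_finite_def
proof
  fix m
  have "agree m (W v * h v) 0" if "v \<notin> low_support W m" for v
    using agree_times[OF agree_0_outside[OF that] agree_refl[of m "h v"]] by simp
  then have "{v. coeff_mfps (W v * h v) m \<noteq> 0} \<subseteq> low_support W m"
    by (auto simp: agree_def)
  then show "finite {v. coeff_mfps (W v * h v) m \<noteq> 0}"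
    using finite_low_support[OF assms] by (rule finite_subset)
qed

lemma locally_finite_add: "locally_finite f \<Longrightarrow> locally_finite g \<Longrightarrow> locally_finite (\<lambda>v. f v + g v)"
  unfolding locally_finite_def
proof
  fix m assume "\<forall>m. finite {v. coeff_mfps (f v) m \<noteq> 0}" "\<forall>m. finite {v. coeff_mfps (g v) m \<noteq> 0}"
  moreover have "{v. coeff_mfps (f v + g v) m \<noteq> 0} \<subseteq>
      {v. coeff_mfps (f v) m \<noteq> 0} \<union> {v. coeff_mfps (g v) m \<noteq> 0}"
    by auto
  ultimately show "finite {v. coeff_mfps (f v + g v) m \<noteq> 0}"
    by (meson finite_UnI finite_subset)
qed

lemma locally_finite_sum:
  assumes "\<And>i. i \<in> A \<Longrightarrow> locally_finite (f i)"
  shows "locally_finite (\<lambda>v. \<Sum>i\<in>A. f i v)"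
  using assms
  by (induction A rule: infinite_finite_induct)
    (simp_all add: locally_finite_add, simp_all add: locally_finite_def)

lemma msum_add:
  assumes "locally_finite W"
  shows "msum (\<lambda>v. W v * (h v + k v)) = msum (\<lambda>v. W v * h v) + msum (\<lambda>v. W v * k v)"
proof (rule mfps_eqI_agree)
  fix m
  let ?S = "low_support W m"
  note a = agree_msum[OF finite_low_support[OF assms] order_refl, of m]
  have "agree m (msum (\<lambda>v. W v * (h v + k v))) (\<Sum>v\<in>?S. W v * (h v + k v))"
    by (rule a)
  also have "\<dots> = (\<Sum>v\<in>?S. W v * h v) + (\<Sum>v\<in>?S. W v * k v)"
    by (simp add: distrib_left sum.distrib)
  also have "agree m \<dots> (msum (\<lambda>v. W v * h v) + msum (\<lambda>v. W v * k v))"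
    by (intro agree_add agree_sym[OF a])
  finally show "agree m (msum (\<lambda>v. W v * (h v + k v)))
      (msum (\<lambda>v. W v * h v) + msum (\<lambda>v. W v * k v))" .
qed

lemma msum_mult_left:
  assumes "locally_finite W"
  shows "msum (\<lambda>v. W v * (f * h v)) = f * msum (\<lambda>v. W v * h v)"
proof (rule mfps_eqI_agree)
  fix m
  let ?S = "low_support W m"
  note a = agree_msum[OF finite_low_support[OF assms] order_refl, of m]
  have "agree m (msum (\<lambda>v. W v * (f * h v))) (\<Sum>v\<in>?S. W v * (f * h v))"
    by (rule a)
  also have "\<dots> = f * (\<Sum>v\<in>?S. W v * h v)"
    by (simp add: sum_distrib_left mult.left_commute)
  also have "agree m \<dots> (f * msum (\<lambda>v. W v * h v))"
    by (intro agree_times agree_refl agree_sym[OF a])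
  finally show "agree m (msum (\<lambda>v. W v * (f * h v))) (f * msum (\<lambda>v. W v * h v))" .
qed

lemma msum_zero [simp]: "msum (\<lambda>v. 0) = 0"
  by (simp add: msum_def zero_mfps_def)

text \<open>A Fubini rule for arbitrary \<open>h\<close>: local finiteness of \<open>W\<close> and
  \<open>V\<close> leaves finitely many pairs of indices up to each monomial.\<close>

lemma msum_swap:
  assumes W: "locally_finite W" and V: "locally_finite V"
  shows "msum (\<lambda>v. W v * msum (\<lambda>u. V u * h v u)) = msum (\<lambda>u. V u * msum (\<lambda>v. W v * h v u))"
proof (rule mfps_eqI_agree)
  fix m
  let ?S = "low_support W m" and ?R = "low_support V m"
  note aW = agree_msum[OF finite_low_support[OF W] order_refl, of m]
    and aV = agree_msum[OF finite_low_support[OF V] order_refl, of m]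
  have "agree m (msum (\<lambda>v. W v * msum (\<lambda>u. V u * h v u)))
      (\<Sum>v\<in>?S. W v * msum (\<lambda>u. V u * h v u))"
    by (rule aW)
  also have "agree m \<dots> (\<Sum>v\<in>?S. W v * (\<Sum>u\<in>?R. V u * h v u))"
    by (intro agree_sum agree_times agree_refl aV)
  also have "\<dots> = (\<Sum>u\<in>?R. V u * (\<Sum>v\<in>?S. W v * h v u))"
    unfolding sum_distrib_left by (subst sum.swap) (simp add: mult.left_commute)
  also have "agree m \<dots> (\<Sum>u\<in>?R. V u * msum (\<lambda>v. W v * h v u))"
    by (intro agree_sum agree_times agree_refl agree_sym[OF aW])
  also have "agree m \<dots> (msum (\<lambda>u. V u * msum (\<lambda>v. W v * h v u)))"
    by (rule agree_sym[OF aV])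
  finally show "agree m (msum (\<lambda>v. W v * msum (\<lambda>u. V u * h v u)))
      (msum (\<lambda>u. V u * msum (\<lambda>v. W v * h v u)))" .
qed

lemma locally_finite_pd: "locally_finite W \<Longrightarrow> locally_finite (\<lambda>v. pd u (W v))"
  unfolding locally_finite_def
proof
  fix m assume W: "\<forall>m. finite {v. coeff_mfps (W v) m \<noteq> 0}"
  have "{v. coeff_mfps (pd u (W v)) m \<noteq> 0} \<subseteq> {v. coeff_mfps (W v) (add_mset u m) \<noteq> 0}"
    by auto
  then show "finite {v. coeff_mfps (pd u (W v)) m \<noteq> 0}"
    using W finite_subset by blast
qed

lemma pd_msum:
  assumes "locally_finite W"
  shows "pd u (msum (\<lambda>v. W v * h v)) =
    msum (\<lambda>v. pd u (W v) * h v) + msum (\<lambda>v. W v * pd u (h v))"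
proof (rule mfps_eqI_agree)
  fix m
  \<comment> \<open>The derivative reads coefficients one degree higher, hence the support up to
    \<open>add_mset u m\<close>; the second set serves the sum in which \<open>W\<close> is
    differentiated.\<close>
  let ?S = "low_support W (add_mset u m) \<union> low_support (\<lambda>v. pd u (W v)) m"
  have fin: "finite ?S"
    using assms by (simp add: finite_low_support locally_finite_pd)
  have "agree m (pd u (msum (\<lambda>v. W v * h v))) (pd u (\<Sum>v\<in>?S. W v * h v))"
    by (intro agree_pd agree_msum fin) auto
  also have "\<dots> = (\<Sum>v\<in>?S. pd u (W v) * h v) + (\<Sum>v\<in>?S. W v * pd u (h v))"
    by (simp add: pd_sum pd_times sum.distrib)
  also have "agree m \<dots> (msum (\<lambda>v. pd u (W v) * h v) + msum (\<lambda>v. W v * pd u (h v)))"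
    using low_support_mono[of m "add_mset u m" W]
    by (intro agree_add agree_sym[OF agree_msum] fin) auto
  finally show "agree m (pd u (msum (\<lambda>v. W v * h v)))
      (msum (\<lambda>v. pd u (W v) * h v) + msum (\<lambda>v. W v * pd u (h v)))" .
qed

section \<open>Contractions\<close>

definition coord :: "'v \<Rightarrow> 'v vfield"
  where "coord v = (\<lambda>u. if u = v then 1 else 0)"

text \<open>The parallel fields of the flat connection: \<open>nabla V W\<close> is 0 for every
  \<open>V\<close>.\<close>

definition constant_field :: "'v vfield \<Rightarrow> bool"
  where "constant_field W \<longleftrightarrow> vector_field W \<and> (\<forall>u v. pd u (W v) = 0)"

lemma constant_fieldD [simp]: "constant_field W \<Longrightarrow> vector_field W"
  and constant_field_pd: "constant_field W \<Longrightarrow> pd u (W v) = 0"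
  by (simp_all add: constant_field_def)

lemma finite_support_vector_field: "finite {v. W v \<noteq> 0} \<Longrightarrow> vector_field W"
  unfolding vector_field_def locally_finite_def
  by (intro allI, erule rev_finite_subset) auto

lemma constant_field_coord [simp]: "constant_field (coord v)"
  unfolding constant_field_def coord_def by (auto intro!: finite_support_vector_field)

lemma vector_field_sum: "(\<And>i. i \<in> A \<Longrightarrow> vector_field (X i)) \<Longrightarrow> vector_field (\<lambda>v. \<Sum>i\<in>A. X i v)"
  unfolding vector_field_def by (rule locally_finite_sum)

lemma vector_field_times: "vector_field W \<Longrightarrow> vector_field (\<lambda>v. f v * W v)"
  unfolding vector_field_def by (subst mult.commute) (rule locally_finite_times)

lemma vector_field_cscale: "vector_field W \<Longrightarrow> vector_field (\<lambda>v. c *\<^sub>c W v)"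
  by (subst cscale_conv_times) (rule vector_field_times)

lemma vector_field_add: "vector_field W \<Longrightarrow> vector_field V \<Longrightarrow> vector_field (\<lambda>v. W v + V v)"
  unfolding vector_field_def by (rule locally_finite_add)

lemma vector_field_diff: "vector_field W \<Longrightarrow> vector_field V \<Longrightarrow> vector_field (\<lambda>v. W v - V v)"
  using vector_field_add[of W "\<lambda>v. (-1) *\<^sub>c V v"] vector_field_cscale[of V "-1"]
  by (simp add: cscale_minus_left)

text \<open>Up to a monomial only finitely many directions \<open>u\<close> of \<open>V\<close>
  contribute, and for each of them the derivatives of the components of \<open>W\<close> are again
  locally finite.\<close>

lemma vector_field_nabla: "vector_field W \<Longrightarrow> vector_field V \<Longrightarrow> vector_field (nabla V W)"
  unfolding vector_field_def locally_finite_def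
proof
  fix m
  assume W: "\<forall>m. finite {v. coeff_mfps (W v) m \<noteq> 0}" and V: "\<forall>m. finite {v. coeff_mfps (V v) m \<noteq> 0}"
  let ?R = "low_support V m"
  let ?S = "\<Union>u\<in>?R. low_support (\<lambda>v. pd u (W v)) m"
  have R: "finite ?R"
    using V by (intro finite_low_support) (simp add: locally_finite_def)
  have S: "finite ?S"
    using W by (intro finite_UN_I R finite_low_support locally_finite_pd) (simp add: locally_finite_def)
  have "agree m (nabla V W v) 0" if "v \<notin> ?S" for v
  proof -
    have "agree m (nabla V W v) (\<Sum>u\<in>?R. V u * pd u (W v))"
      unfolding nabla_def along_def by (rule agree_msum[OF R order_refl])
    also have "agree m \<dots> (\<Sum>u\<in>?R. V u * 0)"
    proof (intro agree_sum agree_times[OF agree_refl])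
      fix u assume "u \<in> ?R"
      with that have "v \<notin> low_support (\<lambda>v. pd u (W v)) m"
        by blast
      then show "agree m (pd u (W v)) 0"
        by (rule agree_0_outside)
    qed
    finally show ?thesis by simp
  qed
  then have "{v. coeff_mfps (nabla V W v) m \<noteq> 0} \<subseteq> ?S"
    by (auto simp: agree_def)
  then show "finite {v. coeff_mfps (nabla V W v) m \<noteq> 0}"
    using S by (rule finite_subset)
qed

lemma msum_coord [simp]: "msum (\<lambda>u. coord v u * h u) = h v"
proof (rule mfps_eqI_agree)
  fix m
  have "agree m (msum (\<lambda>u. coord v u * h u)) (\<Sum>u\<in>insert v (low_support (coord v) m). coord v u * h u)"
    using constant_field_coord[of v] by (intro agree_msum)
      (auto simp: finite_low_support constant_field_def vector_field_def)
  also have "\<dots> = h v"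
    using constant_field_coord[of v]
    by (subst sum.mono_neutral_right[where S = "{v}"])
      (auto simp: coord_def finite_low_support constant_field_def vector_field_def)
  finally show "agree m (msum (\<lambda>u. coord v u * h u)) (h v)" .
qed

lemma contract_swap:
  "vector_field W \<Longrightarrow> vector_field V \<Longrightarrow> contract F (W # V # Ws) = contract F (V # W # Ws)"
  using msum_swap[of W V "\<lambda>v u. contract (pd u (pd v F)) Ws"]
  by (simp add: vector_field_def pd_commute)

lemma contract_move:
  assumes "vector_field W" "\<And>V. V \<in> set xs \<Longrightarrow> vector_field V"
  shows "contract F (xs @ W # ys) = contract F (W # xs @ ys)"
  using assms(2)
proof (induction xs arbitrary: F)
  case (Cons V xs)
  have "contract (pd v F) (xs @ W # ys) = contract (pd v F) (W # xs @ ys)" for v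
    using Cons.prems by (intro Cons.IH) simp
  then have "contract F ((V # xs) @ W # ys) = contract F (V # W # xs @ ys)"
    by simp
  also have "\<dots> = contract F (W # V # xs @ ys)"
    using Cons.prems assms(1) by (intro contract_swap) auto
  finally show ?case by simp
qed simp

lemma contract_perm:
  assumes "mset xs = mset ys" "\<And>V. V \<in> set xs \<Longrightarrow> vector_field V"
  shows "contract F xs = contract F ys"
  using assms
proof (induction xs arbitrary: F ys)
  case (Cons x xs)
  then have "x \<in> set ys"
    by (metis list.set_intros(1) mset_eq_setD)
  then obtain as bs where ys: "ys = as @ x # bs"
    by (meson split_list)
  have "contract (pd v F) xs = contract (pd v F) (as @ bs)" for v
    using Cons.prems ys by (intro Cons.IH) auto
  then have "contract F (x # xs) = contract F (x # as @ bs)"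
    by simp
  also have "\<dots> = contract F ys"
    unfolding ys using Cons.prems mset_eq_setD[OF Cons.prems(1)] ys
    by (intro contract_move[symmetric]) auto
  finally show ?case .
qed simp

lemma pd_contract:
  assumes "\<And>W. W \<in> set Ws \<Longrightarrow> constant_field W"
  shows "pd u (contract F Ws) = contract (pd u F) Ws"
  using assms
proof (induction Ws arbitrary: F)
  case (Cons W Ws)
  then have "locally_finite W" "\<And>v. pd u (W v) = 0"
    by (auto simp: constant_field_def vector_field_def)
  with Cons show ?case
    by (simp add: pd_msum pd_commute)
qed simp

lemma along_conv_contract: "along V f = contract f [V]"
  by (simp add: along_def)

text \<open>The coefficients of parallel insertions are constants, so the derivative reaches only
  the potential and merely adds one insertion.\<close>

lemma along_contract:
  assumes "\<And>W. W \<in> set Ws \<Longrightarrow> constant_field W"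
  shows "along V (contract F Ws) = contract F (V # Ws)"
  using assms by (simp add: along_def pd_contract)

lemma
  assumes "vector_field V"
  shows along_add: "along V (f + g) = along V f + along V g"
    and along_times: "along V (f * g) = along V f * g + f * along V g"
    and along_cscale: "along V (c *\<^sub>c f) = c *\<^sub>c along V f"
    and along_sum: "along V (sum h A) = (\<Sum>i\<in>A. along V (h i))"
proof -
  note lf = assms[unfolded vector_field_def]
  show add: "along V (f + g) = along V f + along V g" for f g
    unfolding along_def by (simp add: pd_add msum_add[OF lf])
  show times: "along V (f * g) = along V f * g + f * along V g" for f g
    unfolding along_def
  proof -
    have "pd v (f * g) = g * pd v f + f * pd v g" for v
      by (simp add: pd_times mult.commute)
    then have "msum (\<lambda>v. V v * pd v (f * g)) = g * msum (\<lambda>v. V v * pd v f) + f * msum (\<lambda>v. V v * pd v g)"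
      by (simp only: msum_add[OF lf] msum_mult_left[OF lf])
    then show "msum (\<lambda>v. V v * pd v (f * g)) = msum (\<lambda>v. V v * pd v f) * g + f * msum (\<lambda>v. V v * pd v g)"
      by (simp only: mult.commute[of g])
  qed
  show "along V (c *\<^sub>c f) = c *\<^sub>c along V f"
    unfolding along_def
    by (subst (1 2) cscale_conv_times) (simp add: pd_times pd_cscale msum_mult_left[OF lf] del: cscale_times_left)
  show "along V (sum h A) = (\<Sum>i\<in>A. along V (h i))"
    by (induction A rule: infinite_finite_induct) (simp_all add: add, simp_all add: along_def)
qed

section \<open>Linearity over functions\<close>

text \<open>Linearity over functions for infinite combinations, so that the values on coordinate
  fields determine a tensor on all vector fields.\<close>

definition mlinear :: "('v vfield \<Rightarrow> 'v mfps) \<Rightarrow> bool"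
  where "mlinear f \<longleftrightarrow> (\<forall>W. vector_field W \<longrightarrow> f W = msum (\<lambda>v. W v * f (coord v)))"

lemma mlinearI: "(\<And>W. vector_field W \<Longrightarrow> f W = msum (\<lambda>v. W v * f (coord v))) \<Longrightarrow> mlinear f"
  unfolding mlinear_def by blast

lemma mlinearD: "mlinear f \<Longrightarrow> vector_field W \<Longrightarrow> f W = msum (\<lambda>v. W v * f (coord v))"
  unfolding mlinear_def by blast

lemma mlinear_contract: "mlinear (\<lambda>W. contract F (W # Ws))"
  by (rule mlinearI) simp

lemma mlinear_0: "mlinear (\<lambda>W. 0)"
  by (rule mlinearI) simp

lemma mlinear_add:
  assumes "mlinear f" "mlinear g"
  shows "mlinear (\<lambda>W. f W + g W)"
proof (rule mlinearI)
  fix W :: "'a vfield" assume W: "vector_field W"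
  show "f W + g W = msum (\<lambda>v. W v * (f (coord v) + g (coord v)))"
    unfolding mlinearD[OF assms(1) W] mlinearD[OF assms(2) W]
    using W unfolding vector_field_def by (rule msum_add[symmetric])
qed

lemma mlinear_mult:
  assumes "mlinear f"
  shows "mlinear (\<lambda>W. g * f W)"
proof (rule mlinearI)
  fix W :: "'a vfield" assume W: "vector_field W"
  show "g * f W = msum (\<lambda>v. W v * (g * f (coord v)))"
    unfolding mlinearD[OF assms W] using W unfolding vector_field_def by (rule msum_mult_left[symmetric])
qed

lemma mlinear_mult_right: "mlinear f \<Longrightarrow> mlinear (\<lambda>W. f W * g)"
  using mlinear_mult[of f g] by (simp add: mult.commute)

lemma mlinear_cscale: "mlinear f \<Longrightarrow> mlinear (\<lambda>W. c *\<^sub>c f W)"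
  using mlinear_mult[of f "c *\<^sub>c 1"] by simp

lemma mlinear_minus: "mlinear f \<Longrightarrow> mlinear (\<lambda>W. - f W)"
  using mlinear_cscale[of f "-1"] by (simp add: cscale_minus_left)

lemma mlinear_diff: "mlinear f \<Longrightarrow> mlinear g \<Longrightarrow> mlinear (\<lambda>W. f W - g W)"
  using mlinear_add[of f "\<lambda>W. - g W"] mlinear_minus[of g] by simp

lemma mlinear_sum: "(\<And>i. i \<in> A \<Longrightarrow> mlinear (f i)) \<Longrightarrow> mlinear (\<lambda>W. \<Sum>i\<in>A. f i W)"
  by (induction A rule: infinite_finite_induct) (simp_all add: mlinear_0 mlinear_add)

lemma mlinear_cong:
  assumes "mlinear f" "\<And>W. vector_field W \<Longrightarrow> f W = g W"
  shows "mlinear g"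
proof (rule mlinearI)
  fix W :: "'a vfield" assume W: "vector_field W"
  have "f (coord v) = g (coord v)" for v
    by (rule assms(2)) simp
  then show "g W = msum (\<lambda>v. W v * g (coord v))"
    using mlinearD[OF assms(1) W] assms(2)[OF W] by simp
qed

text \<open>This is how products, the correction in \<open>T\<close> and frame vectors are expanded
  inside a tensor; the coefficients \<open>a i\<close> are functions, not just scalars.\<close>

lemma mlinear_comb:
  assumes "mlinear f" "\<And>i. i \<in> A \<Longrightarrow> vector_field (X i)"
  shows "f (\<lambda>v. \<Sum>i\<in>A. a i * X i v) = (\<Sum>i\<in>A. a i * f (X i))"
proof -
  have X: "vector_field (\<lambda>v. a i * X i v)" if "i \<in> A" for i
    using assms(2)[OF that] by (rule vector_field_times)
  have f: "f W = msum (\<lambda>v. W v * f (coord v))" if "vector_field W" for W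
    by (rule mlinearD[OF assms(1) that])
  show ?thesis
  proof (cases "finite A")
    case True
    show ?thesis
    proof (subst f, intro vector_field_sum X, assumption, rule mfps_eqI_agree)
      fix m
      let ?S = "low_support (\<lambda>v. \<Sum>i\<in>A. a i * X i v) m \<union> (\<Union>i\<in>A. low_support (X i) m)"
      have lf: "locally_finite (\<lambda>v. \<Sum>i\<in>A. a i * X i v)"
        using vector_field_sum[OF X] by (simp add: vector_field_def)
      have lfX: "locally_finite (X i)" if "i \<in> A" for i
        using assms(2)[OF that] by (simp add: vector_field_def)
      have fin: "finite ?S"
        using True lf lfX by (simp add: finite_low_support)
      have "agree m (msum (\<lambda>v. (\<Sum>i\<in>A. a i * X i v) * f (coord v)))
          (\<Sum>v\<in>?S. (\<Sum>i\<in>A. a i * X i v) * f (coord v))"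
        by (rule agree_msum[OF fin]) simp
      also have "\<dots> = (\<Sum>i\<in>A. a i * (\<Sum>v\<in>?S. X i v * f (coord v)))"
        unfolding sum_distrib_left sum_distrib_right by (subst sum.swap) (simp add: mult.assoc)
      also have "agree m \<dots> (\<Sum>i\<in>A. a i * msum (\<lambda>v. X i v * f (coord v)))"
        by (intro agree_sum agree_times agree_refl agree_sym[OF agree_msum] fin) auto
      also have "\<dots> = (\<Sum>i\<in>A. a i * f (X i))"
        using assms(2) by (intro sum.cong refl) (simp add: f[symmetric])
      finally show "agree m (msum (\<lambda>v. (\<Sum>i\<in>A. a i * X i v) * f (coord v)))
          (\<Sum>i\<in>A. a i * f (X i))" .
    qed
  next
    case False
    \<comment> \<open>Over an infinite index set both sums are 0 by convention, so the claim becomes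
      that the zero field is sent to 0.\<close>
    have "f (\<lambda>v. 0) = 0"
      using f[of "\<lambda>v. 0"] by (simp add: finite_support_vector_field)
    with False show ?thesis by simp
  qed
qed

lemma mlinear_combine:
  assumes "mlinear f" "vector_field X" "vector_field Y"
  shows "f (\<lambda>v. a *\<^sub>c X v + b *\<^sub>c Y v) = a *\<^sub>c f X + b *\<^sub>c f Y"
proof -
  have "f (\<lambda>v. \<Sum>i\<in>UNIV. (if i then a *\<^sub>c 1 else b *\<^sub>c 1) * (if i then X else Y) v) =
      (\<Sum>i\<in>UNIV. (if i then a *\<^sub>c 1 else b *\<^sub>c 1) * f (if i then X else Y))"
    using assms by (intro mlinear_comb) auto
  then show ?thesis by (simp add: UNIV_bool add.commute)
qed

lemma mlinear_eqI:
  assumes "mlinear f" "vector_field W" "\<And>v. f (coord v) = 0"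
  shows "f W = 0"
proof -
  have "f W = msum (\<lambda>v. W v * f (coord v))"
    by (rule mlinearD[OF assms(1,2)])
  then show ?thesis using assms(3) by simp
qed

text \<open>By the Leibniz rule, differentiating the components of \<open>W\<close> produces exactly
  \<open>S (nabla V W)\<close>, which the covariant derivative subtracts. What remains is again
  linear over functions in \<open>W\<close>.\<close>

lemma cov_deriv_mlinear:
  assumes S: "mlinear S" and V: "vector_field V" and W: "vector_field W"
  shows "cov_deriv V (\<lambda>Ws. S (Ws ! 0)) [W] = msum (\<lambda>v. W v * along V (S (coord v)))"
proof -
  note lf = V[unfolded vector_field_def] W[unfolded vector_field_def]
  have S': "S X = msum (\<lambda>v. X v * S (coord v))" if "vector_field X" for X
    by (rule mlinearD[OF S that])
  have "along V (S W) = along V (msum (\<lambda>v. W v * S (coord v)))"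
    using S'[OF W] by (rule arg_cong)
  also have "\<dots> = msum (\<lambda>u. V u * msum (\<lambda>v. S (coord v) * pd u (W v)))
      + msum (\<lambda>u. V u * msum (\<lambda>v. W v * pd u (S (coord v))))"
    unfolding along_def using lf by (simp add: pd_msum msum_add mult.commute[of "pd _ (W _)"])
  also have "msum (\<lambda>u. V u * msum (\<lambda>v. W v * pd u (S (coord v)))) =
      msum (\<lambda>v. W v * along V (S (coord v)))"
    unfolding along_def using lf by (subst msum_swap) simp_all
  also have "msum (\<lambda>u. V u * msum (\<lambda>v. S (coord v) * pd u (W v))) = S (nabla V W)"
  proof (rule mfps_eqI_agree)
    fix m
    let ?R = "low_support V m"
    let ?S = "low_support (nabla V W) m \<union> (\<Union>u\<in>?R. low_support (\<lambda>v. pd u (W v)) m)"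
    have vf: "vector_field (nabla V W)"
      using V W by (rule vector_field_nabla[rotated])
    have R: "finite ?R" and fin: "finite ?S"
      using vf lf by (auto simp: finite_low_support locally_finite_pd vector_field_def)
    have "agree m (msum (\<lambda>u. V u * msum (\<lambda>v. S (coord v) * pd u (W v))))
        (\<Sum>u\<in>?R. V u * msum (\<lambda>v. pd u (W v) * S (coord v)))"
      unfolding mult.commute[of "S _"] by (rule agree_msum[OF R order_refl])
    also have "agree m \<dots> (\<Sum>u\<in>?R. V u * (\<Sum>v\<in>?S. pd u (W v) * S (coord v)))"
      by (intro agree_sum agree_times agree_refl agree_msum fin) auto
    also have "\<dots> = (\<Sum>v\<in>?S. (\<Sum>u\<in>?R. V u * pd u (W v)) * S (coord v))"
      unfolding sum_distrib_left sum_distrib_right by (subst sum.swap) (simp add: mult.assoc)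
    also have "agree m \<dots> (\<Sum>v\<in>?S. nabla V W v * S (coord v))"
      unfolding nabla_def along_def
      by (intro agree_sum agree_times agree_refl agree_sym[OF agree_msum[OF R order_refl]])
    also have "agree m \<dots> (msum (\<lambda>v. nabla V W v * S (coord v)))"
      by (rule agree_sym[OF agree_msum[OF fin]]) simp
    also have "\<dots> = S (nabla V W)"
      by (rule S'[OF vf, symmetric])
    finally show "agree m (msum (\<lambda>u. V u * msum (\<lambda>v. S (coord v) * pd u (W v)))) (S (nabla V W))" .
  qed
  finally show ?thesis
    by (simp add: cov_deriv_def)
qed

section \<open>Graphs\<close>

text \<open>
  A vertex is a genus together with the labels of its legs, a graph a list of vertices.  A label
  occurring twice is an edge.  Labels \<open>0\<close>, \<open>1\<close>, \<open>2\<close> are reserved for edges, and edge \<open>2\<close> for the edge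
  created by a recursion relation.
\<close>

type_synonym vertex = "nat \<times> nat list"
type_synonym graph = "vertex list"
type_synonym comb = "(int \<times> graph) list"

definition legs :: "graph \<Rightarrow> nat list"
  where "legs m = concat (map snd m)"

definition scale_comb :: "int \<Rightarrow> comb \<Rightarrow> comb"
  where "scale_comb k p = map (\<lambda>(c, m). (k * c, m)) p"

definition attach :: "graph \<Rightarrow> comb \<Rightarrow> comb"
  where "attach q p = map (\<lambda>(c, m). (c, q @ m)) p"

text \<open>The Leibniz rule for a product of correlators: the derivative acts on one vertex at a
  time and gives it the new leg \<open>z\<close>.\<close>

fun insert_leg_graph :: "nat \<Rightarrow> graph \<Rightarrow> graph list" where
  "insert_leg_graph z [] = []"
| "insert_leg_graph z ((g, ls) # m) = ((g, z # ls) # m) # map ((#) (g, ls)) (insert_leg_graph z m)"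

definition insert_leg :: "nat \<Rightarrow> comb \<Rightarrow> comb"
  where "insert_leg z p = concat (map (\<lambda>(c, m). map (Pair c) (insert_leg_graph z m)) p)"

text \<open>Entries are distributed by position, so equal entries count separately, as in an
  iterated Leibniz rule.\<close>

fun splits :: "'a list \<Rightarrow> ('a list \<times> 'a list) list" where
  "splits [] = [([], [])]"
| "splits (x # xs) = map (\<lambda>(a, b). (x # a, b)) (splits xs) @ map (\<lambda>(a, b). (a, x # b)) (splits xs)"

lemma splits_map: "splits (map f xs) = map (\<lambda>(a, b). (map f a, map f b)) (splits xs)"
  by (induction xs) (simp_all add: case_prod_beta comp_def)

lemma mset_splits: "(a, b) \<in> set (splits xs) \<Longrightarrow> mset xs = mset a + mset b"
  by (induction xs arbitrary: a b) auto

lemma splits_Nil_left: "filter (\<lambda>(a, b). a = []) (splits xs) = [([], xs)]"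
  by (induction xs) (simp_all add: filter_map comp_def case_prod_beta)

text \<open>
  The recursion relations for a leg carrying \<open>T(W)\<close>, multiplied by 24 to keep the coefficients
  integral.  The splitting with \<open>a = []\<close> is the one subtracted in the definition of \<open>T\<close>.
\<close>

definition T_vertex :: "nat \<Rightarrow> vertex \<Rightarrow> comb" where
  "T_vertex z v = (case v of (g, ls) \<Rightarrow>
     let ks = remove1 z ls in
     if g = 0
     then map (\<lambda>(a, b). (24, [(0, z # a @ [2]), (0, 2 # b @ take 2 ks)]))
        (filter (\<lambda>(a, b). a \<noteq> []) (splits (drop 2 ks)))
     else (1, [(0, z # ks @ [2, 2])]) # map (\<lambda>(a, b). (24, [(0, z # a @ [2]), (1, 2 # b)]))
        (filter (\<lambda>(a, b). a \<noteq> []) (splits ks)))"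

definition eliminate_T :: "nat \<Rightarrow> comb \<Rightarrow> comb" where
  "eliminate_T z p = concat (map (\<lambda>(c, m).
     concat (map (\<lambda>v. scale_comb c (attach (filter (\<lambda>v. z \<notin> set (snd v)) m) (T_vertex z v)))
       (filter (\<lambda>v. z \<in> set (snd v)) m))) p)"

text \<open>Label 2 must be available for the new edge, and a vertex of genus 0 needs two further
  legs, the pair that the genus-0 recursion keeps together.\<close>

definition T_eliminable :: "nat \<Rightarrow> graph \<Rightarrow> bool" where
  "T_eliminable z m \<longleftrightarrow> count_list (legs m) z = 1 \<and> 2 \<notin> set (legs m) \<and>
     list_all (\<lambda>(g, ls). g = 0 \<and> 3 \<le> length ls \<or> g = 1) m"

text \<open>The WDVV equation \<open><<a b e>> <<e c d>> - <<a c e>> <<e b d>>\<close>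
  differentiated along \<open>xs\<close>: the additional legs are distributed over the two vertices
  in all ways.\<close>

definition WDVV_comb :: "nat \<Rightarrow> nat \<Rightarrow> nat \<Rightarrow> nat \<Rightarrow> nat list \<Rightarrow> comb" where
  "WDVV_comb a b c d xs = concat (map (\<lambda>(ys, zs).
     [(1, [(0, a # b # ys @ [2]), (0, 2 # zs @ [c, d])]),
      (-1, [(0, a # c # ys @ [2]), (0, 2 # zs @ [b, d])])]) (splits xs))"

definition relabel :: "(nat \<Rightarrow> nat) \<Rightarrow> graph \<Rightarrow> graph"
  where "relabel f m = map (\<lambda>(g, ls). (g, map f ls)) m"

subsection \<open>Normal forms\<close>

fun insert_by :: "('a \<Rightarrow> 'a \<Rightarrow> bool) \<Rightarrow> 'a \<Rightarrow> 'a list \<Rightarrow> 'a list" where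
  "insert_by le x [] = [x]"
| "insert_by le x (y # ys) = (if le x y then x # y # ys else y # insert_by le x ys)"

definition sort_by :: "('a \<Rightarrow> 'a \<Rightarrow> bool) \<Rightarrow> 'a list \<Rightarrow> 'a list"
  where "sort_by le xs = foldr (insert_by le) xs []"

lemma mset_insert_by: "mset (insert_by le x xs) = add_mset x (mset xs)"
  by (induction xs) auto

lemma mset_sort_by [simp]: "mset (sort_by le xs) = mset xs"
  by (induction xs) (simp_all add: sort_by_def mset_insert_by)

fun le_list :: "('a \<Rightarrow> 'a \<Rightarrow> bool) \<Rightarrow> 'a list \<Rightarrow> 'a list \<Rightarrow> bool" where
  "le_list le [] ys = True"
| "le_list le (x # xs) [] = False"
| "le_list le (x # xs) (y # ys) =
     (if le x y then if le y x then le_list le xs ys else True else False)"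

fun le_vertex :: "vertex \<Rightarrow> vertex \<Rightarrow> bool" where
  "le_vertex (g, ls) (h, ks) =
     (if g < h then True else if h < g then False else le_list (\<le>) ls ks)"

definition le_graph :: "graph \<Rightarrow> graph \<Rightarrow> bool"
  where "le_graph = le_list le_vertex"

definition sort_graph :: "graph \<Rightarrow> graph"
  where "sort_graph m = sort_by le_vertex (map (\<lambda>(g, ls). (g, sort_by (\<le>) ls)) m)"

fun edge_perm :: "nat \<times> nat \<times> nat \<Rightarrow> nat \<Rightarrow> nat" where
  "edge_perm (a, b, c) n = (case n of 0 \<Rightarrow> a | Suc k \<Rightarrow>
     case k of 0 \<Rightarrow> b | Suc l \<Rightarrow> case l of 0 \<Rightarrow> c | Suc _ \<Rightarrow> n)"

text \<open>The least sorted graph under the six renamings of the edges 0, 1, 2; the identity is the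
  starting value of the fold. Graphs that differ only in the order of vertices or legs and in the
  names of edges are thus identified.\<close>

definition canonical :: "graph \<Rightarrow> graph" where
  "canonical m = fold (\<lambda>p k. let m' = sort_graph (relabel (edge_perm p) m) in
       if le_graph m' k then m' else k)
     [(0, 2, 1), (1, 0, 2), (1, 2, 0), (2, 0, 1), (2, 1, 0)] (sort_graph m)"

text \<open>A search tree ordered by \<open>le_graph\<close> that adds up the coefficients of equal
  graphs, which keeps the evaluation of long combinations feasible.\<close>

datatype comb_tree = Leaf | Node comb_tree int graph comb_tree

fun add_term :: "int \<Rightarrow> graph \<Rightarrow> comb_tree \<Rightarrow> comb_tree" where
  "add_term c m Leaf = Node Leaf c m Leaf"
| "add_term c m (Node l d k r) =
     (if le_graph m k then if m = k then Node l (c + d) k r else Node (add_term c m l) d k r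
      else Node l d k (add_term c m r))"

fun terms :: "comb_tree \<Rightarrow> comb" where
  "terms Leaf = []"
| "terms (Node l c m r) = (c, m) # terms l @ terms r"

definition collect :: "(graph \<Rightarrow> graph) \<Rightarrow> comb \<Rightarrow> comb"
  where "collect f p = terms (fold (\<lambda>(c, m). add_term c (f m)) p Leaf)"

definition cancels :: "comb \<Rightarrow> bool"
  where "cancels p \<longleftrightarrow> list_all (\<lambda>(c, m). c = 0) (collect canonical p)"

section \<open>The tensor of a graph\<close>

context gw_data
begin

definition graph_val :: "(nat \<Rightarrow> (nat \<times> 'n) vfield) \<Rightarrow> graph \<Rightarrow> (nat \<times> 'n) mfps"
  where "graph_val \<rho> m = (\<Prod>(g, ls)\<leftarrow>m. contract (potential g) (map \<rho> ls))"

definition comb_val :: "(nat \<Rightarrow> (nat \<times> 'n) vfield) \<Rightarrow> comb \<Rightarrow> (nat \<times> 'n) mfps"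
  where "comb_val \<rho> p = (\<Sum>(c, m)\<leftarrow>p. of_int c *\<^sub>c graph_val \<rho> m)"

lemma graph_val_simps [simp]:
  "graph_val \<rho> [] = 1"
  "graph_val \<rho> ((g, ls) # m) = contract (potential g) (map \<rho> ls) * graph_val \<rho> m"
  unfolding graph_val_def by simp_all

lemma graph_val_append: "graph_val \<rho> (m @ k) = graph_val \<rho> m * graph_val \<rho> k"
  unfolding graph_val_def by simp

lemma comb_val_simps [simp]:
  "comb_val \<rho> [] = 0"
  "comb_val \<rho> ((c, m) # p) = of_int c *\<^sub>c graph_val \<rho> m + comb_val \<rho> p"
  unfolding comb_val_def by simp_all

lemma comb_val_append [simp]: "comb_val \<rho> (p @ q) = comb_val \<rho> p + comb_val \<rho> q"
  unfolding comb_val_def by simp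

lemma comb_val_scale_comb [simp]: "comb_val \<rho> (scale_comb k p) = of_int k *\<^sub>c comb_val \<rho> p"
  by (induction p) (auto simp: scale_comb_def cscale_add_right)

lemma comb_val_attach [simp]: "comb_val \<rho> (attach q p) = graph_val \<rho> q * comb_val \<rho> p"
  by (induction p) (auto simp: attach_def graph_val_append distrib_left)

lemma graph_val_cong: "(\<And>n. n \<in> set (legs m) \<Longrightarrow> \<rho> n = \<rho>' n) \<Longrightarrow> graph_val \<rho> m = graph_val \<rho>' m"
proof (induction m)
  case (Cons v m)
  obtain g ls where v: "v = (g, ls)" by force
  have "map \<rho> ls = map \<rho>' ls"
    using Cons.prems by (intro map_cong refl) (simp add: v legs_def)
  moreover have "graph_val \<rho> m = graph_val \<rho>' m"
    using Cons.prems by (intro Cons.IH) (simp add: v legs_def)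
  ultimately show ?case by (simp only: v graph_val_simps)
qed simp

lemma graph_val_relabel: "graph_val \<rho> (relabel f m) = graph_val (\<rho> \<circ> f) m"
  by (induction m) (auto simp: relabel_def comp_def)

lemma graph_val_perm: "mset m = mset k \<Longrightarrow> graph_val \<rho> m = graph_val \<rho> k"
  unfolding graph_val_def prod_mset_prod_list[symmetric] mset_map by simp

lemma graph_val_sort_graph:
  assumes "\<And>n. vector_field (\<rho> n)"
  shows "graph_val \<rho> (sort_graph m) = graph_val \<rho> m"
proof -
  have "graph_val \<rho> (sort_graph m) = graph_val \<rho> (map (\<lambda>(g, ls). (g, sort_by (\<le>) ls)) m)"
    by (rule graph_val_perm) (simp add: sort_graph_def)
  also have "\<dots> = graph_val \<rho> m"
  proof (induction m)
    case (Cons v m)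
    obtain g ls where v: "v = (g, ls)" by force
    have "contract (potential g) (map \<rho> (sort_by (\<le>) ls)) = contract (potential g) (map \<rho> ls)"
      using assms by (intro contract_perm) auto
    with Cons show ?case by (simp add: v)
  qed simp
  finally show ?thesis .
qed

lemma along_graph_val:
  fixes m :: graph
  assumes "\<And>n. n \<in> set (legs m) \<Longrightarrow> constant_field (\<rho> n)" "vector_field (\<rho> z)"
  shows "along (\<rho> z) (graph_val \<rho> m) = (\<Sum>k\<leftarrow>insert_leg_graph z m. graph_val \<rho> k)"
  using assms(1)
proof (induction m)
  case Nil
  show ?case by (simp add: along_def)
next
  case (Cons v m)
  obtain g ls where v: "v = (g, ls)" by force
  have "along (\<rho> z) (graph_val \<rho> m) = (\<Sum>k\<leftarrow>insert_leg_graph z m. graph_val \<rho> k)"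
    using Cons.prems by (intro Cons.IH) (simp add: legs_def)
  moreover have "along (\<rho> z) (contract (potential g) (map \<rho> ls)) = contract (potential g) (map \<rho> (z # ls))"
    using Cons.prems unfolding list.map by (intro along_contract) (auto simp: legs_def v)
  moreover have "(\<Sum>k\<leftarrow>map ((#) (g, ls)) ms. graph_val \<rho> k) =
      contract (potential g) (map \<rho> ls) * (\<Sum>k\<leftarrow>ms. graph_val \<rho> k)" for ms
    by (induction ms) (simp_all add: distrib_left)
  moreover have "(\<Sum>k\<leftarrow>insert_leg_graph z (v # m). graph_val \<rho> k) =
      contract (potential g) (map \<rho> (z # ls)) * graph_val \<rho> m +
      (\<Sum>k\<leftarrow>map ((#) (g, ls)) (insert_leg_graph z m). graph_val \<rho> k)"
    by (simp add: v)
  ultimately show ?case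
    using assms(2) by (simp only: v graph_val_simps along_times)
qed

lemma along_comb_val:
  assumes "\<And>c m n. (c, m) \<in> set p \<Longrightarrow> n \<in> set (legs m) \<Longrightarrow> constant_field (\<rho> n)" "vector_field (\<rho> z)"
  shows "along (\<rho> z) (comb_val \<rho> p) = comb_val \<rho> (insert_leg z p)"
  using assms(1)
proof (induction p)
  case Nil
  show ?case by (simp add: along_def insert_leg_def)
next
  case (Cons t p)
  obtain c m where t: "t = (c, m)" by force
  have pv: "comb_val \<rho> (map (Pair c) ms) = of_int c *\<^sub>c (\<Sum>k\<leftarrow>ms. graph_val \<rho> k)" for ms
    by (induction ms) (simp_all add: cscale_add_right)
  have "along (\<rho> z) (comb_val \<rho> p) = comb_val \<rho> (insert_leg z p)"
    using Cons.prems by (intro Cons.IH) auto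
  moreover have "along (\<rho> z) (graph_val \<rho> m) = (\<Sum>k\<leftarrow>insert_leg_graph z m. graph_val \<rho> k)"
    using Cons.prems assms(2) by (intro along_graph_val) (auto simp: t)
  ultimately show ?case
    using assms(2) by (simp add: t insert_leg_def along_add along_cscale pv)
qed

text \<open>A label occurring once lies on a single vertex, so its field enters through one
  correlator and the rest of the graph is a fixed factor. Linearity in a leg and the elimination of
  \<open>T\<close> both rest on this factorization.\<close>

lemma graph_val_isolate:
  assumes "count_list (legs m) z = 1" "\<And>n. vector_field (\<rho> n)"
  obtains g ls where "filter (\<lambda>v. z \<in> set (snd v)) m = [(g, ls)]" "(g, ls) \<in> set m"
    "count_list ls z = 1"
    "\<And>X. vector_field X \<Longrightarrow> graph_val (\<rho>(z := X)) m =
       graph_val \<rho> (filter (\<lambda>v. z \<notin> set (snd v)) m) *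
       contract (potential g) (X # map \<rho> (remove1 z ls))"
  using assms(1)
proof (induction m arbitrary: thesis)
  case Nil
  then show ?case by (simp add: legs_def)
next
  case (Cons v m)
  obtain h ks where v: "v = (h, ks)" by force
  have upd: "map (\<rho>(z := X)) l = map \<rho> l" if "z \<notin> set l" for l X
    using that by auto
  show ?case
  proof (cases "z \<in> set ks")
    case True
    then have "count_list ks z \<noteq> 0"
      by (simp add: count_list_0_iff)
    with Cons.prems(2) have c: "count_list ks z = 1" "count_list (legs m) z = 0"
      by (auto simp: legs_def v)
    then have m: "z \<notin> set (snd w)" if "w \<in> set m" for w
      using that by (auto simp: legs_def count_list_0_iff)
    obtain xs ys where ks: "ks = xs @ z # ys" "z \<notin> set xs"
      using True by (meson split_list_first)
    with c have ys: "z \<notin> set ys"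
      by (simp add: count_list_0_iff)
    show thesis
    proof (rule Cons.prems(1))
      have f: "filter (\<lambda>w. z \<in> set (snd w)) m = []" "filter (\<lambda>w. z \<notin> set (snd w)) m = m"
        using m by (auto simp: filter_empty_conv filter_id_conv)
      then show "filter (\<lambda>w. z \<in> set (snd w)) (v # m) = [(h, ks)]" "(h, ks) \<in> set (v # m)"
        using True by (auto simp: v)
      show "count_list ks z = 1" by fact
      fix X :: "(nat \<times> 'n) vfield" assume X: "vector_field X"
      have "contract (potential h) (map (\<rho>(z := X)) ks) = contract (potential h) (map \<rho> xs @ X # map \<rho> ys)"
        using ks ys by (simp add: upd)
      also have "\<dots> = contract (potential h) (X # map \<rho> xs @ map \<rho> ys)"
        using X assms(2) by (intro contract_move) auto
      also have "map \<rho> xs @ map \<rho> ys = map \<rho> (remove1 z ks)"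
        using ks by (simp add: remove1_append)
      moreover have "graph_val (\<rho>(z := X)) m = graph_val \<rho> m"
        using c by (intro graph_val_cong) (auto simp: count_list_0_iff)
      ultimately show "graph_val (\<rho>(z := X)) (v # m) = graph_val \<rho> (filter (\<lambda>w. z \<notin> set (snd w)) (v # m)) *
          contract (potential h) (X # map \<rho> (remove1 z ks))"
        using True f(2) by (simp add: v mult.commute del: contract.simps list.map)
    qed
  next
    case False
    then have "count_list (legs m) z = 1"
      using Cons.prems(2) by (simp add: legs_def v count_list_0_iff)
    then obtain g ls where *: "filter (\<lambda>v. z \<in> set (snd v)) m = [(g, ls)]" "(g, ls) \<in> set m"
      "count_list ls z = 1"
      "\<And>X. vector_field X \<Longrightarrow> graph_val (\<rho>(z := X)) m =
         graph_val \<rho> (filter (\<lambda>v. z \<notin> set (snd v)) m) *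
         contract (potential g) (X # map \<rho> (remove1 z ls))"
      using Cons.IH by blast
    show thesis
    proof (rule Cons.prems(1))
      show "filter (\<lambda>w. z \<in> set (snd w)) (v # m) = [(g, ls)]" "(g, ls) \<in> set (v # m)" "count_list ls z = 1"
        using * False by (auto simp: v)
      fix X :: "(nat \<times> 'n) vfield" assume X: "vector_field X"
      show "graph_val (\<rho>(z := X)) (v # m) = graph_val \<rho> (filter (\<lambda>w. z \<notin> set (snd w)) (v # m)) *
          contract (potential g) (X # map \<rho> (remove1 z ls))"
        using *(4)[OF X] False by (simp add: v upd mult.assoc del: contract.simps list.map)
    qed
  qed
qed

lemma mlinear_comb_val:
  assumes "\<And>n. vector_field (\<rho> n)" "list_all (\<lambda>(c, m). count_list (legs m) z = 1) p"
  shows "mlinear (\<lambda>X. comb_val (\<rho>(z := X)) p)"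
  using assms(2)
proof (induction p)
  case Nil
  show ?case by (simp add: mlinear_0)
next
  case (Cons t p)
  obtain c m where t: "t = (c, m)" by force
  with Cons.prems have "count_list (legs m) z = 1" by simp
  then have "mlinear (\<lambda>X. graph_val (\<rho>(z := X)) m)"
  proof (rule graph_val_isolate[where \<rho> = \<rho>, OF _ assms(1)])
    fix g ls
    assume *: "\<And>X. vector_field X \<Longrightarrow> graph_val (\<rho>(z := X)) m =
       graph_val \<rho> (filter (\<lambda>v. z \<notin> set (snd v)) m) *
       contract (potential g) (X # map \<rho> (remove1 z ls))"
    show ?thesis
      by (rule mlinear_cong[OF mlinear_mult[OF mlinear_contract] *[symmetric]])
  qed
  moreover have "mlinear (\<lambda>X. comb_val (\<rho>(z := X)) p)"
    by (rule Cons.IH) (use Cons.prems in simp)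
  ultimately show ?case
    unfolding t comb_val_simps by (intro mlinear_add mlinear_cscale)
qed

end

declare contract.simps(2) [simp del]

text \<open>Exactly one split has an empty first part; it matches the correction term in the
  definition of \<open>T\<close>.\<close>

lemma sum_list_splits_nonempty:
  fixes f :: "'a list \<times> 'a list \<Rightarrow> 'b :: ab_group_add"
  shows "(\<Sum>s\<leftarrow>filter (\<lambda>(a, b). a \<noteq> []) (splits xs). f s) = (\<Sum>s\<leftarrow>splits xs. f s) - f ([], xs)"
proof -
  have "(\<Sum>s\<leftarrow>ss. f s) = (\<Sum>s\<leftarrow>filter (\<lambda>(a, b). a \<noteq> []) ss. f s) + (\<Sum>s\<leftarrow>filter (\<lambda>(a, b). a = []) ss. f s)" for ss
    by (induction ss) (auto simp: algebra_simps)
  from this[of "splits xs"] show ?thesis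
    by (simp add: splits_Nil_left)
qed

lemma mlinear_contract_at:
  assumes "\<And>V. V \<in> set xs \<Longrightarrow> vector_field V"
  shows "mlinear (\<lambda>X. contract F (xs @ X # ys))"
  by (rule mlinear_cong[OF mlinear_contract]) (rule contract_move[symmetric], use assms in auto)

lemma along_sum_list:
  assumes "vector_field V"
  shows "along V (\<Sum>x\<leftarrow>xs. h x) = (\<Sum>x\<leftarrow>xs. along V (h x))"
proof (induction xs)
  case Nil
  show ?case by (simp add: along_def)
qed (simp add: along_add assms)

lemma sum_sum_list: "(\<Sum>i\<in>A. \<Sum>x\<leftarrow>xs. h i x) = (\<Sum>x\<leftarrow>xs. \<Sum>i\<in>A. h i x)"
  by (induction xs) (simp_all add: sum.distrib)

context gw_data
begin

section \<open>Contraction of dual bases\<close>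

lemma constant_field_basis [simp]: "constant_field (\<gamma>d \<alpha>)" "constant_field (\<gamma>u \<alpha>)"
proof -
  show d: "constant_field (\<gamma>d \<alpha>)" for \<alpha>
    using constant_field_coord[of "(0, \<alpha>)"] by (simp add: \<gamma>d_def \<tau>_def coord_def)
  show "constant_field (\<gamma>u \<alpha>)"
    unfolding constant_field_def \<gamma>u_def
  proof (intro conjI allI)
    show "vector_field (\<lambda>v. \<Sum>\<beta>\<in>UNIV. matrix_inv \<eta> $ \<alpha> $ \<beta> *\<^sub>c \<gamma>d \<beta> v)"
      using d by (intro vector_field_sum vector_field_cscale constant_fieldD)
  next
    fix u v
    show "pd u (\<Sum>\<beta>\<in>UNIV. matrix_inv \<eta> $ \<alpha> $ \<beta> *\<^sub>c \<gamma>d \<beta> v) = 0"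
      using d by (simp add: pd_sum pd_cscale constant_field_pd)
  qed
qed

lemma vector_field_basis [simp]: "vector_field (\<gamma>d \<alpha>)" "vector_field (\<gamma>u \<alpha>)"
  by (intro constant_fieldD constant_field_basis)+

lemma matrix_inv_eta_sym: "matrix_inv \<eta> $ \<alpha> $ \<beta> = matrix_inv \<eta> $ \<beta> $ \<alpha>"
proof -
  let ?M = "matrix_inv \<eta>"
  have M: "\<eta> ** ?M = mat 1" "?M ** \<eta> = mat 1"
    using someI_ex[OF eta_invertible[unfolded invertible_def]] by (simp_all add: matrix_inv_def)
  have "transpose ?M = transpose ?M ** (\<eta> ** ?M)"
    by (simp add: M)
  also have "\<dots> = transpose (\<eta> ** ?M) ** ?M"
    by (simp add: matrix_transpose_mul eta_symmetric matrix_mul_assoc)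
  also have "\<dots> = ?M"
    by (simp add: M)
  finally have "transpose ?M $ \<beta> $ \<alpha> = ?M $ \<beta> $ \<alpha>"
    by simp
  then show ?thesis
    by (simp add: transpose_def)
qed

text \<open>
  Over the complex numbers the symmetric tensor \<open>\<Sum>\<^sub>\<alpha> \<gamma>\<^sup>\<alpha> \<otimes> \<gamma>\<^sub>\<alpha>\<close> is a sum of squares
  \<open>\<Sum>\<^sub>i e\<^sub>i \<otimes> e\<^sub>i\<close>.  The \<open>e\<^sub>i\<close> are not a basis, but contractions no longer distinguish upper and lower
  indices.
\<close>

definition e :: "'n \<times> bool \<Rightarrow> (nat \<times> 'n) vfield"
  where "e i = (case i of (\<alpha>, s) \<Rightarrow> \<lambda>v.
    (if s then 1 / 2 else \<i> / 2) *\<^sub>c \<gamma>u \<alpha> v + (if s then 1 / 2 else - (\<i> / 2)) *\<^sub>c \<gamma>d \<alpha> v)"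

lemma constant_field_e [simp]: "constant_field (e i)"
proof (cases i)
  case (Pair \<alpha> s)
  show ?thesis
    unfolding constant_field_def e_def Pair prod.case
    by (intro conjI allI vector_field_add vector_field_cscale vector_field_basis)
      (simp add: pd_add pd_cscale constant_field_pd)
qed

lemma vector_field_e [simp]: "vector_field (e i)"
  by simp

lemma sum_frame:
  assumes left: "\<And>y. vector_field y \<Longrightarrow> mlinear (\<lambda>x. \<phi> x y)"
    and right: "\<And>x. vector_field x \<Longrightarrow> mlinear (\<phi> x)"
  shows "(\<Sum>\<alpha>\<in>UNIV. \<phi> (\<gamma>d \<alpha>) (\<gamma>u \<alpha>)) = (\<Sum>i\<in>UNIV. \<phi> (e i) (e i))"
proof -
  have expand: "f (\<gamma>u \<alpha>) = (\<Sum>\<beta>\<in>UNIV. matrix_inv \<eta> $ \<alpha> $ \<beta> *\<^sub>c f (\<gamma>d \<beta>))" if "mlinear f" for f \<alpha>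
    using mlinear_comb[OF that, of UNIV \<gamma>d "\<lambda>\<beta>. matrix_inv \<eta> $ \<alpha> $ \<beta> *\<^sub>c 1"]
    by (simp add: \<gamma>u_def)
  \<comment> \<open>The two orders agree because the inverse of the symmetric matrix \<eta> is
    symmetric.\<close>
  have comm: "(\<Sum>\<alpha>\<in>UNIV. \<phi> (\<gamma>u \<alpha>) (\<gamma>d \<alpha>)) = (\<Sum>\<alpha>\<in>UNIV. \<phi> (\<gamma>d \<alpha>) (\<gamma>u \<alpha>))"
    unfolding expand[OF left[OF vector_field_basis(1)]] expand[OF right[OF vector_field_basis(1)]]
    by (subst sum.swap) (simp add: matrix_inv_eta_sym)
  \<comment> \<open>The coefficients 1/2, 1/2 and i/2, -i/2 make the squares of \<gamma>^\<alpha>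
    and of \<gamma>_\<alpha> cancel; the mixed terms remain, each with factor 1/4 + 1/4.\<close>
  have e: "\<phi> (e (\<alpha>, True)) (e (\<alpha>, True)) + \<phi> (e (\<alpha>, False)) (e (\<alpha>, False)) =
      (1/2) *\<^sub>c (\<phi> (\<gamma>u \<alpha>) (\<gamma>d \<alpha>) + \<phi> (\<gamma>d \<alpha>) (\<gamma>u \<alpha>))" for \<alpha>
  proof -
    have "\<phi> (e (\<alpha>, s)) (e (\<alpha>, s)) =
        (let a = if s then 1 / 2 else \<i> / 2; b = if s then 1 / 2 else - (\<i> / 2) in
         a *\<^sub>c (a *\<^sub>c \<phi> (\<gamma>u \<alpha>) (\<gamma>u \<alpha>) + b *\<^sub>c \<phi> (\<gamma>u \<alpha>) (\<gamma>d \<alpha>)) +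
         b *\<^sub>c (a *\<^sub>c \<phi> (\<gamma>d \<alpha>) (\<gamma>u \<alpha>) + b *\<^sub>c \<phi> (\<gamma>d \<alpha>) (\<gamma>d \<alpha>)))" for s
    proof -
      have "\<phi> (e (\<alpha>, s)) y = (if s then 1 / 2 else \<i> / 2) *\<^sub>c \<phi> (\<gamma>u \<alpha>) y +
          (if s then 1 / 2 else - (\<i> / 2)) *\<^sub>c \<phi> (\<gamma>d \<alpha>) y" if "vector_field y" for y
        unfolding e_def prod.case using mlinear_combine[OF left[OF that]] by simp
      moreover have "\<phi> x (e (\<alpha>, s)) = (if s then 1 / 2 else \<i> / 2) *\<^sub>c \<phi> x (\<gamma>u \<alpha>) +
          (if s then 1 / 2 else - (\<i> / 2)) *\<^sub>c \<phi> x (\<gamma>d \<alpha>)" if "vector_field x" for x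
        unfolding e_def prod.case using mlinear_combine[OF right[OF that]] by simp
      ultimately show ?thesis
        by (simp only: vector_field_e vector_field_basis Let_def)
          (simp only: cscale_add_right cscale_cscale ac_simps)
    qed
    then show ?thesis
      by (intro mfps_eqI) (simp add: Let_def field_simps)
  qed
  have "(\<Sum>i\<in>UNIV. \<phi> (e i) (e i)) = (\<Sum>\<alpha>\<in>UNIV. \<Sum>s\<in>UNIV. \<phi> (e (\<alpha>, s)) (e (\<alpha>, s)))"
    by (simp add: sum.cartesian_product flip: UNIV_Times_UNIV)
  also have "\<dots> = (\<Sum>\<alpha>\<in>UNIV. (1/2) *\<^sub>c (\<phi> (\<gamma>u \<alpha>) (\<gamma>d \<alpha>) + \<phi> (\<gamma>d \<alpha>) (\<gamma>u \<alpha>)))"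
    by (simp add: UNIV_bool flip: e) (simp add: add.commute)
  also have "\<dots> = (1/2) *\<^sub>c ((\<Sum>\<alpha>\<in>UNIV. \<phi> (\<gamma>d \<alpha>) (\<gamma>u \<alpha>)) + (\<Sum>\<alpha>\<in>UNIV. \<phi> (\<gamma>d \<alpha>) (\<gamma>u \<alpha>)))"
    by (simp only: cscale_sum[symmetric] sum.distrib comm)
  also have "\<dots> = (\<Sum>\<alpha>\<in>UNIV. \<phi> (\<gamma>d \<alpha>) (\<gamma>u \<alpha>))"
    by (simp only: cscale_add_right flip: cscale_add_left) simp
  finally show ?thesis ..
qed

section \<open>Topological recursion\<close>

lemma vector_field_qprod [simp]: "vector_field (W \<star> V)"
  unfolding qprod_def by (intro vector_field_sum vector_field_times vector_field_basis)

lemma vector_field_\<tau>_plus [simp]: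
  assumes "vector_field W"
  shows "vector_field (\<tau>_plus W)"
  unfolding vector_field_def locally_finite_def
proof
  fix m
  have "{v. coeff_mfps (\<tau>_plus W v) m \<noteq> 0} \<subseteq> (\<lambda>(n, \<alpha>). (Suc n, \<alpha>)) ` {v. coeff_mfps (W v) m \<noteq> 0}"
    by (force simp: \<tau>_plus_def image_iff split: nat.splits)
  then show "finite {v. coeff_mfps (\<tau>_plus W v) m \<noteq> 0}"
    using assms unfolding vector_field_def locally_finite_def
    by (blast intro: finite_subset[OF _ finite_imageI])
qed

lemma constant_field_\<tau>_plus [simp]: "constant_field W \<Longrightarrow> constant_field (\<tau>_plus W)"
  unfolding constant_field_def
  by (intro conjI allI vector_field_\<tau>_plus) (auto simp: \<tau>_plus_def split: nat.splits)

lemma vector_field_T [simp]: "vector_field W \<Longrightarrow> vector_field (T W)"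
  unfolding T_def
  by (intro vector_field_diff vector_field_sum vector_field_times vector_field_basis vector_field_\<tau>_plus)

lemma mlinear_qprod_apply:
  "mlinear f \<Longrightarrow> f (W \<star> V) = (\<Sum>\<alpha>\<in>UNIV. \<llangle>[W, V, \<gamma>u \<alpha>]\<rrangle>\<^sub>0 * f (\<gamma>d \<alpha>))"
  unfolding qprod_def by (rule mlinear_comb) simp_all

lemma mlinear_qprod_frame:
  assumes "mlinear f" "vector_field W" "vector_field V"
  shows "f (W \<star> V) = (\<Sum>i\<in>UNIV. \<llangle>[W, V, e i]\<rrangle>\<^sub>0 * f (e i))"
  unfolding mlinear_qprod_apply[OF assms(1)]
  using assms mlinear_contract_at[of "[W, V]" "potential 0" "[]"]
  by (intro sum_frame[where \<phi> = "\<lambda>x y. \<llangle>[W, V, y]\<rrangle>\<^sub>0 * f x"] mlinear_mult mlinear_mult_right) auto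

lemma mlinear_T_apply:
  assumes f: "mlinear f" and W: "vector_field W"
  shows "f (T W) = f (\<tau>_plus W) - (\<Sum>i\<in>UNIV. \<llangle>[W, e i]\<rrangle>\<^sub>0 * f (e i))"
proof -
  let ?X = "\<lambda>v. \<Sum>\<alpha>\<in>UNIV. \<llangle>[W, \<gamma>u \<alpha>]\<rrangle>\<^sub>0 * \<gamma>d \<alpha> v"
  have "vector_field ?X"
    by (intro vector_field_sum vector_field_times vector_field_basis)
  then have "f (\<lambda>v. 1 *\<^sub>c \<tau>_plus W v + (-1) *\<^sub>c ?X v) = 1 *\<^sub>c f (\<tau>_plus W) + (-1) *\<^sub>c f ?X"
    by (intro mlinear_combine f vector_field_\<tau>_plus W)
  moreover have "T W = (\<lambda>v. 1 *\<^sub>c \<tau>_plus W v + (-1) *\<^sub>c ?X v)"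
    by (rule ext) (simp add: T_def cscale_minus_left)
  ultimately have "f (T W) = 1 *\<^sub>c f (\<tau>_plus W) + (-1) *\<^sub>c f ?X"
    by (simp only:)
  also have "f ?X = (\<Sum>\<alpha>\<in>UNIV. \<llangle>[W, \<gamma>u \<alpha>]\<rrangle>\<^sub>0 * f (\<gamma>d \<alpha>))"
    by (rule mlinear_comb[OF f]) simp
  also have "\<dots> = (\<Sum>i\<in>UNIV. \<llangle>[W, e i]\<rrangle>\<^sub>0 * f (e i))"
    using f W mlinear_contract_at[of "[W]" "potential 0" "[]"]
    by (intro sum_frame[where \<phi> = "\<lambda>x y. \<llangle>[W, y]\<rrangle>\<^sub>0 * f x"] mlinear_mult mlinear_mult_right) auto
  finally show ?thesis
    by (simp add: cscale_minus_left)
qed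

end

locale gw_recursion = gw_data \<eta> GW
  for \<eta> :: "complex ^ 'n::finite ^ 'n" and GW :: "nat \<Rightarrow> (nat \<times> 'n) list \<Rightarrow> complex" +
  assumes \<rho>0_eq_0: "\<And>W1 W2 W3. vector_field W1 \<Longrightarrow> vector_field W2 \<Longrightarrow> vector_field W3 \<Longrightarrow> \<rho>0 W1 W2 W3 = 0"
    and \<rho>1_eq_0: "\<And>W. vector_field W \<Longrightarrow> \<rho>1 W = 0"
begin

text \<open>Induction by covariant derivatives of \<open>\<rho>0 = 0\<close>. With
  \<open>\<tau>_plus W\<close> on the left all insertions are parallel, so differentiating along
  \<open>x\<close> only adds insertions: \<open>x\<close> joins one of the two vertices, while
  \<open>b\<close> and \<open>c\<close> stay on the second. The split with empty \<open>P\<close> is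
  the term subtracted in \<open>T\<close>.\<close>

lemma recursion_0:
  assumes "constant_field W" "constant_field b" "constant_field c" "\<And>X. X \<in> set L \<Longrightarrow> constant_field X"
  shows "contract (potential 0) (\<tau>_plus W # b # c # L) =
    (\<Sum>(P, Q)\<leftarrow>splits L. \<Sum>i\<in>UNIV. contract (potential 0) (W # P @ [e i]) *
       contract (potential 0) (e i # Q @ [b, c]))"
  using assms(4)
proof (induction L)
  case Nil
  have "contract (potential 0) (T W # [b, c]) = 0"
    using \<rho>0_eq_0[of W b c] assms unfolding \<rho>0_def by simp
  then show ?case
    using assms(1) mlinear_T_apply[OF mlinear_contract, of W "potential 0" "[b, c]"]
    by (simp del: contract.simps)
next
  case (Cons x L)
  let ?C = "contract (potential 0)"
  have x: "constant_field x" and L: "\<And>X. X \<in> set L \<Longrightarrow> constant_field X"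
    using Cons.prems by auto
  have AB: "constant_field X" if "(P, Q) \<in> set (splits L)" "X \<in> set P \<union> set Q" for P Q X
    using L that by (metis Un_iff mset_splits set_mset_mset set_mset_union)
  have IH: "?C (\<tau>_plus W # b # c # L) =
      (\<Sum>(P, Q)\<leftarrow>splits L. \<Sum>i\<in>UNIV. ?C (W # P @ [e i]) * ?C (e i # Q @ [b, c]))"
    using L by (rule Cons.IH)
  have "?C (\<tau>_plus W # b # c # x # L) = ?C (x # \<tau>_plus W # b # c # L)"
    using assms x L by (intro contract_perm) auto
  also have "\<dots> = along x (?C (\<tau>_plus W # b # c # L))"
    using assms L by (intro along_contract[symmetric]) auto
  also have "\<dots> = (\<Sum>s\<leftarrow>splits L. along x (case s of (P, Q) \<Rightarrow>
      \<Sum>i\<in>UNIV. ?C (W # P @ [e i]) * ?C (e i # Q @ [b, c])))"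
    unfolding IH using x by (simp only: along_sum_list constant_fieldD)
  also have "\<dots> = (\<Sum>s\<leftarrow>splits L. (case s of (P, Q) \<Rightarrow>
      (\<Sum>i\<in>UNIV. ?C (W # (x # P) @ [e i]) * ?C (e i # Q @ [b, c])) +
      (\<Sum>i\<in>UNIV. ?C (W # P @ [e i]) * ?C (e i # (x # Q) @ [b, c]))))"
  proof (intro arg_cong[where f = sum_list] map_cong refl, clarify)
    fix P Q assume s: "(P, Q) \<in> set (splits L)"
    have "along x (?C (W # P @ [e i])) = ?C (W # (x # P) @ [e i])"
      "along x (?C (e i # Q @ [b, c])) = ?C (e i # (x # Q) @ [b, c])" for i
      using assms x AB[OF s] contract_swap[of x W "potential 0" "P @ [e i]"]
        contract_swap[of x "e i" "potential 0" "Q @ [b, c]"]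
      by (subst along_contract; auto simp del: contract.simps)+
    then show "along x (\<Sum>i\<in>UNIV. ?C (W # P @ [e i]) * ?C (e i # Q @ [b, c])) =
      (\<Sum>i\<in>UNIV. ?C (W # (x # P) @ [e i]) * ?C (e i # Q @ [b, c])) +
      (\<Sum>i\<in>UNIV. ?C (W # P @ [e i]) * ?C (e i # (x # Q) @ [b, c]))"
      using x by (simp only: along_sum along_times constant_fieldD sum.distrib)
  qed
  also have "\<dots> = (\<Sum>(P, Q)\<leftarrow>splits (x # L). \<Sum>i\<in>UNIV. ?C (W # P @ [e i]) * ?C (e i # Q @ [b, c]))"
    by (simp add: case_prod_beta sum_list_addf comp_def del: contract.simps)
  finally show ?case .
qed

text \<open>The same induction starting from \<open>\<rho>1 = 0\<close>. The last summand is a loop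
  on a single vertex, which collects all further insertions.\<close>

lemma recursion_1:
  assumes "constant_field W" "\<And>X. X \<in> set L \<Longrightarrow> constant_field X"
  shows "contract (potential 1) (\<tau>_plus W # L) =
    (\<Sum>(P, Q)\<leftarrow>splits L. \<Sum>i\<in>UNIV. contract (potential 0) (W # P @ [e i]) *
       contract (potential 1) (e i # Q)) +
    (1/24) *\<^sub>c (\<Sum>i\<in>UNIV. contract (potential 0) (W # L @ [e i, e i]))"
  using assms(2)
proof (induction L)
  case Nil
  have "(\<Sum>\<alpha>\<in>UNIV. \<llangle>[W, \<gamma>u \<alpha>, \<gamma>d \<alpha>]\<rrangle>\<^sub>0) = (\<Sum>i\<in>UNIV. \<llangle>[W, e i, e i]\<rrangle>\<^sub>0)"
  proof (rule sum_frame[where \<phi> = "\<lambda>x y. \<llangle>[W, y, x]\<rrangle>\<^sub>0"])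
    fix X :: "(nat \<times> 'n) vfield" assume "vector_field X"
    then have "vector_field V" if "V \<in> set [W, X]" for V
      using assms(1) that by auto
    from mlinear_contract_at[of "[W, X]" "potential 0" "[]", OF this]
    show "mlinear (\<lambda>x. \<llangle>[W, X, x]\<rrangle>\<^sub>0)" by simp
    show "mlinear (\<lambda>y. \<llangle>[W, y, X]\<rrangle>\<^sub>0)"
      using assms(1) mlinear_contract_at[of "[W]" "potential 0" "[X]"] by auto
  qed
  then have "contract (potential 1) (T W # []) = (1/24) *\<^sub>c (\<Sum>i\<in>UNIV. \<llangle>[W, e i, e i]\<rrangle>\<^sub>0)"
    using \<rho>1_eq_0[of W] assms unfolding \<rho>1_def by (simp del: contract.simps)
  then show ?case
    using assms(1) mlinear_T_apply[OF mlinear_contract, of W "potential 1" "[]"]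
    by (simp add: algebra_simps del: contract.simps)
next
  case (Cons x L)
  let ?C = "contract (potential 0)" and ?D = "contract (potential 1)"
  have x: "constant_field x" and L: "\<And>X. X \<in> set L \<Longrightarrow> constant_field X"
    using Cons.prems by auto
  have AB: "constant_field X" if "(P, Q) \<in> set (splits L)" "X \<in> set P \<union> set Q" for P Q X
    using L that by (metis Un_iff mset_splits set_mset_mset set_mset_union)
  have IH: "?D (\<tau>_plus W # L) =
      (\<Sum>(P, Q)\<leftarrow>splits L. \<Sum>i\<in>UNIV. ?C (W # P @ [e i]) * ?D (e i # Q)) +
      (1/24) *\<^sub>c (\<Sum>i\<in>UNIV. ?C (W # L @ [e i, e i]))"
    using L by (rule Cons.IH)
  have "?D (\<tau>_plus W # x # L) = ?D (x # \<tau>_plus W # L)"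
    using assms x by (intro contract_swap) auto
  also have "\<dots> = along x (?D (\<tau>_plus W # L))"
    using assms L by (intro along_contract[symmetric]) auto
  also have "along x (?D (\<tau>_plus W # L)) = (\<Sum>s\<leftarrow>splits L. along x (case s of (P, Q) \<Rightarrow>
      \<Sum>i\<in>UNIV. ?C (W # P @ [e i]) * ?D (e i # Q))) + (1/24) *\<^sub>c (\<Sum>i\<in>UNIV. along x (?C (W # L @ [e i, e i])))"
    unfolding IH using x
    by (simp only: along_sum_list along_add along_cscale along_sum constant_fieldD)
  finally have lhs: "?D (\<tau>_plus W # x # L) = (\<Sum>s\<leftarrow>splits L. along x (case s of (P, Q) \<Rightarrow>
      \<Sum>i\<in>UNIV. ?C (W # P @ [e i]) * ?D (e i # Q))) + (1/24) *\<^sub>c (\<Sum>i\<in>UNIV. along x (?C (W # L @ [e i, e i])))" .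
  have loop: "along x (?C (W # L @ [e i, e i])) = ?C (W # (x # L) @ [e i, e i])" for i
    using assms x L contract_swap[of x W "potential 0" "L @ [e i, e i]"]
    by (subst along_contract) (auto simp del: contract.simps)
  have "(\<Sum>s\<leftarrow>splits L. along x (case s of (P, Q) \<Rightarrow> \<Sum>i\<in>UNIV. ?C (W # P @ [e i]) * ?D (e i # Q))) =
    (\<Sum>s\<leftarrow>splits L. (case s of (P, Q) \<Rightarrow>
      (\<Sum>i\<in>UNIV. ?C (W # (x # P) @ [e i]) * ?D (e i # Q)) +
      (\<Sum>i\<in>UNIV. ?C (W # P @ [e i]) * ?D (e i # (x # Q)))))"
  proof (intro arg_cong[where f = sum_list] map_cong refl, clarify)
    fix P Q assume s: "(P, Q) \<in> set (splits L)"
    have "along x (?C (W # P @ [e i])) = ?C (W # (x # P) @ [e i])"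
      "along x (?D (e i # Q)) = ?D (e i # (x # Q))" for i
      using assms x AB[OF s] contract_swap[of x W "potential 0" "P @ [e i]"]
        contract_swap[of x "e i" "potential 1" Q]
      by (subst along_contract; auto simp del: contract.simps)+
    then show "along x (\<Sum>i\<in>UNIV. ?C (W # P @ [e i]) * ?D (e i # Q)) =
      (\<Sum>i\<in>UNIV. ?C (W # (x # P) @ [e i]) * ?D (e i # Q)) +
      (\<Sum>i\<in>UNIV. ?C (W # P @ [e i]) * ?D (e i # (x # Q)))"
      using x by (simp only: along_sum along_times constant_fieldD sum.distrib)
  qed
  also have "\<dots> = (\<Sum>(P, Q)\<leftarrow>splits (x # L). \<Sum>i\<in>UNIV. ?C (W # P @ [e i]) * ?D (e i # Q))"
    by (simp add: case_prod_beta sum_list_addf comp_def del: contract.simps)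
  finally show ?case
    unfolding lhs loop by simp
qed

end

section \<open>Sums over edges\<close>

definition comb_sum :: "(graph \<Rightarrow> 'v mfps) \<Rightarrow> comb \<Rightarrow> 'v mfps"
  where "comb_sum F p = (\<Sum>(c, m)\<leftarrow>p. of_int c *\<^sub>c F m)"

lemma comb_sum_simps [simp]:
  "comb_sum F [] = 0" "comb_sum F ((c, m) # p) = of_int c *\<^sub>c F m + comb_sum F p" "comb_sum F (p @ q) = comb_sum F p + comb_sum F q"
  unfolding comb_sum_def by simp_all

text \<open>Wherever a graph is stored, its total coefficient is preserved; the order of the tree
  only serves to bring equal graphs together.\<close>

lemma comb_sum_add_term: "comb_sum F (terms (add_term c m t)) = of_int c *\<^sub>c F m + comb_sum F (terms t)"
  by (induction c m t rule: add_term.induct) (simp_all add: cscale_add_left ac_simps)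

lemma comb_sum_collect: "comb_sum F (collect f p) = comb_sum (\<lambda>m. F (f m)) p"
proof -
  have "comb_sum F (terms (fold (\<lambda>(c, m). add_term c (f m)) p t)) = comb_sum (\<lambda>m. F (f m)) p + comb_sum F (terms t)" for t
    by (induction p arbitrary: t) (auto simp: comb_sum_add_term)
  then show ?thesis
    by (simp add: collect_def)
qed

lemma comb_sum_cong: "(\<And>m. F m = F' m) \<Longrightarrow> comb_sum F p = comb_sum F' p"
  by (induction p) auto

lemma triple_sum_perm:
  fixes f :: "'i \<Rightarrow> 'i \<Rightarrow> 'i \<Rightarrow> 'b :: comm_monoid_add"
  shows "(\<Sum>i\<in>A. \<Sum>j\<in>A. \<Sum>k\<in>A. f i k j) = (\<Sum>i\<in>A. \<Sum>j\<in>A. \<Sum>k\<in>A. f i j k)" (is ?a)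
    and "(\<Sum>i\<in>A. \<Sum>j\<in>A. \<Sum>k\<in>A. f j i k) = (\<Sum>i\<in>A. \<Sum>j\<in>A. \<Sum>k\<in>A. f i j k)" (is ?b)
    and "(\<Sum>i\<in>A. \<Sum>j\<in>A. \<Sum>k\<in>A. f j k i) = (\<Sum>i\<in>A. \<Sum>j\<in>A. \<Sum>k\<in>A. f i j k)" (is ?c)
    and "(\<Sum>i\<in>A. \<Sum>j\<in>A. \<Sum>k\<in>A. f k i j) = (\<Sum>i\<in>A. \<Sum>j\<in>A. \<Sum>k\<in>A. f i j k)" (is ?d)
    and "(\<Sum>i\<in>A. \<Sum>j\<in>A. \<Sum>k\<in>A. f k j i) = (\<Sum>i\<in>A. \<Sum>j\<in>A. \<Sum>k\<in>A. f i j k)" (is ?e)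
proof -
  have a: "(\<Sum>i\<in>A. \<Sum>j\<in>A. \<Sum>k\<in>A. g i k j) = (\<Sum>i\<in>A. \<Sum>j\<in>A. \<Sum>k\<in>A. g i j k)"
    for g :: "'i \<Rightarrow> 'i \<Rightarrow> 'i \<Rightarrow> 'b"
    by (rule sum.cong[OF refl]) (rule sum.swap)
  have b: "(\<Sum>i\<in>A. \<Sum>j\<in>A. \<Sum>k\<in>A. g j i k) = (\<Sum>i\<in>A. \<Sum>j\<in>A. \<Sum>k\<in>A. g i j k)"
    for g :: "'i \<Rightarrow> 'i \<Rightarrow> 'i \<Rightarrow> 'b"
    by (rule sum.swap)
  show ?a by (rule a)
  show ?b by (rule b)
  show ?c
    using a[of "\<lambda>i j k. f k j i"] b[of "\<lambda>i j k. f i k j"] a[of f]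
      a[of "\<lambda>i k j. f j k i"] b[of "\<lambda>i j k. f j k i"] by simp
  show ?d
    using a[of "\<lambda>i j k. f j i k"] b[of f] by simp
  show ?e
    using b[of "\<lambda>i j k. f k i j"] a[of "\<lambda>i j k. f j i k"] b[of f] by simp
qed

context gw_data
begin

primrec edge_sum :: "nat list \<Rightarrow> (nat \<Rightarrow> (nat \<times> 'n) vfield) \<Rightarrow> comb \<Rightarrow> (nat \<times> 'n) mfps" where
  "edge_sum [] \<rho> p = comb_val \<rho> p"
| "edge_sum (n # ns) \<rho> p = (\<Sum>i\<in>UNIV. edge_sum ns (\<rho>(n := e i)) p)"

lemma edge_sum_Nil [simp]: "edge_sum ns \<rho> [] = 0"
  and edge_sum_append [simp]: "edge_sum ns \<rho> (p @ q) = edge_sum ns \<rho> p + edge_sum ns \<rho> q"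
  and edge_sum_scale [simp]: "edge_sum ns \<rho> (scale_comb k p) = of_int k *\<^sub>c edge_sum ns \<rho> p"
  by (induction ns arbitrary: \<rho>) (simp_all add: sum.distrib cscale_sum)

lemma edge_sum_conv_comb_sum: "edge_sum ns \<rho> p = comb_sum (\<lambda>m. edge_sum ns \<rho> [(1, m)]) p"
proof (induction p)
  case (Cons t p)
  obtain c m where t: "t = (c, m)" by force
  have "t # p = scale_comb c [(1, m)] @ p"
    by (simp add: t scale_comb_def)
  then have "edge_sum ns \<rho> (t # p) = of_int c *\<^sub>c edge_sum ns \<rho> [(1, m)] + edge_sum ns \<rho> p"
    by (simp only: edge_sum_append edge_sum_scale)
  also have "edge_sum ns \<rho> p = comb_sum (\<lambda>m. edge_sum ns \<rho> [(1, m)]) p"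
    by (rule Cons.IH)
  finally show ?case
    unfolding t comb_sum_simps .
qed simp

lemma edge_sum_attach:
  "set ns \<inter> set (legs q) = {} \<Longrightarrow> edge_sum ns \<rho> (attach q p) = graph_val \<rho> q * edge_sum ns \<rho> p"
proof (induction ns arbitrary: \<rho>)
  case (Cons n ns)
  have "graph_val (\<rho>(n := X)) q = graph_val \<rho> q" for X
    using Cons.prems by (intro graph_val_cong) auto
  then show ?case
    using Cons by (simp add: sum_distrib_left)
qed simp

text \<open>Frame vectors are parallel, so the derivative passes through the sums over edges, and
  the condition concerns the free legs only.\<close>

lemma along_edge_sum:
  assumes "\<And>c m n. (c, m) \<in> set p \<Longrightarrow> n \<in> set (legs m) \<Longrightarrow> n \<notin> set ns \<Longrightarrow> constant_field (\<rho> n)"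
    "vector_field (\<rho> z)" "z \<notin> set ns"
  shows "along (\<rho> z) (edge_sum ns \<rho> p) = edge_sum ns \<rho> (insert_leg z p)"
  using assms
proof (induction ns arbitrary: \<rho>)
  case Nil
  then show ?case by (auto intro!: along_comb_val)
next
  case (Cons k ns)
  have "along ((\<rho>(k := e i)) z) (edge_sum ns (\<rho>(k := e i)) p) = edge_sum ns (\<rho>(k := e i)) (insert_leg z p)" for i
    using Cons.prems by (intro Cons.IH) auto
  moreover have "(\<rho>(k := e i)) z = \<rho> z" for i
    using Cons.prems by auto
  ultimately show ?case
    using Cons.prems by (simp only: edge_sum.simps along_sum)
qed

lemma mlinear_edge_sum:
  assumes "\<And>n. vector_field (\<rho> n)" "z \<notin> set ns" "list_all (\<lambda>(c, m). count_list (legs m) z = 1) p"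
  shows "mlinear (\<lambda>X. edge_sum ns (\<rho>(z := X)) p)"
  using assms(1,2)
proof (induction ns arbitrary: \<rho>)
  case Nil
  then show ?case using assms(3) by (simp add: mlinear_comb_val del: fun_upd_apply)
next
  case (Cons k ns)
  have "mlinear (\<lambda>X. \<Sum>i\<in>UNIV. edge_sum ns (\<rho>(k := e i, z := X)) p)"
    using Cons.prems by (intro mlinear_sum Cons.IH) auto
  moreover have "\<rho>(k := e i, z := X) = \<rho>(z := X, k := e i)" for i X
    using Cons.prems by (intro fun_upd_twist) auto
  ultimately show ?case
    by (simp only: edge_sum.simps)
qed

text \<open>Relations are stated for all parallel environments so that free labels can be bound
  afterwards: a further sum over a label shared by two legs closes them by an edge.\<close>

definition vanish :: "nat list \<Rightarrow> comb \<Rightarrow> bool"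
  where "vanish ns p \<longleftrightarrow> (\<forall>\<rho>. (\<forall>n. constant_field (\<rho> n)) \<longrightarrow> edge_sum ns \<rho> p = 0)"

lemma vanishD: "vanish ns p \<Longrightarrow> (\<And>n. constant_field (\<rho> n)) \<Longrightarrow> edge_sum ns \<rho> p = 0"
  by (simp add: vanish_def)

lemma vanish_append: "vanish ns p \<Longrightarrow> vanish ns q \<Longrightarrow> vanish ns (p @ q)"
  and vanish_scale: "vanish ns p \<Longrightarrow> vanish ns (scale_comb c p)"
  and vanish_Cons: "vanish ns p \<Longrightarrow> vanish (n # ns) p"
  and vanish_attach: "vanish ns p \<Longrightarrow> set ns \<inter> set (legs k) = {} \<Longrightarrow> vanish ns (attach k p)"
  by (simp_all add: vanish_def edge_sum_attach)

text \<open>Covariant derivatives of relations are relations. The label \<open>z\<close> may already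
  be a free leg; a later sum over it then joins this leg to the new insertion.\<close>

lemma vanish_insert_leg: "vanish ns p \<Longrightarrow> z \<notin> set ns \<Longrightarrow> vanish ns (insert_leg z p)"
  unfolding vanish_def by (simp add: along_edge_sum[symmetric]) (simp add: along_def)

lemma edge_sum_collect_sort_graph:
  assumes "\<And>n. vector_field (\<rho> n)"
  shows "edge_sum ns \<rho> (collect sort_graph p) = edge_sum ns \<rho> p"
proof -
  have "edge_sum ns \<rho> [(1, sort_graph m)] = edge_sum ns \<rho> [(1, m)]" for m
    using assms by (induction ns arbitrary: \<rho>) (simp_all add: graph_val_sort_graph)
  then show ?thesis
    unfolding edge_sum_conv_comb_sum[of _ _ p] edge_sum_conv_comb_sum[of _ _ "collect _ _"] comb_sum_collect
    by (intro comb_sum_cong)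
qed

lemma vanish_collect: "vanish ns (collect sort_graph p) \<longleftrightarrow> vanish ns p"
  by (simp add: vanish_def edge_sum_collect_sort_graph)

text \<open>All three edges are summed over the same frame, so permuting their names only reorders
  the sums.\<close>

lemma edge_sum_relabel_edge_perm:
  assumes "t \<in> {(0, 2, 1), (1, 0, 2), (1, 2, 0), (2, 0, 1), (2, 1, 0)}"
  shows "edge_sum [0, 1, 2] \<rho> [(1, relabel (edge_perm t) m)] = edge_sum [0, 1, 2] \<rho> [(1, m)]"
proof -
  let ?f = "\<lambda>i j k. graph_val (\<rho>(0 := e i, 1 := e j, 2 := e k)) m"
  have *: "(\<rho>(0 := u 0, 1 := u 1, 2 := u 2)) \<circ> edge_perm (a, b, c) = \<rho>(0 := u a, 1 := u b, 2 := u c)"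
    if "a < 3" "b < 3" "c < 3" for u :: "nat \<Rightarrow> (nat \<times> 'n) vfield" and a b c
  proof
    fix n :: nat
    have upd: "(\<rho>(0 := u 0, 1 := u 1, 2 := u 2)) k = u k" if "k < 3" for k
    proof -
      from that consider "k = 0" | "k = 1" | "k = 2" by linarith
      then show ?thesis by cases simp_all
    qed
    consider "n = 0" | "n = 1" | "n = 2" | k where "n = Suc (Suc (Suc k))"
      by (metis One_nat_def nat.exhaust numeral_2_eq_2)
    then show "((\<rho>(0 := u 0, 1 := u 1, 2 := u 2)) \<circ> edge_perm (a, b, c)) n =
        (\<rho>(0 := u a, 1 := u b, 2 := u c)) n"
      unfolding comp_def using upd[OF that(1)] upd[OF that(2)] upd[OF that(3)]
      by cases (simp_all only: edge_perm.simps nat.case numeral_2_eq_2 One_nat_def fun_upd_apply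
          nat.inject nat.distinct if_True if_False refl simp_thms)
  qed
  have relabel: "edge_sum [0, 1, 2] \<rho> [(1, relabel (edge_perm (a, b, c)) m)] =
      (\<Sum>i\<in>UNIV. \<Sum>j\<in>UNIV. \<Sum>k\<in>UNIV. ?f ([i, j, k] ! a) ([i, j, k] ! b) ([i, j, k] ! c))"
    if "a < 3" "b < 3" "c < 3" for a b c
    using *[OF that, of "\<lambda>l. e ([_, _, _] ! l)"]
    by (simp add: graph_val_relabel)
  from assms consider "t = (0, 2, 1)" | "t = (1, 0, 2)" | "t = (1, 2, 0)" | "t = (2, 0, 1)" | "t = (2, 1, 0)"
    by blast
  then show ?thesis
  proof cases
    case 1
    then show ?thesis
      using relabel[of 0 2 1] triple_sum_perm(1)[of ?f UNIV] by simp
  next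
    case 2
    then show ?thesis
      using relabel[of 1 0 2] triple_sum_perm(2)[of ?f UNIV] by simp
  next
    case 3
    then show ?thesis
      using relabel[of 1 2 0] triple_sum_perm(3)[of ?f UNIV] by simp
  next
    case 4
    then show ?thesis
      using relabel[of 2 0 1] triple_sum_perm(4)[of ?f UNIV] by simp
  next
    case 5
    then show ?thesis
      using relabel[of 2 1 0] triple_sum_perm(5)[of ?f UNIV] by simp
  qed
qed

text \<open>Soundness of the check: passing to canonical forms does not change the sum over edges.
  The check is one-sided, since distinct canonical graphs may still be related by associativity or
  Getzler's relation.\<close>

lemma vanish_cancels:
  assumes "cancels p"
  shows "vanish [0, 1, 2] p"
  unfolding vanish_def
proof (intro allI impI)
  fix \<rho> :: "nat \<Rightarrow> (nat \<times> 'n) vfield"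
  assume \<rho>: "\<forall>n. constant_field (\<rho> n)"
  let ?F = "\<lambda>m. edge_sum [0, 1, 2] \<rho> [(1, m)]"
  have sort: "?F (sort_graph m) = ?F m" for m
    using \<rho> by (simp add: graph_val_sort_graph)
  \<comment> \<open>Either outcome of the comparison preserves the sum, because both candidates have
    the same value as \<open>m\<close>.\<close>
  have fold: "?F (fold (\<lambda>p k. let m' = sort_graph (relabel (edge_perm p) m) in
      if le_graph m' k then m' else k) ts k) = ?F m"
    if "set ts \<subseteq> {(0, 2, 1), (1, 0, 2), (1, 2, 0), (2, 0, 1), (2, 1, 0)}" "?F k = ?F m" for ts k m
    using that
  proof (induction ts arbitrary: k)
    case (Cons t ts)
    have "?F (sort_graph (relabel (edge_perm t) m)) = ?F m"
      unfolding sort using Cons.prems by (intro edge_sum_relabel_edge_perm) simp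
    then show ?case
      using Cons by (simp add: Let_def del: edge_sum.simps)
  qed simp
  have canonical: "?F (canonical m) = ?F m" for m
    unfolding canonical_def by (rule fold[OF _ sort]) simp
  have "comb_sum ?F q = 0" if "list_all (\<lambda>(c, m). c = 0) q" for q
    using that by (induction q) auto
  then have "comb_sum ?F (collect canonical p) = 0"
    using assms by (simp add: cancels_def del: edge_sum.simps)
  then show "edge_sum [0, 1, 2] \<rho> p = 0"
    unfolding comb_sum_collect canonical edge_sum_conv_comb_sum[of _ _ p] .
qed

text \<open>A product is a trivalent vertex of genus 0, joined by the new edge \<open>k\<close> to
  the place where it was inserted.\<close>

lemma edge_sum_qprod:
  assumes "\<And>n. constant_field (\<rho> n)" "a \<notin> set ns" "b \<notin> set ns" "k \<notin> set ns" "a \<noteq> k" "b \<noteq> k"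
    "list_all (\<lambda>(c, m). count_list (legs m) k = 1) p"
  shows "edge_sum ns (\<rho>(k := \<rho> a \<star> \<rho> b)) p = edge_sum (k # ns) \<rho> (attach [(0, [a, b, k])] p)"
proof -
  have "edge_sum ns (\<rho>(k := \<rho> a \<star> \<rho> b)) p = (\<Sum>i\<in>UNIV. \<llangle>[\<rho> a, \<rho> b, e i]\<rrangle>\<^sub>0 * edge_sum ns (\<rho>(k := e i)) p)"
    using assms by (intro mlinear_qprod_frame mlinear_edge_sum) auto
  also have "\<dots> = (\<Sum>i\<in>UNIV. edge_sum ns (\<rho>(k := e i)) (attach [(0, [a, b, k])] p))"
    using assms by (subst edge_sum_attach) (auto simp: legs_def)
  finally show ?thesis by simp
qed

end

context gw_recursion
begin

text \<open>Passing from \<open>\<tau>_plus\<close> back to \<open>T\<close> in the two recursions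
  subtracts the split with empty first part.\<close>

lemma T_vertex:
  assumes \<rho>: "\<And>n. constant_field (\<rho> n)" and ls: "2 \<notin> set ls" "z \<in> set ls" "z \<noteq> 2"
    and g: "g = 0 \<and> 3 \<le> length ls \<or> g = 1"
  shows "24 *\<^sub>c contract (potential g) (T (\<rho> z) # map \<rho> (remove1 z ls)) =
    (\<Sum>i\<in>UNIV. comb_val (\<rho>(2 := e i)) (T_vertex z (g, ls)))"
proof -
  let ?ks = "remove1 z ls"
  have ks: "2 \<notin> set ?ks"
    using ls(1) set_remove1_subset[of z ls] by blast
  have sub: "set P \<subseteq> set L \<and> set Q \<subseteq> set L" if "(P, Q) \<in> set (splits L)" for P Q and L :: "nat list"
    using mset_eq_setD[of L "P @ Q"] mset_splits[OF that] by auto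
  have pmap: "comb_val \<rho>' (map (\<lambda>(P, Q). (24, h P Q)) ss) = 24 *\<^sub>c (\<Sum>(P, Q)\<leftarrow>ss. graph_val \<rho>' (h P Q))"
    for \<rho>' h and ss :: "(nat list \<times> nat list) list"
    by (induction ss) (auto simp: cscale_add_right)
  show ?thesis
  proof (cases "g = 0")
    case True
    let ?C = "contract (potential 0)"
    have "2 \<le> length ?ks"
      using g True ls by (auto simp: length_remove1)
    then obtain b c L where bcL: "?ks = b # c # L"
      by (metis Suc_le_length_iff numeral_2_eq_2)
    let ?f = "\<lambda>(P, Q). \<Sum>i\<in>UNIV. ?C (\<rho> z # map \<rho> P @ [e i]) * ?C (e i # map \<rho> Q @ [\<rho> b, \<rho> c])"
    have tau: "?C (\<tau>_plus (\<rho> z) # \<rho> b # \<rho> c # map \<rho> L) = (\<Sum>s\<leftarrow>splits L. ?f s)"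
      using \<rho> by (subst recursion_0) (auto simp: splits_map comp_def case_prod_unfold)
    have perm: "?C (e i # map \<rho> L @ [\<rho> b, \<rho> c]) = ?C (e i # \<rho> b # \<rho> c # map \<rho> L)" for i
      using \<rho> by (intro contract_perm) auto
    have "?C (T (\<rho> z) # map \<rho> ?ks) = (\<Sum>s\<leftarrow>splits L. ?f s) - ?f ([], L)"
      using \<rho> mlinear_T_apply[OF mlinear_contract, of "\<rho> z" "potential 0" "map \<rho> ?ks"]
      by (simp add: bcL tau perm)
    also have "\<dots> = (\<Sum>s\<leftarrow>filter (\<lambda>(P, Q). P \<noteq> []) (splits L). ?f s)"
      by (rule sum_list_splits_nonempty[symmetric])
    also have "\<dots> = (\<Sum>(P, Q)\<leftarrow>filter (\<lambda>(P, Q). P \<noteq> []) (splits L). \<Sum>i\<in>UNIV.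
        graph_val (\<rho>(2 := e i)) [(0, z # P @ [2]), (0, 2 # Q @ take 2 ?ks)])"
    proof (intro arg_cong[where f = sum_list] map_cong refl, clarify)
      fix P Q assume "(P, Q) \<in> set (filter (\<lambda>(P, Q). P \<noteq> []) (splits L))"
      then have "2 \<notin> set P" "2 \<notin> set Q" "b \<noteq> 2" "c \<noteq> 2"
        using sub[of P Q L] ks bcL by auto
      then have "map (\<rho>(2 := e i)) (z # P @ [2]) = \<rho> z # map \<rho> P @ [e i]"
        "map (\<rho>(2 := e i)) (2 # Q @ take 2 ?ks) = e i # map \<rho> Q @ [\<rho> b, \<rho> c]" for i
        using ls(3) by (auto simp: bcL)
      then show "(\<Sum>i\<in>UNIV. ?C (\<rho> z # map \<rho> P @ [e i]) * ?C (e i # map \<rho> Q @ [\<rho> b, \<rho> c])) =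
          (\<Sum>i\<in>UNIV. graph_val (\<rho>(2 := e i)) [(0, z # P @ [2]), (0, 2 # Q @ take 2 ?ks)])"
        by (simp only: graph_val_simps mult_1_right)
    qed
    also have "24 *\<^sub>c \<dots> = (\<Sum>i\<in>UNIV. comb_val (\<rho>(2 := e i)) (T_vertex z (g, ls)))"
    proof -
      have "drop 2 ?ks = L"
        by (simp add: bcL)
      then have "comb_val \<rho>' (T_vertex z (g, ls)) = 24 *\<^sub>c (\<Sum>(P, Q)\<leftarrow>filter (\<lambda>(P, Q). P \<noteq> []) (splits L).
          graph_val \<rho>' [(0, z # P @ [2]), (0, 2 # Q @ take 2 ?ks)])" for \<rho>'
        unfolding T_vertex_def by (simp only: prod.case Let_def True simp_thms if_True pmap)
      then show ?thesis
        by (simp only: cscale_sum[symmetric] sum_sum_list case_prod_unfold)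
    qed
    finally show ?thesis
      by (simp only: True)
  next
    case False
    with g have g: "g = 1" by simp
    let ?C = "contract (potential 0)" and ?D = "contract (potential 1)"
    let ?f = "\<lambda>(P, Q). \<Sum>i\<in>UNIV. ?C (\<rho> z # map \<rho> P @ [e i]) * ?D (e i # map \<rho> Q)"
    have tau: "?D (\<tau>_plus (\<rho> z) # map \<rho> ?ks) = (\<Sum>s\<leftarrow>splits ?ks. ?f s) +
        (1/24) *\<^sub>c (\<Sum>i\<in>UNIV. ?C (\<rho> z # map \<rho> ?ks @ [e i, e i]))"
      using \<rho> by (subst recursion_1) (auto simp: splits_map comp_def case_prod_unfold)
    have "?D (T (\<rho> z) # map \<rho> ?ks) = (\<Sum>s\<leftarrow>splits ?ks. ?f s) - ?f ([], ?ks) +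
        (1/24) *\<^sub>c (\<Sum>i\<in>UNIV. ?C (\<rho> z # map \<rho> ?ks @ [e i, e i]))"
      using \<rho> mlinear_T_apply[OF mlinear_contract, of "\<rho> z" "potential 1" "map \<rho> ?ks"]
      by (simp add: tau del: One_nat_def)
    also have "(\<Sum>s\<leftarrow>splits ?ks. ?f s) - ?f ([], ?ks) =
        (\<Sum>s\<leftarrow>filter (\<lambda>(P, Q). P \<noteq> []) (splits ?ks). ?f s)"
      by (rule sum_list_splits_nonempty[symmetric])
    also have "\<dots> = (\<Sum>(P, Q)\<leftarrow>filter (\<lambda>(P, Q). P \<noteq> []) (splits ?ks). \<Sum>i\<in>UNIV.
        graph_val (\<rho>(2 := e i)) [(0, z # P @ [2]), (1, 2 # Q)])"
    proof (intro arg_cong[where f = sum_list] map_cong refl, clarify)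
      fix P Q assume "(P, Q) \<in> set (filter (\<lambda>(P, Q). P \<noteq> []) (splits ?ks))"
      then have "2 \<notin> set P" "2 \<notin> set Q"
        using sub[of P Q ?ks] ks by auto
      then have "map (\<rho>(2 := e i)) (z # P @ [2]) = \<rho> z # map \<rho> P @ [e i]"
        "map (\<rho>(2 := e i)) (2 # Q) = e i # map \<rho> Q" for i
        using ls(3) by auto
      then show "(\<Sum>i\<in>UNIV. ?C (\<rho> z # map \<rho> P @ [e i]) * ?D (e i # map \<rho> Q)) =
          (\<Sum>i\<in>UNIV. graph_val (\<rho>(2 := e i)) [(0, z # P @ [2]), (1, 2 # Q)])"
        by (simp only: graph_val_simps mult_1_right)
    qed
    also have "(\<Sum>i\<in>UNIV. ?C (\<rho> z # map \<rho> ?ks @ [e i, e i])) =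
        (\<Sum>i\<in>UNIV. graph_val (\<rho>(2 := e i)) [(0, z # ?ks @ [2, 2])])"
    proof -
      have "map (\<rho>(2 := e i)) (z # ?ks @ [2, 2]) = \<rho> z # map \<rho> ?ks @ [e i, e i]" for i
        using ls(3) ks by auto
      then show ?thesis
        by (simp only: graph_val_simps mult_1_right)
    qed
    moreover have "comb_val \<rho>' (T_vertex z (g, ls)) = graph_val \<rho>' [(0, z # ?ks @ [2, 2])] +
        24 *\<^sub>c (\<Sum>(P, Q)\<leftarrow>filter (\<lambda>(P, Q). P \<noteq> []) (splits ?ks). graph_val \<rho>' [(0, z # P @ [2]), (1, 2 # Q)])" for \<rho>'
      unfolding T_vertex_def
      by (simp only: prod.case Let_def False if_False comb_val_simps pmap of_int_1 cscale_1)
    ultimately show ?thesis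
      unfolding g by (simp only: cscale_sum[symmetric] sum_sum_list case_prod_unfold sum.distrib
          cscale_add_right cscale_cscale) (simp add: add.commute)
  qed
qed

lemma comb_val_eliminate_T:
  assumes \<rho>: "\<And>n. constant_field (\<rho> n)" and z: "z \<noteq> 2"
    and p: "list_all (\<lambda>(c, m). T_eliminable z m) p"
  shows "24 *\<^sub>c comb_val (\<rho>(z := T (\<rho> z))) p = (\<Sum>i\<in>UNIV. comb_val (\<rho>(2 := e i)) (eliminate_T z p))"
  using p
proof (induction p)
  case Nil
  show ?case by (simp add: eliminate_T_def)
next
  case (Cons t p)
  obtain c m where t: "t = (c, m)" by force
  have m: "count_list (legs m) z = 1" "2 \<notin> set (legs m)"
    "\<And>g ls. (g, ls) \<in> set m \<Longrightarrow> g = 0 \<and> 3 \<le> length ls \<or> g = 1"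
    using Cons.prems by (auto simp: t T_eliminable_def list_all_iff)
  have "24 *\<^sub>c graph_val (\<rho>(z := T (\<rho> z))) m = (\<Sum>i\<in>UNIV. comb_val (\<rho>(2 := e i)) (concat (map
      (\<lambda>v. attach (filter (\<lambda>v. z \<notin> set (snd v)) m) (T_vertex z v))
      (filter (\<lambda>v. z \<in> set (snd v)) m))))"
  proof (rule graph_val_isolate[where \<rho> = \<rho>, OF m(1)])
    show "vector_field (\<rho> n)" for n using \<rho> by simp
  next
    fix g ls
    assume *: "filter (\<lambda>v. z \<in> set (snd v)) m = [(g, ls)]" "(g, ls) \<in> set m" "count_list ls z = 1"
      and graph_val: "\<And>X. vector_field X \<Longrightarrow> graph_val (\<rho>(z := X)) m =
        graph_val \<rho> (filter (\<lambda>v. z \<notin> set (snd v)) m) * contract (potential g) (X # map \<rho> (remove1 z ls))"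
    let ?rest = "filter (\<lambda>v. z \<notin> set (snd v)) m"
    have "set ls \<subseteq> set (legs m)" "set (legs ?rest) \<subseteq> set (legs m)"
      using *(2) by (force simp: legs_def)+
    then have two: "2 \<notin> set ls" "2 \<notin> set (legs ?rest)"
      using m(2) by auto
    have "z \<in> set ls"
      using *(3) by (metis count_list_0_iff zero_neq_one)
    note vertex = T_vertex[where \<rho> = \<rho>, OF \<rho> two(1) this z m(3)[OF *(2)]]
    have rest: "graph_val (\<rho>(2 := X)) ?rest = graph_val \<rho> ?rest" for X
      using two(2) by (intro graph_val_cong) auto
    have "24 *\<^sub>c graph_val (\<rho>(z := T (\<rho> z))) m =
        graph_val \<rho> ?rest * (24 *\<^sub>c contract (potential g) (T (\<rho> z) # map \<rho> (remove1 z ls)))"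
      using \<rho> by (subst graph_val) simp_all
    also have "\<dots> = (\<Sum>i\<in>UNIV. comb_val (\<rho>(2 := e i)) (attach ?rest (T_vertex z (g, ls))))"
      by (simp only: vertex sum_distrib_left comb_val_attach rest)
    finally show ?thesis
      by (simp add: *(1))
  qed
  moreover have "concat (map (\<lambda>v. scale_comb c (F v)) vs) = scale_comb c (concat (map F vs))" for F :: "vertex \<Rightarrow> comb" and vs
    by (induction vs) (simp_all add: scale_comb_def)
  moreover have "24 *\<^sub>c comb_val (\<rho>(z := T (\<rho> z))) p = (\<Sum>i\<in>UNIV. comb_val (\<rho>(2 := e i)) (eliminate_T z p))"
    by (rule Cons.IH) (use Cons.prems in simp)
  moreover have "24 *\<^sub>c of_int c *\<^sub>c x = of_int c *\<^sub>c 24 *\<^sub>c x" for x :: "(nat \<times> 'n) mfps"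
    by (simp add: mult.commute)
  ultimately show ?case
    by (simp add: t eliminate_T_def cscale_add_right sum.distrib cscale_sum[symmetric]
        del: cscale_cscale fun_upd_apply)
qed

text \<open>The field on \<open>z\<close> is untouched by the sums over \<open>ns\<close>, so the
  recursion applies underneath them and the new edge 2 is summed innermost.\<close>

lemma edge_sum_eliminate_T:
  assumes "\<And>n. constant_field (\<rho> n)" "z \<noteq> 2" "z \<notin> set ns" "list_all (\<lambda>(c, m). T_eliminable z m) p"
  shows "24 *\<^sub>c edge_sum ns (\<rho>(z := T (\<rho> z))) p = edge_sum (ns @ [2]) \<rho> (eliminate_T z p)"
  using assms(1,3)
proof (induction ns arbitrary: \<rho>)
  case Nil
  then show ?case
    using comb_val_eliminate_T[OF _ assms(2,4)] by (simp del: fun_upd_apply)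
next
  case (Cons k ns)
  have "\<rho>(z := T (\<rho> z), k := e i) = (\<rho>(k := e i))(z := T ((\<rho>(k := e i)) z))" for i
    using Cons.prems by (auto simp: fun_eq_iff)
  moreover have "24 *\<^sub>c edge_sum ns ((\<rho>(k := e i))(z := T ((\<rho>(k := e i)) z))) p =
      edge_sum (ns @ [2]) (\<rho>(k := e i)) (eliminate_T z p)" for i
    using Cons.prems by (intro Cons.IH) auto
  ultimately show ?case
    by (simp only: edge_sum.simps cscale_sum append_Cons)
qed

text \<open>
  \<open>\<llangle>\<tau>\<^sub>+(a) b c d \<dots>\<rrangle>\<^sub>0\<close> is symmetric in \<open>b\<close> and \<open>c\<close>, but the recursion that keeps \<open>c d\<close> together
  is not; the summands in which \<open>b\<close> and \<open>c\<close> stay together cancel.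
\<close>

lemma vanish_WDVV:
  assumes "2 \<notin> set (a # b # c # d # xs)"
  shows "vanish [2] (WDVV_comb a b c d xs)"
  unfolding vanish_def
proof (intro allI impI)
  fix \<rho> :: "nat \<Rightarrow> (nat \<times> 'n) vfield"
  assume "\<forall>n. constant_field (\<rho> n)"
  then have \<rho>: "constant_field (\<rho> n)" for n by simp
  let ?C = "contract (potential 0)"
  define S where "S u v w ls = (\<Sum>(P, Q)\<leftarrow>splits ls. \<Sum>i\<in>UNIV. ?C (\<rho> a # \<rho> u # map \<rho> P @ [e i]) *
    ?C (e i # map \<rho> Q @ [\<rho> v, \<rho> w]))" for u v w ls
  define R where "R = (\<Sum>(P, Q)\<leftarrow>splits xs. \<Sum>i\<in>UNIV. ?C (\<rho> a # map \<rho> P @ [e i]) *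
    ?C (e i # \<rho> b # map \<rho> Q @ [\<rho> c, \<rho> d]))"
  have rec: "?C (\<tau>_plus (\<rho> a) # \<rho> v # \<rho> w # \<rho> u # map \<rho> xs) = S u v w xs +
      (\<Sum>(P, Q)\<leftarrow>splits xs. \<Sum>i\<in>UNIV. ?C (\<rho> a # map \<rho> P @ [e i]) * ?C (e i # \<rho> u # map \<rho> Q @ [\<rho> v, \<rho> w]))"
    for u v w
  proof -
    have "constant_field X" if "X \<in> set (map \<rho> (u # xs))" for X
      using \<rho> that by auto
    from recursion_0[of "\<rho> a" "\<rho> v" "\<rho> w" "map \<rho> (u # xs)", OF \<rho> \<rho> \<rho> this] show ?thesis
      by (simp add: S_def splits_map comp_def case_prod_unfold)
  qed
  have "S b c d xs + R = ?C (\<tau>_plus (\<rho> a) # \<rho> c # \<rho> d # \<rho> b # map \<rho> xs)"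
    unfolding rec R_def ..
  also have "\<dots> = ?C (\<tau>_plus (\<rho> a) # \<rho> b # \<rho> d # \<rho> c # map \<rho> xs)"
    using \<rho> by (intro contract_perm) auto
  also have "\<dots> = S c b d xs + R"
  proof -
    have "?C (e i # \<rho> c # map \<rho> Q @ [\<rho> b, \<rho> d]) = ?C (e i # \<rho> b # map \<rho> Q @ [\<rho> c, \<rho> d])" for i Q
      using \<rho> by (intro contract_perm) auto
    then show ?thesis
      unfolding rec R_def by simp
  qed
  finally have S: "S b c d xs = S c b d xs" by simp
  have "comb_val (\<rho>(2 := X)) (concat (map (\<lambda>(ys, zs).
     [(1, [(0, a # b # ys @ [2]), (0, 2 # zs @ [c, d])]),
      (-1, [(0, a # c # ys @ [2]), (0, 2 # zs @ [b, d])])]) ss)) =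
    (\<Sum>(P, Q)\<leftarrow>ss. ?C (\<rho> a # \<rho> b # map \<rho> P @ [X]) * ?C (X # map \<rho> Q @ [\<rho> c, \<rho> d])) -
    (\<Sum>(P, Q)\<leftarrow>ss. ?C (\<rho> a # \<rho> c # map \<rho> P @ [X]) * ?C (X # map \<rho> Q @ [\<rho> b, \<rho> d]))"
    if "set ss \<subseteq> set (splits xs)" for ss X
    using that
  proof (induction ss)
    case (Cons s ss)
    obtain P Q where s: "s = (P, Q)" by force
    with Cons.prems have "set P \<subseteq> set xs" "set Q \<subseteq> set xs"
      using mset_splits[of P Q xs] mset_eq_setD[of xs "P @ Q"] by auto
    then have "map (\<rho>(2 := X)) (a # u # P @ [2]) = \<rho> a # \<rho> u # map \<rho> P @ [X]"
      "map (\<rho>(2 := X)) (2 # Q @ [u, d]) = X # map \<rho> Q @ [\<rho> u, \<rho> d]" if "u \<noteq> 2" for u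
      using assms that by auto
    then have "comb_val (\<rho>(2 := X)) [(1, [(0, a # b # P @ [2]), (0, 2 # Q @ [c, d])]),
        (-1, [(0, a # c # P @ [2]), (0, 2 # Q @ [b, d])])] =
      ?C (\<rho> a # \<rho> b # map \<rho> P @ [X]) * ?C (X # map \<rho> Q @ [\<rho> c, \<rho> d]) -
      ?C (\<rho> a # \<rho> c # map \<rho> P @ [X]) * ?C (X # map \<rho> Q @ [\<rho> b, \<rho> d])"
      using assms by (simp del: fun_upd_apply list.map map_append add: cscale_minus_left)
    moreover note Cons.IH[OF order.trans[OF _ Cons.prems]]
    ultimately show ?case
      by (simp only: s list.map concat.simps prod.case comb_val_append sum_list.Cons set_subset_Cons)
        (simp only: add_diff_eq diff_add_eq diff_diff_eq ac_simps)
  qed simp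
  from this[OF order_refl] have "edge_sum [2] \<rho> (WDVV_comb a b c d xs) = S b c d xs - S c b d xs"
    by (simp add: WDVV_comb_def S_def sum_subtractf sum_sum_list[symmetric] case_prod_unfold)
  with S show "edge_sum [2] \<rho> (WDVV_comb a b c d xs) = 0" by simp
qed

end

section \<open>The tensors as graphs\<close>

text \<open>
  In the definitions of the tensors the two ends of edge \<open>a\<close> carry the labels \<open>a\<close>, for a lower
  index, and \<open>a + 6\<close>, for an upper index.  The combinations below stand for \<open>2880 A\<^sub>1\<close>,
  \<open>2880 A\<^sub>2\<close>, \<open>2880 B\<close> and \<open>24 G\<close>.
\<close>

definition lower :: "comb \<Rightarrow> comb"
  where "lower p = map (\<lambda>(c, m). (c, relabel (\<lambda>n. if n < 6 then n else n - 6) m)) p"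

text \<open>Each of the four ends occurs once, which gives the linearity needed to replace dual
  bases by the frame. All other labels are below 6, so the shift by 6 causes no collision.\<close>

definition half_edges :: "nat \<Rightarrow> nat \<Rightarrow> comb \<Rightarrow> bool" where
  "half_edges a b p \<longleftrightarrow> a < 6 \<and> b < 6 \<and> a \<noteq> b \<and> list_all (\<lambda>(c, m).
     (\<forall>n \<in> {a, b, a + 6, b + 6}. count_list (legs m) n = 1) \<and>
     (\<forall>n \<in> set (legs m). n < 6 \<or> n = a + 6 \<or> n = b + 6)) p"

definition A1_half :: "nat \<Rightarrow> comb" where
  "A1_half w =
    [(2016, [(1, [0]), (0, [6, w, 7]), (1, [1])]),
     (288, [(0, [6, w, 7]), (1, [0, 1])]),
     (-12, [(0, [0, 6, 7]), (1, [w, 1])]),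
     (156, [(0, [w, 0, 6, 7]), (1, [1])]),
     (3, [(0, [w, 6, 0, 7, 1])])]"

definition A2_half :: "nat \<Rightarrow> nat \<Rightarrow> comb" where
  "A2_half w v =
    [(3744, [(0, [w, v, 6, 7]), (1, [0]), (1, [1])]),
     (2304, [(1, [w, 6]), (0, [0, v, 7]), (1, [1])]),
     (2304, [(1, [v, 6]), (0, [0, w, 7]), (1, [1])]),
     (-2304, [(0, [w, v, 7]), (1, [1, 6]), (1, [0])]),
     (276, [(0, [w, v, 6, 0, 7]), (1, [1])]),
     (60, [(0, [w, 6, 0, 7]), (1, [1, v])]),
     (60, [(0, [v, 6, 0, 7]), (1, [1, w])]),
     (-36, [(0, [6, 0, 7]), (1, [w, v, 1])]),
     (672, [(0, [w, v, 6, 7]), (1, [0, 1])]),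
     (96, [(0, [6, w, 7]), (1, [0, 1, v])]),
     (96, [(0, [6, v, 7]), (1, [0, 1, w])]),
     (-96, [(0, [w, v, 7]), (1, [1, 0, 6])]),
     (5, [(0, [w, v, 6, 0, 7, 1])])]"

definition B_half_symmetric :: "nat \<Rightarrow> nat \<Rightarrow> nat \<Rightarrow> comb" where
  "B_half_symmetric x y z =
    [(576, [(0, [x, y, z, 6, 7]), (1, [0]), (1, [1])]),
     (-3456, [(0, [x, y, z, 6]), (1, [0, 7]), (1, [1])]),
     (24, [(0, [x, y, z, 6, 0, 7]), (1, [1])]),
     (-24, [(0, [6, 0, 7]), (1, [x, y, z, 1])]),
     (288, [(0, [x, y, z, 6, 7]), (1, [0, 1])]),
     (-144, [(0, [x, y, z, 6]), (1, [0, 7, 1])])]"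

definition B_half_term :: "nat \<Rightarrow> nat \<Rightarrow> nat \<Rightarrow> comb" where
  "B_half_term x y z =
    [(-576, [(0, [x, y, 6, 7]), (1, [0]), (1, [1, z])]),
     (1152, [(0, [x, 0, 7]), (1, [1]), (1, [6, y, z])]),
     (-1728, [(0, [y, 6, 7]), (1, [x, 1]), (1, [0, z])]),
     (864, [(1, [x, 0]), (0, [y, z, 7]), (1, [6, 1])]),
     (-576, [(1, [0]), (0, [y, z, 7]), (1, [6, x, 1])]),
     (-36, [(0, [x, y, 6, 0, 7]), (1, [1, z])]),
     (36, [(0, [x, 6, 0, 7]), (1, [1, y, z])]),
     (-144, [(1, [x, 0, 1]), (0, [6, 7, y, z])]),
     (48, [(0, [6, z, 7]), (1, [x, y, 0, 1])]),
     (-24, [(0, [y, z, 7]), (1, [x, 6, 0, 1])])]"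

definition G_half_term :: "nat \<Rightarrow> nat \<Rightarrow> nat \<Rightarrow> nat \<Rightarrow> comb" where
  "G_half_term w x y z =
    [(72, [(0, [w, x, 7]), (0, [y, z, 8]), (1, [1, 2])]),
     (-96, [(0, [w, x, 8]), (0, [2, y, 7]), (1, [1, z])]),
     (-24, [(0, [w, x, 8]), (0, [2, y, z, 7]), (1, [1])]),
     (48, [(0, [w, x, y, 7]), (0, [1, z, 8]), (1, [2])]),
     (4, [(0, [w, x, y, 7]), (0, [1, z, 2, 8])]),
     (1, [(0, [w, x, y, z, 7]), (0, [1, 2, 8])]),
     (-6, [(0, [w, x, 7, 8]), (0, [1, 2, y, z])])]"

definition perms3 :: "'a \<Rightarrow> 'a \<Rightarrow> 'a \<Rightarrow> ('a \<times> 'a \<times> 'a) list"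
  where "perms3 x y z = [(x, y, z), (x, z, y), (y, x, z), (y, z, x), (z, x, y), (z, y, x)]"

definition perms4 :: "'a \<Rightarrow> 'a \<Rightarrow> 'a \<Rightarrow> 'a \<Rightarrow> ('a \<times> 'a \<times> 'a \<times> 'a) list" where
  "perms4 w x y z = map (Pair w) (perms3 x y z) @ map (Pair x) (perms3 w y z) @
     map (Pair y) (perms3 w x z) @ map (Pair z) (perms3 w x y)"

lemma sum_permutes_3:
  fixes h :: "nat \<Rightarrow> nat \<Rightarrow> nat \<Rightarrow> 'b :: comm_monoid_add"
  shows "(\<Sum>s | s permutes {..<3}. h (s 0) (s 1) (s 2)) = (\<Sum>(i, j, k)\<leftarrow>perms3 0 1 2. h i j k)"
proof -
  have "{..<3} = insert (0::nat) (insert 1 (insert 2 {}))" by auto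
  then show ?thesis
    by (simp add: sum_over_permutations_insert perms3_def transpose_def ac_simps)
qed

lemma sum_permutes_4:
  fixes h :: "nat \<Rightarrow> nat \<Rightarrow> nat \<Rightarrow> nat \<Rightarrow> 'b :: comm_monoid_add"
  shows "(\<Sum>s | s permutes {..<4}. h (s 0) (s 1) (s 2) (s 3)) = (\<Sum>(i, j, k, l)\<leftarrow>perms4 0 1 2 3. h i j k l)"
proof -
  have "{..<4} = insert (0::nat) (insert 1 (insert 2 (insert 3 {})))" by auto
  then show ?thesis
    by (simp add: sum_over_permutations_insert perms3_def perms4_def transpose_def ac_simps)
qed

definition B_half :: "nat \<Rightarrow> nat \<Rightarrow> nat \<Rightarrow> comb" where
  "B_half x y z = B_half_symmetric x y z @ concat (map (\<lambda>(x, y, z). B_half_term x y z) (perms3 x y z))"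

definition G_half :: "nat \<Rightarrow> nat \<Rightarrow> nat \<Rightarrow> nat \<Rightarrow> comb"
  where "G_half w x y z = concat (map (\<lambda>(w, x, y, z). G_half_term w x y z) (perms4 w x y z))"

context gw_data
begin

definition half_edge_sum :: "nat \<Rightarrow> nat \<Rightarrow> (nat \<Rightarrow> (nat \<times> 'n) vfield) \<Rightarrow> comb \<Rightarrow> (nat \<times> 'n) mfps" where
  "half_edge_sum a b \<rho> p = (\<Sum>\<alpha>\<in>UNIV. \<Sum>\<beta>\<in>UNIV.
     comb_val (\<rho>(a := \<gamma>d \<alpha>, a + 6 := \<gamma>u \<alpha>, b := \<gamma>d \<beta>, b + 6 := \<gamma>u \<beta>)) p)"

lemma comb_val_lower:
  assumes "\<And>c m. (c, m) \<in> set p \<Longrightarrow> graph_val \<rho> m = graph_val \<rho>' (relabel (\<lambda>n. if n < 6 then n else n - 6) m)"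
  shows "comb_val \<rho> p = comb_val \<rho>' (lower p)"
  using assms
proof (induction p)
  case (Cons t p)
  obtain c m where t: "t = (c, m)" by force
  have "graph_val \<rho> m = graph_val \<rho>' (relabel (\<lambda>n. if n < 6 then n else n - 6) m)"
    using t by (intro Cons.prems[of c]) simp
  moreover have "comb_val \<rho> p = comb_val \<rho>' (lower p)"
  proof (rule Cons.IH)
    fix c m assume "(c, m) \<in> set p"
    then show "graph_val \<rho> m = graph_val \<rho>' (relabel (\<lambda>n. if n < 6 then n else n - 6) m)"
      by (intro Cons.prems[of c]) simp
  qed
  ultimately show ?case
    by (simp add: t lower_def)
qed (simp add: lower_def)

text \<open>\<open>sum_frame\<close> is applied to one edge while the other is fixed; exchanging the
  two sums brings the second edge into position.\<close>

lemma half_edge_sum_conv_edge_sum: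
  assumes \<rho>: "\<And>n. vector_field (\<rho> n)" and p: "half_edges a b p"
  shows "half_edge_sum a b \<rho> p = edge_sum [a, b] \<rho> (lower p)"
proof -
  have count: "list_all (\<lambda>(c, m). count_list (legs m) n = 1) p" if "n \<in> {a, b, a + 6, b + 6}" for n
    using p that by (auto simp: half_edges_def list_all_iff)
  have ab: "a < 6" "b < 6" "a \<noteq> b"
    using p by (auto simp: half_edges_def)
  let ?\<rho> = "\<lambda>x x' y y'. \<rho>(a := x, a + 6 := x', b := y, b + 6 := y')"
  have vf: "vector_field (?\<rho> x x' y y' n)"
    if "vector_field x" "vector_field x'" "vector_field y" "vector_field y'" for x x' y y' n
    using that \<rho> by simp
  have 1: "mlinear (\<lambda>x. comb_val (?\<rho> x x' y y') p)" and 2: "mlinear (\<lambda>x'. comb_val (?\<rho> x x' y y') p)"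
    and 3: "mlinear (\<lambda>y. comb_val (?\<rho> x x' y y') p)" and 4: "mlinear (\<lambda>y'. comb_val (?\<rho> x x' y y') p)"
    if v: "vector_field x" "vector_field x'" "vector_field y" "vector_field y'" for x x' y y'
  proof -
    have ne: "a \<noteq> a + 6" "a \<noteq> b + 6" "b \<noteq> a + 6" "b \<noteq> b + 6" "a + 6 \<noteq> b + 6"
      using ab by auto
    have a: "\<rho>(a := u, a + 6 := x', b := y, b + 6 := y') = (?\<rho> x x' y y')(a := u)"
      "\<rho>(a := x, a + 6 := u, b := y, b + 6 := y') = (?\<rho> x x' y y')(a + 6 := u)"
      "\<rho>(a := x, a + 6 := x', b := u, b + 6 := y') = (?\<rho> x x' y y')(b := u)"
      "\<rho>(a := x, a + 6 := x', b := y, b + 6 := u) = (?\<rho> x x' y y')(b + 6 := u)" for u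
      using ab(3) ne by (simp_all add: fun_upd_def fun_eq_iff)
    have "mlinear (\<lambda>u. comb_val ((?\<rho> x x' y y')(n := u)) p)" if "n \<in> {a, b, a + 6, b + 6}" for n
      using that by (intro mlinear_comb_val vf v count)
    note this[of a] this[of "a + 6"] this[of b] this[of "b + 6"]
    then show "mlinear (\<lambda>x. comb_val (?\<rho> x x' y y') p)" "mlinear (\<lambda>x'. comb_val (?\<rho> x x' y y') p)"
      "mlinear (\<lambda>y. comb_val (?\<rho> x x' y y') p)" "mlinear (\<lambda>y'. comb_val (?\<rho> x x' y y') p)"
      by (simp_all only: a[symmetric] insert_iff simp_thms)
  qed
  have "half_edge_sum a b \<rho> p = (\<Sum>\<alpha>\<in>UNIV. \<Sum>j\<in>UNIV. comb_val (?\<rho> (\<gamma>d \<alpha>) (\<gamma>u \<alpha>) (e j) (e j)) p)"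
    unfolding half_edge_sum_def by (intro sum.cong refl sum_frame 3 4 vector_field_basis)
  also have "\<dots> = (\<Sum>j\<in>UNIV. \<Sum>\<alpha>\<in>UNIV. comb_val (?\<rho> (\<gamma>d \<alpha>) (\<gamma>u \<alpha>) (e j) (e j)) p)"
    by (rule sum.swap)
  also have "\<dots> = (\<Sum>j\<in>UNIV. \<Sum>i\<in>UNIV. comb_val (?\<rho> (e i) (e i) (e j) (e j)) p)"
    by (intro sum.cong refl sum_frame[where \<phi> = "\<lambda>x x'. comb_val (?\<rho> x x' _ _) p"] 1 2 vector_field_e)
  also have "\<dots> = (\<Sum>i\<in>UNIV. \<Sum>j\<in>UNIV. comb_val (?\<rho> (e i) (e i) (e j) (e j)) p)"
    by (rule sum.swap)
  finally have halves: "half_edge_sum a b \<rho> p = (\<Sum>i\<in>UNIV. \<Sum>j\<in>UNIV. comb_val (?\<rho> (e i) (e i) (e j) (e j)) p)" .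
  have "comb_val (?\<rho> x x y y) p = comb_val (\<rho>(a := x, b := y)) (lower p)" for x y
  proof (rule comb_val_lower)
    fix c m assume m: "(c, m) \<in> set p"
    show "graph_val (?\<rho> x x y y) m = graph_val (\<rho>(a := x, b := y)) (relabel (\<lambda>n. if n < 6 then n else n - 6) m)"
      unfolding graph_val_relabel
    proof (rule graph_val_cong)
      fix n assume "n \<in> set (legs m)"
      then consider "n < 6" | "n = a + 6" | "n = b + 6"
        using p m by (auto simp: half_edges_def list_all_iff)
      then show "?\<rho> x x y y n = ((\<rho>(a := x, b := y)) \<circ> (\<lambda>n. if n < 6 then n else n - 6)) n"
        using ab by cases auto
    qed
  qed
  then show ?thesis
    unfolding halves by (simp only: edge_sum.simps)
qed

text \<open>Rewrite rules for a product in one of the first four places, which covers all products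
  in the tensors.\<close>

lemma contract_qprod:
  "contract F ((W \<star> V) # ys) = (\<Sum>\<alpha>\<in>UNIV. \<llangle>[W, V, \<gamma>u \<alpha>]\<rrangle>\<^sub>0 * contract F (\<gamma>d \<alpha> # ys))"
  "vector_field x \<Longrightarrow> contract F (x # (W \<star> V) # ys) =
    (\<Sum>\<alpha>\<in>UNIV. \<llangle>[W, V, \<gamma>u \<alpha>]\<rrangle>\<^sub>0 * contract F (x # \<gamma>d \<alpha> # ys))"
  "vector_field x \<Longrightarrow> vector_field y \<Longrightarrow> contract F (x # y # (W \<star> V) # ys) =
    (\<Sum>\<alpha>\<in>UNIV. \<llangle>[W, V, \<gamma>u \<alpha>]\<rrangle>\<^sub>0 * contract F (x # y # \<gamma>d \<alpha> # ys))"
  "vector_field x \<Longrightarrow> vector_field y \<Longrightarrow> vector_field z \<Longrightarrow> contract F (x # y # z # (W \<star> V) # ys) =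
    (\<Sum>\<alpha>\<in>UNIV. \<llangle>[W, V, \<gamma>u \<alpha>]\<rrangle>\<^sub>0 * contract F (x # y # z # \<gamma>d \<alpha> # ys))"
proof -
  have at: "contract F (xs @ (W \<star> V) # ys) =
      (\<Sum>\<alpha>\<in>UNIV. \<llangle>[W, V, \<gamma>u \<alpha>]\<rrangle>\<^sub>0 * contract F (xs @ \<gamma>d \<alpha> # ys))"
    if "\<And>x. x \<in> set xs \<Longrightarrow> vector_field x" for xs
    using that by (intro mlinear_qprod_apply mlinear_contract_at)
  show "contract F ((W \<star> V) # ys) = (\<Sum>\<alpha>\<in>UNIV. \<llangle>[W, V, \<gamma>u \<alpha>]\<rrangle>\<^sub>0 * contract F (\<gamma>d \<alpha> # ys))"
    using at[of "[]"] by simp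
  show "vector_field x \<Longrightarrow> contract F (x # (W \<star> V) # ys) =
    (\<Sum>\<alpha>\<in>UNIV. \<llangle>[W, V, \<gamma>u \<alpha>]\<rrangle>\<^sub>0 * contract F (x # \<gamma>d \<alpha> # ys))"
    using at[of "[x]"] by simp
  show "vector_field x \<Longrightarrow> vector_field y \<Longrightarrow> contract F (x # y # (W \<star> V) # ys) =
    (\<Sum>\<alpha>\<in>UNIV. \<llangle>[W, V, \<gamma>u \<alpha>]\<rrangle>\<^sub>0 * contract F (x # y # \<gamma>d \<alpha> # ys))"
    using at[of "[x, y]"] by auto
  show "vector_field x \<Longrightarrow> vector_field y \<Longrightarrow> vector_field z \<Longrightarrow> contract F (x # y # z # (W \<star> V) # ys) =
    (\<Sum>\<alpha>\<in>UNIV. \<llangle>[W, V, \<gamma>u \<alpha>]\<rrangle>\<^sub>0 * contract F (x # y # z # \<gamma>d \<alpha> # ys))"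
    using at[of "[x, y, z]"] by auto
qed

lemma half_edge_sum_append: "half_edge_sum a b \<rho> (p @ q) = half_edge_sum a b \<rho> p + half_edge_sum a b \<rho> q"
  by (simp add: half_edge_sum_def sum.distrib)

lemmas read_in = half_edge_sum_def contract_qprod sum_distrib_left sum_distrib_right cscale_sum
  sum.distrib cscale_add_right cscale_diff_right cscale_minus_right cscale_minus_left sum_negf
  sum_subtractf

lemma A1_half:
  assumes \<rho>: "\<And>n. vector_field (\<rho> n)" and w: "w \<notin> {0, 1, 6, 7}"
  shows "2880 *\<^sub>c A1 (\<rho> w) = half_edge_sum 0 1 \<rho> (A1_half w)"
  using w \<rho>[of w] by (simp add: A1_def A1_half_def read_in mult.assoc)

lemma A2_half:
  assumes \<rho>: "\<And>n. vector_field (\<rho> n)" and w: "w \<notin> {0, 1, 6, 7}" "v \<notin> {0, 1, 6, 7}"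
  shows "2880 *\<^sub>c A2 (\<rho> w) (\<rho> v) = half_edge_sum 0 1 \<rho> (A2_half w v)"
  using w \<rho>[of w] \<rho>[of v] by (simp add: A2_def A2_half_def read_in mult.assoc)

text \<open>Naming the summand allows the permutations to be listed before any product is
  expanded.\<close>

definition B_summand :: "(nat \<times> 'n) vfield \<Rightarrow> (nat \<times> 'n) vfield \<Rightarrow> (nat \<times> 'n) vfield \<Rightarrow> (nat \<times> 'n) mfps" where
  "B_summand X Y Z =
    - ((1/5) *\<^sub>c (\<Sum>\<alpha>\<in>UNIV. \<Sum>\<beta>\<in>UNIV. \<llangle>[X, Y, \<gamma>u \<alpha>, \<gamma>u \<beta>]\<rrangle>\<^sub>0 * \<llangle>[\<gamma>d \<alpha>]\<rrangle>\<^sub>1 * \<llangle>[\<gamma>d \<beta>, Z]\<rrangle>\<^sub>1))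
    + (2/5) *\<^sub>c (\<Sum>\<alpha>\<in>UNIV. \<llangle>[X \<star> \<gamma>d \<alpha>]\<rrangle>\<^sub>1 * \<llangle>[\<gamma>u \<alpha>, Y, Z]\<rrangle>\<^sub>1)
    - (3/5) *\<^sub>c (\<Sum>\<alpha>\<in>UNIV. \<llangle>[X, Y \<star> \<gamma>u \<alpha>]\<rrangle>\<^sub>1 * \<llangle>[\<gamma>d \<alpha>, Z]\<rrangle>\<^sub>1)
    + (3/10) *\<^sub>c (\<Sum>\<alpha>\<in>UNIV. \<llangle>[X, \<gamma>d \<alpha>]\<rrangle>\<^sub>1 * \<llangle>[\<gamma>u \<alpha>, Y \<star> Z]\<rrangle>\<^sub>1)
    - (1/5) *\<^sub>c (\<Sum>\<alpha>\<in>UNIV. \<llangle>[\<gamma>d \<alpha>]\<rrangle>\<^sub>1 * \<llangle>[\<gamma>u \<alpha>, X, Y \<star> Z]\<rrangle>\<^sub>1)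
    - (1/80) *\<^sub>c (\<Sum>\<alpha>\<in>UNIV. \<Sum>\<beta>\<in>UNIV. \<llangle>[X, Y, \<gamma>u \<alpha>, \<gamma>d \<alpha>, \<gamma>u \<beta>]\<rrangle>\<^sub>0 * \<llangle>[\<gamma>d \<beta>, Z]\<rrangle>\<^sub>1)
    + (1/80) *\<^sub>c (\<Sum>\<alpha>\<in>UNIV. \<Sum>\<beta>\<in>UNIV. \<llangle>[X, \<gamma>u \<alpha>, \<gamma>d \<alpha>, \<gamma>u \<beta>]\<rrangle>\<^sub>0 * \<llangle>[\<gamma>d \<beta>, Y, Z]\<rrangle>\<^sub>1)
    - (1/20) *\<^sub>c (\<Sum>\<alpha>\<in>UNIV. \<Sum>\<beta>\<in>UNIV. \<llangle>[X, \<gamma>d \<alpha>, \<gamma>d \<beta>]\<rrangle>\<^sub>1 * \<llangle>[\<gamma>u \<alpha>, \<gamma>u \<beta>, Y, Z]\<rrangle>\<^sub>0)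
    + (1/60) *\<^sub>c (\<Sum>\<alpha>\<in>UNIV. \<llangle>[X, Y, \<gamma>d \<alpha>, \<gamma>u \<alpha> \<star> Z]\<rrangle>\<^sub>1)
    - (1/120) *\<^sub>c (\<Sum>\<alpha>\<in>UNIV. \<llangle>[X, \<gamma>u \<alpha>, \<gamma>d \<alpha>, Y \<star> Z]\<rrangle>\<^sub>1)"

definition G_summand :: "(nat \<times> 'n) vfield \<Rightarrow> (nat \<times> 'n) vfield \<Rightarrow> (nat \<times> 'n) vfield \<Rightarrow>
    (nat \<times> 'n) vfield \<Rightarrow> (nat \<times> 'n) mfps" where
  "G_summand W X Y Z =
      3 *\<^sub>c \<llangle>[W \<star> X, Y \<star> Z]\<rrangle>\<^sub>1
    - 4 *\<^sub>c \<llangle>[W \<star> X \<star> Y, Z]\<rrangle>\<^sub>1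
    - (\<Sum>\<alpha>\<in>UNIV. \<llangle>[W \<star> X, Y, Z, \<gamma>u \<alpha>]\<rrangle>\<^sub>0 * \<llangle>[\<gamma>d \<alpha>]\<rrangle>\<^sub>1)
    + 2 *\<^sub>c (\<Sum>\<alpha>\<in>UNIV. \<llangle>[W, X, Y, \<gamma>u \<alpha>]\<rrangle>\<^sub>0 * \<llangle>[\<gamma>d \<alpha> \<star> Z]\<rrangle>\<^sub>1)
    + (1/6) *\<^sub>c (\<Sum>\<alpha>\<in>UNIV. \<Sum>\<beta>\<in>UNIV. \<llangle>[W, X, Y, \<gamma>u \<alpha>]\<rrangle>\<^sub>0 * \<llangle>[\<gamma>d \<alpha>, Z, \<gamma>d \<beta>, \<gamma>u \<beta>]\<rrangle>\<^sub>0)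
    + (1/24) *\<^sub>c (\<Sum>\<alpha>\<in>UNIV. \<Sum>\<beta>\<in>UNIV. \<llangle>[W, X, Y, Z, \<gamma>u \<alpha>]\<rrangle>\<^sub>0 * \<llangle>[\<gamma>d \<alpha>, \<gamma>d \<beta>, \<gamma>u \<beta>]\<rrangle>\<^sub>0)
    - (1/4) *\<^sub>c (\<Sum>\<alpha>\<in>UNIV. \<Sum>\<beta>\<in>UNIV. \<llangle>[W, X, \<gamma>u \<alpha>, \<gamma>u \<beta>]\<rrangle>\<^sub>0 * \<llangle>[\<gamma>d \<alpha>, \<gamma>d \<beta>, Y, Z]\<rrangle>\<^sub>0)"

lemma B_half_term:
  assumes \<rho>: "\<And>n. vector_field (\<rho> n)" and "x \<notin> {0, 1, 6, 7}" "y \<notin> {0, 1, 6, 7}" "z \<notin> {0, 1, 6, 7}"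
  shows "2880 *\<^sub>c B_summand (\<rho> x) (\<rho> y) (\<rho> z) = half_edge_sum 0 1 \<rho> (B_half_term x y z)"
  using assms(2-) \<rho>[of x] \<rho>[of y] \<rho>[of z]
  by (simp add: B_summand_def B_half_term_def read_in mult.assoc)

lemma G_half_term:
  assumes \<rho>: "\<And>n. vector_field (\<rho> n)"
    and "w \<notin> {1, 2, 7, 8}" "x \<notin> {1, 2, 7, 8}" "y \<notin> {1, 2, 7, 8}" "z \<notin> {1, 2, 7, 8}"
  shows "24 *\<^sub>c G_summand (\<rho> w) (\<rho> x) (\<rho> y) (\<rho> z) = half_edge_sum 1 2 \<rho> (G_half_term w x y z)"
  using assms(2-) \<rho>[of w] \<rho>[of x] \<rho>[of y] \<rho>[of z]
  by (simp add: G_summand_def G_half_term_def read_in mult.assoc)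

lemma B_conv_summand:
  "B X Y Z =
      (1/5) *\<^sub>c (\<Sum>\<alpha>\<in>UNIV. \<Sum>\<beta>\<in>UNIV. \<llangle>[X, Y, Z, \<gamma>u \<alpha>, \<gamma>u \<beta>]\<rrangle>\<^sub>0 * \<llangle>[\<gamma>d \<alpha>]\<rrangle>\<^sub>1 * \<llangle>[\<gamma>d \<beta>]\<rrangle>\<^sub>1)
    - (6/5) *\<^sub>c (\<Sum>\<alpha>\<in>UNIV. \<Sum>\<beta>\<in>UNIV. \<llangle>[X, Y, Z, \<gamma>u \<alpha>]\<rrangle>\<^sub>0 * \<llangle>[\<gamma>d \<alpha>, \<gamma>u \<beta>]\<rrangle>\<^sub>1 * \<llangle>[\<gamma>d \<beta>]\<rrangle>\<^sub>1)
    + (1/120) *\<^sub>c (\<Sum>\<alpha>\<in>UNIV. \<Sum>\<beta>\<in>UNIV. \<llangle>[X, Y, Z, \<gamma>u \<alpha>, \<gamma>d \<alpha>, \<gamma>u \<beta>]\<rrangle>\<^sub>0 * \<llangle>[\<gamma>d \<beta>]\<rrangle>\<^sub>1)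
    - (1/120) *\<^sub>c (\<Sum>\<alpha>\<in>UNIV. \<llangle>[X, Y, Z, \<gamma>u \<alpha> \<star> \<gamma>d \<alpha>]\<rrangle>\<^sub>1)
    + (1/10) *\<^sub>c (\<Sum>\<alpha>\<in>UNIV. \<Sum>\<beta>\<in>UNIV. \<llangle>[X, Y, Z, \<gamma>u \<alpha>, \<gamma>u \<beta>]\<rrangle>\<^sub>0 * \<llangle>[\<gamma>d \<alpha>, \<gamma>d \<beta>]\<rrangle>\<^sub>1)
    - (1/20) *\<^sub>c (\<Sum>\<alpha>\<in>UNIV. \<Sum>\<beta>\<in>UNIV. \<llangle>[X, Y, Z, \<gamma>u \<alpha>]\<rrangle>\<^sub>0 * \<llangle>[\<gamma>d \<alpha>, \<gamma>u \<beta>, \<gamma>d \<beta>]\<rrangle>\<^sub>1)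
    + (\<Sum>(U, V, W)\<leftarrow>perms3 X Y Z. B_summand U V W)"
proof -
  let ?W = "\<lambda>i. [X, Y, Z] ! i"
  have "(\<Sum>s | s permutes {..<3}. B_summand (?W (s 0)) (?W (s 1)) (?W (s 2))) =
      (\<Sum>(U, V, W)\<leftarrow>perms3 X Y Z. B_summand U V W)"
    using sum_permutes_3[of "\<lambda>i j k. B_summand (?W i) (?W j) (?W k)"] by (simp add: perms3_def)
  then show ?thesis
    unfolding B_def Let_def B_summand_def by (simp only:)
qed

lemma G_conv_summand: "G W X Y Z = (\<Sum>(U, V, S, R)\<leftarrow>perms4 W X Y Z. G_summand U V S R)"
proof -
  let ?W = "\<lambda>i. [W, X, Y, Z] ! i"
  have "(\<Sum>s | s permutes {..<4}. G_summand (?W (s 0)) (?W (s 1)) (?W (s 2)) (?W (s 3))) =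
      (\<Sum>(U, V, S, R)\<leftarrow>perms4 W X Y Z. G_summand U V S R)"
    using sum_permutes_4[of "\<lambda>i j k l. G_summand (?W i) (?W j) (?W k) (?W l)"] by (simp add: perms4_def perms3_def)
  then show ?thesis
    unfolding G_def Let_def G_summand_def by (simp only:)
qed

lemma B_half:
  assumes \<rho>: "\<And>n. vector_field (\<rho> n)" and xyz: "x \<notin> {0, 1, 6, 7}" "y \<notin> {0, 1, 6, 7}" "z \<notin> {0, 1, 6, 7}"
  shows "2880 *\<^sub>c B (\<rho> x) (\<rho> y) (\<rho> z) = half_edge_sum 0 1 \<rho> (B_half x y z)"
proof -
  have "2880 *\<^sub>c (B (\<rho> x) (\<rho> y) (\<rho> z) - (\<Sum>(U, V, W)\<leftarrow>perms3 (\<rho> x) (\<rho> y) (\<rho> z). B_summand U V W)) =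
      half_edge_sum 0 1 \<rho> (B_half_symmetric x y z)"
    using xyz \<rho>[of x] \<rho>[of y] \<rho>[of z]
    by (simp add: B_conv_summand B_half_symmetric_def read_in mult.assoc)
  moreover have "2880 *\<^sub>c (\<Sum>(U, V, W)\<leftarrow>perms3 (\<rho> x) (\<rho> y) (\<rho> z). B_summand U V W) =
      half_edge_sum 0 1 \<rho> (concat (map (\<lambda>(x, y, z). B_half_term x y z) (perms3 x y z)))"
    using xyz \<rho> by (simp add: perms3_def half_edge_sum_append cscale_add_right B_half_term)
  ultimately show ?thesis
    by (simp only: B_half_def half_edge_sum_append cscale_diff_right) (simp add: algebra_simps)
qed

lemma G_half:
  assumes \<rho>: "\<And>n. vector_field (\<rho> n)"
    and wxyz: "w \<notin> {1, 2, 7, 8}" "x \<notin> {1, 2, 7, 8}" "y \<notin> {1, 2, 7, 8}" "z \<notin> {1, 2, 7, 8}"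
  shows "24 *\<^sub>c G (\<rho> w) (\<rho> x) (\<rho> y) (\<rho> z) = half_edge_sum 1 2 \<rho> (G_half w x y z)"
  using wxyz \<rho> unfolding G_conv_summand
  by (simp add: perms4_def perms3_def G_half_def half_edge_sum_append cscale_add_right G_half_term del: One_nat_def)

end

section \<open>The certificates\<close>

definition A1_comb :: "nat \<Rightarrow> comb"
  where "A1_comb w = lower (A1_half w)"

definition A2_comb :: "nat \<Rightarrow> nat \<Rightarrow> comb"
  where "A2_comb w v = lower (A2_half w v)"

definition B_comb :: "nat \<Rightarrow> nat \<Rightarrow> nat \<Rightarrow> comb"
  where "B_comb x y z = lower (B_half x y z)"

text \<open>Only \<open>sort_graph\<close> is applied: label 0 is still a free leg here, and
  \<open>canonical\<close> would permute it with the edges 1 and 2. Collecting the 24 permutations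
  at this stage keeps everything derived from them short.\<close>

definition G_comb :: "nat \<Rightarrow> nat \<Rightarrow> nat \<Rightarrow> nat \<Rightarrow> comb"
  where "G_comb w x y z = collect sort_graph (lower (G_half w x y z))"

type_synonym wdvv_term = "int \<times> graph \<times> (nat \<times> nat \<times> nat \<times> nat) \<times> nat list"

definition WDVV_sum :: "wdvv_term list \<Rightarrow> comb"
  where "WDVV_sum l = concat (map (\<lambda>(k, q, (a, b, c, d), xs). scale_comb k (attach q (WDVV_comb a b c d xs))) l)"

definition WDVV_admissible :: "wdvv_term list \<Rightarrow> bool" where
  "WDVV_admissible l \<longleftrightarrow>
     list_all (\<lambda>(k, q, (a, b, c, d), xs). 2 \<notin> set (a # b # c # d # xs) \<and> 2 \<notin> set (legs q)) l"

text \<open>Both equations are multiplied by \<open>69120 = 24 \<cdot> 2880\<close>.\<close>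

definition equation1 :: comb where
  "equation1 = eliminate_T 4 (A2_comb 3 4) @ scale_comb (-1) (eliminate_T 3 (insert_leg 3 (A1_comb 4)))"

text \<open>Eliminating \<open>T\<close> multiplies the first part by 24; the other two parts
  contain no \<open>T\<close> and receive this factor explicitly. The vertex
  \<open>[3, 4, 2]\<close> is the product of the first two fields, attached by edge 2.\<close>

definition equation2 :: comb where
  "equation2 = eliminate_T 5 (B_comb 3 4 5) @
     scale_comb (-24) (attach [(0, [3, 4, 2])] (A2_comb 2 5)) @
     scale_comb 24 (attach [(0, [3, 4, 2])] (insert_leg 2 (A1_comb 5)))"

text \<open>
  The coefficients solve the linear system expressing each equation through instances of
  associativity and of Getzler's relation; they were found by computer.
\<close>

definition WDVV_terms1 :: "wdvv_term list" where
  "WDVV_terms1 =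
    [(384, [(1, [0, 1])], (0, 1, 3, 4), []),
     (672, [(1, [1])], (0, 0, 3, 4), [1]),
     (-576, [(1, [1])], (0, 1, 3, 4), [0]),
     (-4896, [(1, [1])], (0, 3, 4, 1), [0]),
     (-384, [(1, [1, 3])], (0, 0, 1, 4), []),
     (-384, [(1, [1, 4])], (0, 0, 1, 3), [])]"

definition WDVV_terms2 :: "wdvv_term list" where
  "WDVV_terms2 =
    [(96, [], (0, 0, 3, 4), [1, 1, 5]),
     (27648, [(1, [0]), (1, [1])], (0, 1, 3, 4), [5]),
     (-9216, [(1, [0]), (1, [1])], (0, 3, 4, 5), [1]),
     (-18432, [(1, [0]), (1, [1])], (0, 4, 5, 3), [1]),
     (46080, [(1, [0]), (1, [1, 3])], (0, 1, 4, 5), []),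
     (-64512, [(1, [0]), (1, [1, 3])], (0, 1, 5, 4), []),
     (46080, [(1, [0]), (1, [1, 4])], (0, 1, 3, 5), []),
     (-64512, [(1, [0]), (1, [1, 4])], (0, 1, 5, 3), []),
     (36864, [(1, [0]), (1, [1, 5])], (0, 1, 3, 4), []),
     (18432, [(1, [0]), (1, [1, 5])], (0, 3, 4, 1), []),
     (1536, [(1, [0, 1])], (0, 1, 3, 5), [4]),
     (2304, [(1, [0, 1])], (0, 3, 4, 5), [1]),
     (-3072, [(1, [0, 1])], (0, 3, 5, 4), [1]),
     (18432, [(1, [0, 1]), (1, [1])], (0, 3, 4, 5), []),
     (-36864, [(1, [0, 1]), (1, [1])], (0, 3, 5, 4), []),
     (-768, [(1, [0, 1, 1])], (0, 3, 5, 4), []),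
     (-768, [(1, [0, 1, 1])], (0, 4, 5, 3), []),
     (6528, [(1, [0, 1, 3])], (0, 1, 4, 5), []),
     (6528, [(1, [0, 1, 4])], (0, 1, 3, 5), []),
     (1152, [(1, [0, 1, 5])], (0, 1, 3, 4), []),
     (288, [(1, [1])], (0, 0, 1, 5), [3, 4]),
     (2688, [(1, [1])], (0, 0, 3, 4), [1, 5]),
     (864, [(1, [1])], (0, 1, 5, 3), [0, 4]),
     (-288, [(1, [1])], (1, 3, 4, 5), [0, 0]),
     (-1440, [(1, [1])], (1, 4, 5, 3), [0, 0]),
     (672, [(1, [1, 3])], (0, 0, 1, 5), [4]),
     (-672, [(1, [1, 3])], (0, 1, 5, 4), [0]),
     (-1536, [(1, [1, 3])], (0, 4, 5, 1), [0]),
     (-768, [(1, [1, 3, 4])], (0, 0, 1, 5), []),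
     (672, [(1, [1, 4])], (0, 0, 3, 5), [1]),
     (864, [(1, [1, 4])], (0, 1, 3, 5), [0]),
     (-2208, [(1, [1, 4])], (0, 1, 5, 3), [0]),
     (-288, [(1, [1, 5])], (0, 0, 1, 3), [4]),
     (576, [(1, [1, 5])], (0, 0, 3, 4), [1]),
     (288, [(1, [1, 5])], (0, 1, 3, 4), [0])]"

text \<open>Two legs of Getzler's relation carry the fields 3 and 4, the other two are closed by
  edge 0. Since \<open>G_comb\<close> is 24 times the relation, the first equation is -1/2880 times
  this contraction, up to associativity.\<close>

lemma cancels_equation1: "cancels (equation1 @ G_comb 3 4 0 0 @ WDVV_sum WDVV_terms1)"
  by code_simp

text \<open>Five instances of Getzler's relation: one with a genus-1 one-point vertex on its fourth
  leg, three closed ones differentiated along the missing field, and one whose fourth leg is joined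
  to a derivative. The coefficients -1, 1, 1 of the closed ones reflect that the equation is
  symmetric in the fields 3 and 4 only.\<close>

lemma cancels_equation2:
  "cancels (equation2 @ scale_comb (-96) (attach [(1, [0])] (G_comb 3 4 5 0)) @
     scale_comb (-1) (insert_leg 5 (G_comb 3 4 0 0)) @ insert_leg 3 (G_comb 4 5 0 0) @
     insert_leg 4 (G_comb 3 5 0 0) @ scale_comb (-4) (insert_leg 0 (G_comb 3 4 5 0)) @
     WDVV_sum WDVV_terms2)"
  by code_simp

lemma WDVV_admissible_terms: "WDVV_admissible WDVV_terms1" "WDVV_admissible WDVV_terms2"
  by code_simp+

lemma half_edges_tensors:
  "half_edges 0 1 (A1_half 3)" "half_edges 0 1 (A1_half 4)" "half_edges 0 1 (A1_half 5)"
  "half_edges 0 1 (A2_half 3 4)" "half_edges 0 1 (A2_half 2 5)" "half_edges 0 1 (B_half 3 4 5)"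
  "half_edges 1 2 (G_half 3 4 0 0)" "half_edges 1 2 (G_half 4 5 0 0)"
  "half_edges 1 2 (G_half 3 5 0 0)" "half_edges 1 2 (G_half 3 4 5 0)"
  by code_simp+

lemma T_eliminable_tensors:
  "list_all (\<lambda>(c, m). T_eliminable 4 m) (A2_comb 3 4)"
  "list_all (\<lambda>(c, m). T_eliminable 3 m) (insert_leg 3 (A1_comb 4))"
  "list_all (\<lambda>(c, m). T_eliminable 5 m) (B_comb 3 4 5)"
  by code_simp+

lemma linear_tensors:
  "list_all (\<lambda>(c, m). count_list (legs m) 3 = 1) (A1_comb 3)"
  "n \<in> {3, 4} \<Longrightarrow> list_all (\<lambda>(c, m). count_list (legs m) n = 1) (A2_comb 3 4)"
  "list_all (\<lambda>(c, m). count_list (legs m) 2 = 1) (A2_comb 2 5)"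
  "list_all (\<lambda>(c, m). count_list (legs m) 2 = 1) (insert_leg 2 (A1_comb 5))"
  "n \<in> {3, 4, 5} \<Longrightarrow> list_all (\<lambda>(c, m). count_list (legs m) n = 1) (B_comb 3 4 5)"
proof -
  have *: "list_all (\<lambda>(c, m). count_list (legs m) 3 = 1) (A2_comb 3 4)"
    "list_all (\<lambda>(c, m). count_list (legs m) 4 = 1) (A2_comb 3 4)"
    "list_all (\<lambda>(c, m). count_list (legs m) 3 = 1) (B_comb 3 4 5)"
    "list_all (\<lambda>(c, m). count_list (legs m) 4 = 1) (B_comb 3 4 5)"
    "list_all (\<lambda>(c, m). count_list (legs m) 5 = 1) (B_comb 3 4 5)"
    by code_simp+
  then show "n \<in> {3, 4} \<Longrightarrow> list_all (\<lambda>(c, m). count_list (legs m) n = 1) (A2_comb 3 4)"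
    "n \<in> {3, 4, 5} \<Longrightarrow> list_all (\<lambda>(c, m). count_list (legs m) n = 1) (B_comb 3 4 5)"
    by auto
  show "list_all (\<lambda>(c, m). count_list (legs m) 3 = 1) (A1_comb 3)"
    "list_all (\<lambda>(c, m). count_list (legs m) 2 = 1) (A2_comb 2 5)"
    "list_all (\<lambda>(c, m). count_list (legs m) 2 = 1) (insert_leg 2 (A1_comb 5))"
    by code_simp+
qed

section \<open>The two equations\<close>

lemma A1_comb_legs:
  "list_all (\<lambda>(c, m). \<forall>n \<in> set (legs m). n \<in> {0, 1, 4}) (A1_comb 4)"
  "list_all (\<lambda>(c, m). \<forall>n \<in> set (legs m). n \<in> {0, 1, 5}) (A1_comb 5)"
  by code_simp+

context gw_data
begin

text \<open>\<open>edge_sum_qprod\<close> sums the product edge 2 outermost, while the certificates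
  sum it innermost.\<close>

lemma edge_sum_rotate: "edge_sum [2, 0, 1] \<rho> p = edge_sum [0, 1, 2] \<rho> p"
proof -
  have "\<rho>(2 := x, 0 := y, 1 := z) = \<rho>(0 := y, 1 := z, 2 := x)" for x y z
    by (auto simp: fun_eq_iff)
  then have "edge_sum [2, 0, 1] \<rho> p = (\<Sum>k\<in>UNIV. \<Sum>i\<in>UNIV. \<Sum>j\<in>UNIV. comb_val (\<rho>(0 := e i, 1 := e j, 2 := e k)) p)"
    by (simp only: edge_sum.simps)
  also have "\<dots> = edge_sum [0, 1, 2] \<rho> p"
    unfolding edge_sum.simps by (rule triple_sum_perm(3))
  finally show ?thesis .
qed

lemma A1_conv_edge_sum:
  assumes "\<And>n. vector_field (\<rho> n)" "half_edges 0 1 (A1_half w)" "w \<notin> {0, 1, 6, 7}"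
  shows "2880 *\<^sub>c A1 (\<rho> w) = edge_sum [0, 1] \<rho> (A1_comb w)"
  unfolding A1_comb_def half_edge_sum_conv_edge_sum[where \<rho> = \<rho>, OF assms(1,2), symmetric]
  using assms(1,3-) by (rule A1_half)

lemma A2_conv_edge_sum:
  assumes "\<And>n. vector_field (\<rho> n)" "half_edges 0 1 (A2_half w v)" "w \<notin> {0, 1, 6, 7}" "v \<notin> {0, 1, 6, 7}"
  shows "2880 *\<^sub>c A2 (\<rho> w) (\<rho> v) = edge_sum [0, 1] \<rho> (A2_comb w v)"
  unfolding A2_comb_def half_edge_sum_conv_edge_sum[where \<rho> = \<rho>, OF assms(1,2), symmetric]
  using assms(1,3-) by (rule A2_half)

lemma B_conv_edge_sum:
  assumes "\<And>n. vector_field (\<rho> n)" "half_edges 0 1 (B_half x y z)"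
    "x \<notin> {0, 1, 6, 7}" "y \<notin> {0, 1, 6, 7}" "z \<notin> {0, 1, 6, 7}"
  shows "2880 *\<^sub>c B (\<rho> x) (\<rho> y) (\<rho> z) = edge_sum [0, 1] \<rho> (B_comb x y z)"
  unfolding B_comb_def half_edge_sum_conv_edge_sum[where \<rho> = \<rho>, OF assms(1,2), symmetric]
  using assms(1,3-) by (rule B_half)

text \<open>Labels 3, 4, 5 are the arguments of the equations; all others get some parallel field,
  which is overwritten wherever an edge label is summed.\<close>

definition env :: "(nat \<times> 'n) vfield \<Rightarrow> (nat \<times> 'n) vfield \<Rightarrow> (nat \<times> 'n) vfield \<Rightarrow> nat \<Rightarrow> (nat \<times> 'n) vfield"
  where "env X Y Z = (\<lambda>n. e undefined)(3 := X, 4 := Y, 5 := Z)"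

lemma env_simps [simp]: "env X Y Z 3 = X" "env X Y Z 4 = Y" "env X Y Z 5 = Z"
  by (simp_all add: env_def)

lemma env_upd: "(env X Y Z)(3 := W) = env W Y Z" "(env X Y Z)(4 := W) = env X W Z"
  "(env X Y Z)(5 := W) = env X Y W"
  by (auto simp: env_def fun_eq_iff)

lemma constant_field_env: "constant_field X \<Longrightarrow> constant_field Y \<Longrightarrow> constant_field Z \<Longrightarrow> constant_field (env X Y Z n)"
  and vector_field_env: "vector_field X \<Longrightarrow> vector_field Y \<Longrightarrow> vector_field Z \<Longrightarrow> vector_field (env X Y Z n)"
  by (simp_all add: env_def)

section \<open>Linearity over functions of the tensors and operators\<close>

lemma mlinear_edge_sum_env:
  assumes "mlinear (\<lambda>W. (1/2880) *\<^sub>c edge_sum [0, 1] (\<rho>(n := W)) p)"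
    "\<And>W. vector_field W \<Longrightarrow> 2880 *\<^sub>c f W = edge_sum [0, 1] (\<rho>(n := W)) p"
  shows "mlinear f"
proof (rule mlinear_cong[OF assms(1)])
  fix W :: "(nat \<times> 'n) vfield" assume "vector_field W"
  from assms(2)[OF this, symmetric] show "(1/2880) *\<^sub>c edge_sum [0, 1] (\<rho>(n := W)) p = f W"
    by simp
qed

text \<open>Linearity is read off the graphs, in which the argument is a leg occurring exactly
  once.\<close>

lemma mlinear_A1: "mlinear A1"
proof (rule mlinear_edge_sum_env)
  show "mlinear (\<lambda>W. (1/2880) *\<^sub>c edge_sum [0, 1] ((env (e undefined) (e undefined) (e undefined))(3 := W)) (A1_comb 3))"
    by (intro mlinear_cscale mlinear_edge_sum vector_field_env vector_field_e linear_tensors) simp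
  fix W :: "(nat \<times> 'n) vfield" assume "vector_field W"
  then show "2880 *\<^sub>c A1 W = edge_sum [0, 1] ((env (e undefined) (e undefined) (e undefined))(3 := W)) (A1_comb 3)"
    using A1_conv_edge_sum[of "env W (e undefined) (e undefined)" 3]
    by (simp add: env_upd vector_field_env half_edges_tensors del: One_nat_def edge_sum.simps fun_upd_apply)
qed

lemma mlinear_A2:
  assumes V: "vector_field V"
  shows "mlinear (\<lambda>W. A2 W V)" "mlinear (A2 V)"
proof -
  have A2: "2880 *\<^sub>c A2 W X = edge_sum [0, 1] (env W X (e undefined)) (A2_comb 3 4)"
    if "vector_field W" "vector_field X" for W X
    using that A2_conv_edge_sum[of "env W X (e undefined)" 3 4]
    by (simp add: vector_field_env half_edges_tensors del: One_nat_def edge_sum.simps)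
  show "mlinear (\<lambda>W. A2 W V)"
  proof (rule mlinear_edge_sum_env)
    show "mlinear (\<lambda>W. (1/2880) *\<^sub>c edge_sum [0, 1] ((env V V (e undefined))(3 := W)) (A2_comb 3 4))"
      by (intro mlinear_cscale mlinear_edge_sum vector_field_env vector_field_e V linear_tensors) simp_all
  qed (simp add: A2 V env_upd del: One_nat_def edge_sum.simps fun_upd_apply)
  show "mlinear (A2 V)"
  proof (rule mlinear_edge_sum_env)
    show "mlinear (\<lambda>W. (1/2880) *\<^sub>c edge_sum [0, 1] ((env V V (e undefined))(4 := W)) (A2_comb 3 4))"
      by (intro mlinear_cscale mlinear_edge_sum vector_field_env vector_field_e V linear_tensors) simp_all
  qed (simp add: A2 V env_upd del: One_nat_def edge_sum.simps fun_upd_apply)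
qed

lemma mlinear_B:
  assumes V: "vector_field V" "vector_field U"
  shows "mlinear (\<lambda>W. B W V U)" "mlinear (\<lambda>W. B V W U)" "mlinear (B V U)"
proof -
  have B: "2880 *\<^sub>c B W X Y = edge_sum [0, 1] (env W X Y) (B_comb 3 4 5)"
    if "vector_field W" "vector_field X" "vector_field Y" for W X Y
    using that B_conv_edge_sum[of "env W X Y" 3 4 5]
    by (simp add: vector_field_env half_edges_tensors del: One_nat_def edge_sum.simps)
  show "mlinear (\<lambda>W. B W V U)"
  proof (rule mlinear_edge_sum_env)
    show "mlinear (\<lambda>W. (1/2880) *\<^sub>c edge_sum [0, 1] ((env V V U)(3 := W)) (B_comb 3 4 5))"
      by (intro mlinear_cscale mlinear_edge_sum vector_field_env V linear_tensors) simp_all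
  qed (simp add: B V env_upd del: One_nat_def edge_sum.simps fun_upd_apply)
  show "mlinear (\<lambda>W. B V W U)"
  proof (rule mlinear_edge_sum_env)
    show "mlinear (\<lambda>W. (1/2880) *\<^sub>c edge_sum [0, 1] ((env V V U)(4 := W)) (B_comb 3 4 5))"
      by (intro mlinear_cscale mlinear_edge_sum vector_field_env V linear_tensors) simp_all
  qed (simp add: B V env_upd del: One_nat_def edge_sum.simps fun_upd_apply)
  show "mlinear (B V U)"
  proof (rule mlinear_edge_sum_env)
    show "mlinear (\<lambda>W. (1/2880) *\<^sub>c edge_sum [0, 1] ((env V U V)(5 := W)) (B_comb 3 4 5))"
      by (intro mlinear_cscale mlinear_edge_sum vector_field_env V linear_tensors) simp_all
  qed (simp add: B V env_upd del: One_nat_def edge_sum.simps fun_upd_apply)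
qed

text \<open>The index shift sends coordinate fields to coordinate fields, and the components of
  \<open>\<tau>_plus W\<close> outside the image of the shift vanish.\<close>

lemma mlinear_\<tau>_plus:
  assumes f: "mlinear f"
  shows "mlinear (\<lambda>W. f (\<tau>_plus W))"
proof (rule mlinearI)
  fix W :: "(nat \<times> 'n) vfield" assume W: "vector_field W"
  let ?s = "\<lambda>(n, \<alpha>). (Suc n, \<alpha>) :: nat \<times> 'n"
  have s: "\<tau>_plus W (?s v) = W v" "inj ?s" for v
    by (auto simp: \<tau>_plus_def inj_def split: prod.split)
  have coord: "\<tau>_plus (coord v) = coord (?s v)" for v :: "nat \<times> 'n"
    by (auto simp: \<tau>_plus_def coord_def fun_eq_iff split: nat.split prod.split)
  have "f (\<tau>_plus W) = msum (\<lambda>u. \<tau>_plus W u * f (coord u))"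
    using W by (intro mlinearD f) simp
  also have "\<dots> = msum (\<lambda>v. W v * f (coord (?s v)))"
  proof (rule mfps_eqI_agree)
    fix m
    let ?S = "low_support W m"
    have fin: "finite ?S"
      using W by (simp add: finite_low_support vector_field_def)
    have "low_support (\<tau>_plus W) m \<subseteq> ?s ` ?S"
      by (force simp: low_support_def \<tau>_plus_def image_iff split: nat.splits)
    then have "agree m (msum (\<lambda>u. \<tau>_plus W u * f (coord u))) (\<Sum>u\<in>?s ` ?S. \<tau>_plus W u * f (coord u))"
      using fin by (intro agree_msum) auto
    also have "\<dots> = (\<Sum>v\<in>?S. W v * f (coord (?s v)))"
      using s by (subst sum.reindex) (auto intro: inj_on_subset)
    also have "agree m \<dots> (msum (\<lambda>v. W v * f (coord (?s v))))"
      by (rule agree_sym[OF agree_msum[OF fin order_refl]])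
    finally show "agree m (msum (\<lambda>u. \<tau>_plus W u * f (coord u))) (msum (\<lambda>v. W v * f (coord (?s v))))" .
  qed
  finally show "f (\<tau>_plus W) = msum (\<lambda>v. W v * f (\<tau>_plus (coord v)))"
    by (simp only: coord)
qed

lemma mlinear_T:
  assumes f: "mlinear f"
  shows "mlinear (\<lambda>W. f (T W))"
proof (rule mlinear_cong)
  show "mlinear (\<lambda>W. f (\<tau>_plus W) - (\<Sum>i\<in>UNIV. \<llangle>[W, e i]\<rrangle>\<^sub>0 * f (e i)))"
    by (intro mlinear_diff mlinear_\<tau>_plus f mlinear_sum mlinear_mult_right mlinear_contract)
qed (simp only: mlinear_T_apply[OF f])

lemma mlinear_qprod:
  assumes f: "mlinear f" and V: "vector_field V"
  shows "mlinear (\<lambda>W. f (W \<star> V))" "mlinear (\<lambda>W. f (V \<star> W))"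
  unfolding mlinear_qprod_apply[OF f]
  using V mlinear_contract_at[of "[V]" "potential 0"]
  by (auto intro!: mlinear_sum mlinear_mult_right mlinear_contract)

lemma mlinear_along: "mlinear (\<lambda>V. along V f)"
  unfolding along_conv_contract by (rule mlinear_contract)

text \<open>On coordinate fields the correction term of the covariant derivative drops out;
  linearity extends this to the other fields.\<close>

lemma
  assumes "vector_field V"
  shows mlinear_cov_deriv: "mlinear (\<lambda>W. cov_deriv V (\<lambda>Ws. A1 (Ws ! 0)) [W])"
    and cov_deriv_coord: "cov_deriv V (\<lambda>Ws. A1 (Ws ! 0)) [coord v] = along V (A1 (coord v))"
proof -
  note cov = cov_deriv_mlinear[OF mlinear_A1 assms]
  show coord: "cov_deriv V (\<lambda>Ws. A1 (Ws ! 0)) [coord v] = along V (A1 (coord v))" for v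
    by (subst cov) simp_all
  show "mlinear (\<lambda>W. cov_deriv V (\<lambda>Ws. A1 (Ws ! 0)) [W])"
    by (rule mlinearI) (simp only: coord cov)
qed

text \<open>\<open>V\<close> is placed on a label \<open>z\<close> that is fresh for the graphs. It
  is not assumed parallel, since it will be \<open>T X\<close> or a product of two fields.\<close>

lemma along_A1:
  assumes V: "vector_field V" and \<rho>: "\<And>n. n \<in> {0, 1, w} \<Longrightarrow> constant_field (\<rho> n)" "\<And>n. vector_field (\<rho> n)"
    and w: "half_edges 0 1 (A1_half w)" "w \<notin> {0, 1, 6, 7}"
      "list_all (\<lambda>(c, m). \<forall>n \<in> set (legs m). n \<in> {0, 1, w}) (A1_comb w)"
    and z: "z \<notin> {0, 1, w}"
  shows "2880 *\<^sub>c along V (A1 (\<rho> w)) = edge_sum [0, 1] (\<rho>(z := V)) (insert_leg z (A1_comb w))"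
proof -
  let ?\<rho> = "\<rho>(z := V)"
  have vf: "vector_field (?\<rho> n)" for n
    using V \<rho> by simp
  have "2880 *\<^sub>c along V (A1 (\<rho> w)) = along (?\<rho> z) (2880 *\<^sub>c A1 (?\<rho> w))"
    using V z by (simp add: along_cscale)
  also have "2880 *\<^sub>c A1 (?\<rho> w) = edge_sum [0, 1] ?\<rho> (A1_comb w)"
    by (rule A1_conv_edge_sum[OF vf w(1,2)])
  also have "along (?\<rho> z) \<dots> = edge_sum [0, 1] ?\<rho> (insert_leg z (A1_comb w))"
  proof (rule along_edge_sum)
    fix c m n assume "(c, m) \<in> set (A1_comb w)" "n \<in> set (legs m)"
    then have "n \<in> {0, 1, w}"
      using w(3) by (auto simp: list_all_iff)
    then show "constant_field (?\<rho> n)"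
      using \<rho>(1)[of n] z by auto
  qed (use V z in auto)
  finally show ?thesis .
qed

end

section \<open>Vanishing of the two certified combinations\<close>

locale gw_relations = gw_recursion \<eta> GW
  for \<eta> :: "complex ^ 'n::finite ^ 'n" and GW :: "nat \<Rightarrow> (nat \<times> 'n) list \<Rightarrow> complex" +
  assumes G_eq_0: "\<And>W1 W2 W3 W4. vector_field W1 \<Longrightarrow> vector_field W2 \<Longrightarrow> vector_field W3 \<Longrightarrow>
    vector_field W4 \<Longrightarrow> G W1 W2 W3 W4 = 0"
begin

lemma vanish_G:
  assumes "half_edges 1 2 (G_half w x y z)"
    "w \<notin> {1, 2, 7, 8}" "x \<notin> {1, 2, 7, 8}" "y \<notin> {1, 2, 7, 8}" "z \<notin> {1, 2, 7, 8}"
  shows "vanish [1, 2] (G_comb w x y z)"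
  unfolding G_comb_def vanish_collect unfolding vanish_def
proof (intro allI impI)
  fix \<rho> :: "nat \<Rightarrow> (nat \<times> 'n) vfield"
  assume "\<forall>n. constant_field (\<rho> n)"
  then have \<rho>: "vector_field (\<rho> n)" for n by simp
  have "edge_sum [1, 2] \<rho> (lower (G_half w x y z)) = half_edge_sum 1 2 \<rho> (G_half w x y z)"
    by (rule half_edge_sum_conv_edge_sum[OF \<rho> assms(1), symmetric])
  also have "\<dots> = 24 *\<^sub>c G (\<rho> w) (\<rho> x) (\<rho> y) (\<rho> z)"
    using \<rho> assms(2-) by (rule G_half[symmetric])
  finally show "edge_sum [1, 2] \<rho> (lower (G_half w x y z)) = 0"
    using \<rho> by (simp add: G_eq_0 del: One_nat_def edge_sum.simps)
qed

lemma vanish_WDVV_sum: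
  assumes "WDVV_admissible l"
  shows "vanish [0, 1, 2] (WDVV_sum l)"
proof -
  have "vanish [2] (WDVV_sum l)"
    using assms
  proof (induction l)
    case Nil
    show ?case by (simp add: WDVV_sum_def vanish_def)
  next
    case (Cons t l)
    obtain k q a b c d xs where t: "t = (k, q, (a, b, c, d), xs)"
      by (metis prod.exhaust)
    have "vanish [2] (scale_comb k (attach q (WDVV_comb a b c d xs)))"
      using Cons.prems by (intro vanish_scale vanish_attach vanish_WDVV)
        (simp_all add: t WDVV_admissible_def)
    moreover have "vanish [2] (WDVV_sum l)"
      using Cons by (simp add: WDVV_admissible_def)
    ultimately show ?case
      unfolding WDVV_sum_def t by (simp add: vanish_append)
  qed
  then show ?thesis
    by (rule vanish_Cons[OF vanish_Cons])
qed

lemma vanish_append_left: "vanish ns (p @ q) \<Longrightarrow> vanish ns q \<Longrightarrow> vanish ns p"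
  by (simp add: vanish_def)

lemma vanish_equation1: "vanish [0, 1, 2] equation1"
proof (rule vanish_append_left[OF vanish_cancels[OF cancels_equation1]])
  \<comment> \<open>Label 0 stands on two legs of Getzler's relation; summing over it closes
    them.\<close>
  have "vanish [0, 1, 2] (G_comb 3 4 0 0)"
    by (intro vanish_Cons[of "[1, 2]"] vanish_G half_edges_tensors) simp_all
  then show "vanish [0, 1, 2] (G_comb 3 4 0 0 @ WDVV_sum WDVV_terms1)"
    by (intro vanish_append vanish_WDVV_sum WDVV_admissible_terms)
qed

lemma vanish_equation2: "vanish [0, 1, 2] equation2"
proof (rule vanish_append_left[OF vanish_cancels[OF cancels_equation2]])
  have "vanish [1, 2] (G_comb 3 4 5 0)" "vanish [1, 2] (G_comb 3 4 0 0)"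
    "vanish [1, 2] (G_comb 4 5 0 0)" "vanish [1, 2] (G_comb 3 5 0 0)"
    by (intro vanish_G half_edges_tensors; simp)+
  \<comment> \<open>Factors and derivatives are added while label 0 is still free, so that a
    derivative along it makes sense; it is bound only afterwards.\<close>
  then have "vanish [1, 2] (scale_comb (-96) (attach [(1, [0])] (G_comb 3 4 5 0)))"
    "vanish [1, 2] (scale_comb (-1) (insert_leg 5 (G_comb 3 4 0 0)))" "vanish [1, 2] (insert_leg 3 (G_comb 4 5 0 0))"
    "vanish [1, 2] (insert_leg 4 (G_comb 3 5 0 0))" "vanish [1, 2] (scale_comb (-4) (insert_leg 0 (G_comb 3 4 5 0)))"
    by (intro vanish_scale vanish_attach vanish_insert_leg; simp add: legs_def)+
  then show "vanish [0, 1, 2] (scale_comb (-96) (attach [(1, [0])] (G_comb 3 4 5 0)) @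
     scale_comb (-1) (insert_leg 5 (G_comb 3 4 0 0)) @ insert_leg 3 (G_comb 4 5 0 0) @
     insert_leg 4 (G_comb 3 5 0 0) @ scale_comb (-4) (insert_leg 0 (G_comb 3 4 5 0)) @
     WDVV_sum WDVV_terms2)"
    by (intro vanish_append vanish_WDVV_sum WDVV_admissible_terms vanish_Cons[of "[1, 2]"])
qed

section \<open>The equations for parallel fields\<close>

lemma equation1_coord:
  assumes X: "constant_field X" and Y: "constant_field Y"
  shows "A2 X (T Y) - along (T X) (A1 Y) = 0"
proof -
  let ?\<rho> = "env X Y (e undefined)"
  have \<rho>: "constant_field (?\<rho> n)" for n
    using X Y by (intro constant_field_env) auto
  have vf: "vector_field (env (T X) Y (e undefined) n)" "vector_field (env X (T Y) (e undefined) n)" for n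
    using X Y by (intro vector_field_env; simp)+
  \<comment> \<open>\<open>T Y\<close> cannot itself belong to a parallel environment; it enters as
    an update on leg 4 of one, the form in which \<open>T\<close> can be eliminated.\<close>
  have "24 *\<^sub>c 2880 *\<^sub>c A2 X (T Y) = 24 *\<^sub>c edge_sum [0, 1] (?\<rho>(4 := T (?\<rho> 4))) (A2_comb 3 4)"
    using A2_conv_edge_sum[where \<rho> = "env X (T Y) (e undefined)", OF vf(2), of 3 4] half_edges_tensors by (simp add: env_upd del: One_nat_def edge_sum.simps fun_upd_apply)
  also have "\<dots> = edge_sum ([0, 1] @ [2]) ?\<rho> (eliminate_T 4 (A2_comb 3 4))"
    by (intro edge_sum_eliminate_T \<rho> T_eliminable_tensors) simp_all
  finally have A2: "69120 *\<^sub>c A2 X (T Y) = edge_sum [0, 1, 2] ?\<rho> (eliminate_T 4 (A2_comb 3 4))"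
    by (simp del: One_nat_def edge_sum.simps)
  have "24 *\<^sub>c 2880 *\<^sub>c along (T X) (A1 Y) = 24 *\<^sub>c edge_sum [0, 1] (?\<rho>(3 := T (?\<rho> 3))) (insert_leg 3 (A1_comb 4))"
    using along_A1[of "T X" 4 ?\<rho> 3] \<rho> X half_edges_tensors A1_comb_legs
    by (simp del: One_nat_def edge_sum.simps fun_upd_apply)
  also have "\<dots> = edge_sum ([0, 1] @ [2]) ?\<rho> (eliminate_T 3 (insert_leg 3 (A1_comb 4)))"
    by (intro edge_sum_eliminate_T \<rho> T_eliminable_tensors) simp_all
  finally have A1: "69120 *\<^sub>c along (T X) (A1 Y) = edge_sum [0, 1, 2] ?\<rho> (eliminate_T 3 (insert_leg 3 (A1_comb 4)))"
    by (simp del: One_nat_def edge_sum.simps)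
  have "69120 *\<^sub>c (A2 X (T Y) - along (T X) (A1 Y)) = edge_sum [0, 1, 2] ?\<rho> equation1"
    by (simp add: cscale_diff_right A1 A2 equation1_def cscale_minus_left del: One_nat_def edge_sum.simps)
  also have "\<dots> = 0"
    using vanish_equation1 \<rho> by (rule vanishD)
  finally show ?thesis
    by (simp only: cscale_eq_0_iff) simp
qed

lemma equation2_coord:
  assumes X: "constant_field X" and Y: "constant_field Y" and Z: "constant_field Z"
  shows "B X Y (T Z) - A2 (X \<star> Y) Z + along (X \<star> Y) (A1 Z) = 0"
proof -
  let ?\<rho> = "env X Y Z"
  have \<rho>: "constant_field (?\<rho> n)" for n
    using X Y Z by (intro constant_field_env) auto
  have vf: "vector_field (env X Y (T Z) n)" "vector_field ((?\<rho>(2 := X \<star> Y)) n)" for n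
    using X Y Z by (simp_all add: vector_field_env)
  have "24 *\<^sub>c 2880 *\<^sub>c B X Y (T Z) = 24 *\<^sub>c edge_sum [0, 1] (?\<rho>(5 := T (?\<rho> 5))) (B_comb 3 4 5)"
    using B_conv_edge_sum[where \<rho> = "env X Y (T Z)", OF vf(1), of 3 4 5] half_edges_tensors by (simp add: env_upd del: One_nat_def edge_sum.simps fun_upd_apply)
  also have "\<dots> = edge_sum ([0, 1] @ [2]) ?\<rho> (eliminate_T 5 (B_comb 3 4 5))"
    by (intro edge_sum_eliminate_T \<rho> T_eliminable_tensors) simp_all
  finally have B: "69120 *\<^sub>c B X Y (T Z) = edge_sum [0, 1, 2] ?\<rho> (eliminate_T 5 (B_comb 3 4 5))"
    by (simp del: One_nat_def edge_sum.simps)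
  \<comment> \<open>The product on leg 2 is not parallel in general; turning it into an edge leaves
    only the parallel environment of \<open>X\<close>, \<open>Y\<close>, \<open>Z\<close>.\<close>
  have qprod: "edge_sum [0, 1] (?\<rho>(2 := X \<star> Y)) p = edge_sum [0, 1, 2] ?\<rho> (attach [(0, [3, 4, 2])] p)"
    if "list_all (\<lambda>(c, m). count_list (legs m) 2 = 1) p" for p
    using edge_sum_qprod[of ?\<rho> 3 "[0, 1]" 4 2 p] \<rho> that
    by (simp add: edge_sum_rotate del: One_nat_def edge_sum.simps fun_upd_apply)
  have times24: "69120 *\<^sub>c f = 24 *\<^sub>c 2880 *\<^sub>c f" for f :: "(nat \<times> 'n) mfps"
    by simp
  have "2880 *\<^sub>c A2 (X \<star> Y) Z = edge_sum [0, 1] (?\<rho>(2 := X \<star> Y)) (A2_comb 2 5)"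
    using A2_conv_edge_sum[where \<rho> = "?\<rho>(2 := X \<star> Y)", OF vf(2), of 2 5] half_edges_tensors by (simp del: One_nat_def edge_sum.simps)
  then have A2: "69120 *\<^sub>c A2 (X \<star> Y) Z = 24 *\<^sub>c edge_sum [0, 1, 2] ?\<rho> (attach [(0, [3, 4, 2])] (A2_comb 2 5))"
    using times24[of "A2 (X \<star> Y) Z"] by (simp only: qprod linear_tensors)
  have "2880 *\<^sub>c along (X \<star> Y) (A1 Z) = edge_sum [0, 1] (?\<rho>(2 := X \<star> Y)) (insert_leg 2 (A1_comb 5))"
    using along_A1[of "X \<star> Y" 5 ?\<rho> 2] \<rho> half_edges_tensors A1_comb_legs
    by (simp del: One_nat_def edge_sum.simps fun_upd_apply)
  then have A1: "69120 *\<^sub>c along (X \<star> Y) (A1 Z) =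
      24 *\<^sub>c edge_sum [0, 1, 2] ?\<rho> (attach [(0, [3, 4, 2])] (insert_leg 2 (A1_comb 5)))"
    using times24[of "along (X \<star> Y) (A1 Z)"] by (simp only: qprod linear_tensors)
  have "69120 *\<^sub>c (B X Y (T Z) - A2 (X \<star> Y) Z + along (X \<star> Y) (A1 Z)) = edge_sum [0, 1, 2] ?\<rho> equation2"
    by (simp add: cscale_diff_right cscale_add_right A1 A2 B equation2_def cscale_minus_left del: One_nat_def edge_sum.simps)
  also have "\<dots> = 0"
    using vanish_equation2 \<rho> by (rule vanishD)
  finally show ?thesis
    by (simp only: cscale_eq_0_iff) simp
qed

section \<open>Extension to all vector fields\<close>

lemma equation1:
  assumes W1: "vector_field W1" and W2: "vector_field W2"
  shows "A2 W1 (T W2) - cov_deriv (T W1) (\<lambda>Ws. A1 (Ws ! 0)) [W2] = 0"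
proof (rule mlinear_eqI[OF _ W2])
  show "mlinear (\<lambda>W2. A2 W1 (T W2) - cov_deriv (T W1) (\<lambda>Ws. A1 (Ws ! 0)) [W2])"
    using W1 by (intro mlinear_diff mlinear_T mlinear_A2 mlinear_cov_deriv) simp_all
  \<comment> \<open>The argument of A_1 is specialized before the direction: on a coordinate field
    the covariant derivative becomes \<open>along\<close>, which is linear in the direction.\<close>
  fix v
  show "A2 W1 (T (coord v)) - cov_deriv (T W1) (\<lambda>Ws. A1 (Ws ! 0)) [coord v] = 0"
    unfolding cov_deriv_coord[OF vector_field_T[OF W1]]
  proof (rule mlinear_eqI[OF _ W1])
    show "mlinear (\<lambda>W1. A2 W1 (T (coord v)) - along (T W1) (A1 (coord v)))"
      by (intro mlinear_diff mlinear_A2 mlinear_T[OF mlinear_along]) simp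
  qed (simp add: equation1_coord)
qed

lemma equation2:
  assumes W1: "vector_field W1" and W2: "vector_field W2" and W3: "vector_field W3"
  shows "B W1 W2 (T W3) - A2 (W1 \<star> W2) W3 + cov_deriv (W1 \<star> W2) (\<lambda>Ws. A1 (Ws ! 0)) [W3] = 0"
proof (rule mlinear_eqI[OF _ W3])
  show "mlinear (\<lambda>W3. B W1 W2 (T W3) - A2 (W1 \<star> W2) W3 + cov_deriv (W1 \<star> W2) (\<lambda>Ws. A1 (Ws ! 0)) [W3])"
    using W1 W2 by (intro mlinear_add mlinear_diff mlinear_T mlinear_B mlinear_A2 mlinear_cov_deriv) simp_all
  fix v
  show "B W1 W2 (T (coord v)) - A2 (W1 \<star> W2) (coord v) + cov_deriv (W1 \<star> W2) (\<lambda>Ws. A1 (Ws ! 0)) [coord v] = 0"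
    unfolding cov_deriv_coord[OF vector_field_qprod]
  proof (rule mlinear_eqI[OF _ W1])
    show "mlinear (\<lambda>W1. B W1 W2 (T (coord v)) - A2 (W1 \<star> W2) (coord v) + along (W1 \<star> W2) (A1 (coord v)))"
      using W2 mlinear_qprod(1)[OF mlinear_along] mlinear_qprod(1)[OF mlinear_A2(1)]
      by (intro mlinear_add mlinear_diff mlinear_B) simp_all
    fix u
    show "B (coord u) W2 (T (coord v)) - A2 (coord u \<star> W2) (coord v) + along (coord u \<star> W2) (A1 (coord v)) = 0"
    proof (rule mlinear_eqI[OF _ W2])
      show "mlinear (\<lambda>W2. B (coord u) W2 (T (coord v)) - A2 (coord u \<star> W2) (coord v) +
          along (coord u \<star> W2) (A1 (coord v)))"
        using mlinear_qprod(2)[OF mlinear_along] mlinear_qprod(2)[OF mlinear_A2(1)]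
        by (intro mlinear_add mlinear_diff mlinear_B) simp_all
    qed (simp add: equation2_coord)
  qed
qed

end

theorem theorem3p1:
  fixes \<eta> :: "complex ^ 'n::finite ^ 'n"
    and GW :: "nat \<Rightarrow> (nat \<times> 'n) list \<Rightarrow> complex"
  assumes "gw_data \<eta> GW"
    and "\<And>W1 W2 W3. vector_field W1 \<Longrightarrow> vector_field W2 \<Longrightarrow> vector_field W3 \<Longrightarrow>
           gw_data.\<rho>0 \<eta> GW W1 W2 W3 = 0"
    and "\<And>W1 W2 W3 W4. vector_field W1 \<Longrightarrow> vector_field W2 \<Longrightarrow> vector_field W3 \<Longrightarrow>
           vector_field W4 \<Longrightarrow> gw_data.C0 \<eta> GW W1 W2 W3 W4 = 0"
    and "\<And>W. vector_field W \<Longrightarrow> gw_data.\<rho>1 \<eta> GW W = 0"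
    and "\<And>W1 W2 W3 W4. vector_field W1 \<Longrightarrow> vector_field W2 \<Longrightarrow> vector_field W3 \<Longrightarrow>
           vector_field W4 \<Longrightarrow> gw_data.G \<eta> GW W1 W2 W3 W4 = 0"
  shows "(\<forall>W1 W2. vector_field W1 \<longrightarrow> vector_field W2 \<longrightarrow>
            gw_data.A2 \<eta> GW W1 (gw_data.T \<eta> GW W2)
            - cov_deriv (gw_data.T \<eta> GW W1) (\<lambda>Ws. gw_data.A1 \<eta> GW (Ws ! 0)) [W2] = 0)
       \<and> (\<forall>W1 W2 W3. vector_field W1 \<longrightarrow> vector_field W2 \<longrightarrow> vector_field W3 \<longrightarrow>
            gw_data.B \<eta> GW W1 W2 (gw_data.T \<eta> GW W3)
            - gw_data.A2 \<eta> GW (gw_data.qprod \<eta> GW W1 W2) W3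
            + cov_deriv (gw_data.qprod \<eta> GW W1 W2) (\<lambda>Ws. gw_data.A1 \<eta> GW (Ws ! 0)) [W3] = 0)"
proof -
  interpret gw_data \<eta> GW by fact
  interpret gw_relations \<eta> GW
    using assms(2,4,5) by unfold_locales
  show ?thesis
    using equation1 equation2 by blast
qed

end
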